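(* Let $Y$ be a regular indecomposable representation of $(T(n),\Omega)$ (or of $(T(n),\sigma\Omega)$). Then $Y$ is a sink module (resp. a flow module, resp. a source module) if and only if $\eta Y$ is a sink module (resp. a flow module, resp. a source module). Moreover $\eta Y$ has the same center as $Y$, and $r(\eta Y)=r(Y)+2$.
   Context: Let $k$ be a field and $n\ge 3$. $T(n)$ is the $n$-regular tree; fix a bipartite orientation $\Omega$ (every vertex a sink or a source), and let $\sigma\Omega$ be the opposite orientation. A module is a finite-dimensional $k$-representation of $(T(n),\Omega)$ or $(T(n),\sigma\Omega)$. The shift functor $\sigma$ is the composition of the Bernstein–Gelfand–Ponomarev reflection functors at all sinks; an indecomposable module $M$ is regular if $\sigma^tM\neq0$ for all $t\in\mathbb Z$ (with $\sigma^t$, $t<0$, the powers of the left adjoint $\sigma^-$). For indecomposable $M$: $T(M)$ is the full subgraph of $T(n)$ on vertices $a$ with $M_a\neq 0$; a diameter path is a path (sequence of vertices, consecutive ones neighbours, no immediate backtracking) in $T(M)$ of maximal length $d(M)$; a path of length $2r$ has center its middle vertex, a path of length $2r+1$ has center its middle edge; all diameter paths have the same center, the center of $M$; $r(M)=\lfloor d(M)/2\rfloor$. $M$ is a sink (resp. source) module if its diameter paths start and end at sinks (resp. sources) of the orientation of its quiver, and a flow module if $d(M)$ is odd. The categories $\mathrm{mod}(T(n),\Omega)$ and $\mathrm{mod}(T(n),\sigma\Omega)$ have Auslander–Reiten sequences and their regular Auslander–Reiten components are of the form $\mathbb Z\mathbb A_\infty$. For a regular indecomposable $Y$, $\eta Y$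 denotes the indecomposable module $Y'$ (unique up to isomorphism) such that there is an Auslander–Reiten sequence $0\to X\to Y\oplus Y'\to Z\to0$ with $|Y|<|Y'|$, where $|\cdot|$ denotes length. *)

theory Defs
  imports "Jordan_Normal_Form.Matrix"
begin

definition nb_path :: "('v \<Rightarrow> 'v \<Rightarrow> bool) \<Rightarrow> 'v set \<Rightarrow> 'v list \<Rightarrow> bool" where
  "nb_path adj S xs \<longleftrightarrow> xs \<noteq> [] \<and> set xs \<subseteq> S
     \<and> (\<forall>i. i + 1 < length xs \<longrightarrow> adj (xs ! i) (xs ! (i + 1)))
     \<and> (\<forall>i. i + 2 < length xs \<longrightarrow> xs ! i \<noteq> xs ! (i + 2))"

definition plen :: "'v list \<Rightarrow> nat" where
  "plen xs = length xs - 1"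

definition regular_tree :: "('v \<Rightarrow> 'v \<Rightarrow> bool) \<Rightarrow> nat \<Rightarrow> bool" where
  "regular_tree adj n \<longleftrightarrow>
     (\<forall>a b. adj a b \<longrightarrow> adj b a) \<and> (\<forall>a. \<not> adj a a)
     \<and> (\<forall>a b. adj\<^sup>*\<^sup>* a b)
     \<and> (\<forall>xs. nb_path adj UNIV xs \<and> plen xs \<ge> 1 \<longrightarrow> hd xs \<noteq> last xs)
     \<and> (\<forall>a. finite {b. adj a b} \<and> card {b. adj a b} = n)"

text \<open>A bipartite orientation: sk a means that a is a sink; every vertex is a sink or a
  source and neighbours have opposite type. The arrows go from sources to neighbouring
  sinks. The opposite orientation (sigma Omega) is (\<lambda>v. \<not> sk v).\<close>
definition bipartite_orientation :: "('v \<Rightarrow> 'v \<Rightarrow> bool) \<Rightarrow> ('v \<Rightarrow> bool) \<Rightarrow> bool" where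
  "bipartite_orientation adj sk \<longleftrightarrow> (\<forall>a b. adj a b \<longrightarrow> (sk a \<longleftrightarrow> \<not> sk b))"

text \<open>A representation assigns to each vertex a the space k^(dimv a) and to each arrow
  b \<rightarrow> a (a a sink, b an adjacent source) the matrix mapv a b (target first).\<close>
record ('v, 'k) rep =
  dimv :: "'v \<Rightarrow> nat"
  mapv :: "'v \<Rightarrow> 'v \<Rightarrow> 'k mat"

definition support :: "('v, 'k) rep \<Rightarrow> 'v set" where
  "support M = {a. dimv M a \<noteq> 0}"

definition valid_rep :: "('v \<Rightarrow> 'v \<Rightarrow> bool) \<Rightarrow> ('v \<Rightarrow> bool) \<Rightarrow> ('v, 'k) rep \<Rightarrow> bool" where
  "valid_rep adj sk M \<longleftrightarrow> finite (support M)
     \<and> (\<forall>a b. adj a b \<and> sk a \<longrightarrow> mapv M a b \<in> carrier_mat (dimv M a) (dimv M b))"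

definition nonzero_rep :: "('v, 'k) rep \<Rightarrow> bool" where
  "nonzero_rep M \<longleftrightarrow> (\<exists>a. dimv M a \<noteq> 0)"

text \<open>Length (composition length) = total dimension.\<close>
definition rep_length :: "('v, 'k) rep \<Rightarrow> nat" where
  "rep_length M = (\<Sum>a\<in>support M. dimv M a)"

definition morph :: "('v \<Rightarrow> 'v \<Rightarrow> bool) \<Rightarrow> ('v \<Rightarrow> bool) \<Rightarrow> ('v, 'k::field) rep
     \<Rightarrow> ('v, 'k) rep \<Rightarrow> ('v \<Rightarrow> 'k mat) \<Rightarrow> bool" where
  "morph adj sk M N f \<longleftrightarrow> (\<forall>a. f a \<in> carrier_mat (dimv N a) (dimv M a))
     \<and> (\<forall>a b. adj a b \<and> sk a \<longrightarrow> mapv N a b * f b = f a * mapv M a b)"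

definition rep_iso :: "('v \<Rightarrow> 'v \<Rightarrow> bool) \<Rightarrow> ('v \<Rightarrow> bool) \<Rightarrow> ('v, 'k::field) rep
     \<Rightarrow> ('v, 'k) rep \<Rightarrow> bool" where
  "rep_iso adj sk M N \<longleftrightarrow> (\<exists>f g. morph adj sk M N f \<and> morph adj sk N M g
     \<and> (\<forall>a. g a * f a = 1\<^sub>m (dimv M a)) \<and> (\<forall>a. f a * g a = 1\<^sub>m (dimv N a)))"

definition dsum :: "('v, 'k::field) rep \<Rightarrow> ('v, 'k) rep \<Rightarrow> ('v, 'k) rep" where
  "dsum M N = \<lparr> dimv = (\<lambda>a. dimv M a + dimv N a),
     mapv = (\<lambda>a b. four_block_mat (mapv M a b) (0\<^sub>m (dimv M a) (dimv N b))
                                  (0\<^sub>m (dimv N a) (dimv M b)) (mapv N a b)) \<rparr>"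

definition indecomposable :: "('v \<Rightarrow> 'v \<Rightarrow> bool) \<Rightarrow> ('v \<Rightarrow> bool) \<Rightarrow> ('v, 'k::field) rep \<Rightarrow> bool" where
  "indecomposable adj sk M \<longleftrightarrow> valid_rep adj sk M \<and> nonzero_rep M
     \<and> (\<forall>M1 M2. valid_rep adj sk M1 \<and> valid_rep adj sk M2 \<and> rep_iso adj sk M (dsum M1 M2)
          \<longrightarrow> \<not> nonzero_rep M1 \<or> \<not> nonzero_rep M2)"

definition split_epi :: "('v \<Rightarrow> 'v \<Rightarrow> bool) \<Rightarrow> ('v \<Rightarrow> bool) \<Rightarrow> ('v, 'k::field) rep
     \<Rightarrow> ('v, 'k) rep \<Rightarrow> ('v \<Rightarrow> 'k mat) \<Rightarrow> bool" where
  "split_epi adj sk E Z g \<longleftrightarrow> (\<exists>s. morph adj sk Z E s \<and> (\<forall>a. g a * s a = 1\<^sub>m (dimv Z a)))"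

definition split_mono :: "('v \<Rightarrow> 'v \<Rightarrow> bool) \<Rightarrow> ('v \<Rightarrow> bool) \<Rightarrow> ('v, 'k::field) rep
     \<Rightarrow> ('v, 'k) rep \<Rightarrow> ('v \<Rightarrow> 'k mat) \<Rightarrow> bool" where
  "split_mono adj sk X E f \<longleftrightarrow> (\<exists>r. morph adj sk E X r \<and> (\<forall>a. r a * f a = 1\<^sub>m (dimv X a)))"

definition right_almost_split :: "('v \<Rightarrow> 'v \<Rightarrow> bool) \<Rightarrow> ('v \<Rightarrow> bool) \<Rightarrow> ('v, 'k::field) rep
     \<Rightarrow> ('v, 'k) rep \<Rightarrow> ('v \<Rightarrow> 'k mat) \<Rightarrow> bool" where
  "right_almost_split adj sk E Z g \<longleftrightarrow> morph adj sk E Z g \<and> \<not> split_epi adj sk E Z g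
     \<and> (\<forall>W h. valid_rep adj sk W \<and> morph adj sk W Z h \<and> \<not> split_epi adj sk W Z h
          \<longrightarrow> (\<exists>h'. morph adj sk W E h' \<and> (\<forall>a. g a * h' a = h a)))"

definition left_almost_split :: "('v \<Rightarrow> 'v \<Rightarrow> bool) \<Rightarrow> ('v \<Rightarrow> bool) \<Rightarrow> ('v, 'k::field) rep
     \<Rightarrow> ('v, 'k) rep \<Rightarrow> ('v \<Rightarrow> 'k mat) \<Rightarrow> bool" where
  "left_almost_split adj sk X E f \<longleftrightarrow> morph adj sk X E f \<and> \<not> split_mono adj sk X E f
     \<and> (\<forall>W h. valid_rep adj sk W \<and> morph adj sk X W h \<and> \<not> split_mono adj sk X W h
          \<longrightarrow> (\<exists>h'. morph adj sk E W h' \<and> (\<forall>a. h' a * f a = h a)))"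

definition short_exact :: "('v \<Rightarrow> 'v \<Rightarrow> bool) \<Rightarrow> ('v \<Rightarrow> bool) \<Rightarrow> ('v, 'k::field) rep
     \<Rightarrow> ('v, 'k) rep \<Rightarrow> ('v, 'k) rep \<Rightarrow> ('v \<Rightarrow> 'k mat) \<Rightarrow> ('v \<Rightarrow> 'k mat) \<Rightarrow> bool" where
  "short_exact adj sk X E Z f g \<longleftrightarrow>
     valid_rep adj sk X \<and> valid_rep adj sk E \<and> valid_rep adj sk Z
     \<and> morph adj sk X E f \<and> morph adj sk E Z g
     \<and> (\<forall>a. (\<forall>u\<in>carrier_vec (dimv X a). f a *\<^sub>v u = 0\<^sub>v (dimv E a) \<longrightarrow> u = 0\<^sub>v (dimv X a))
          \<and> (\<forall>w\<in>carrier_vec (dimv Z a). \<exists>v\<in>carrier_vec (dimv E a). g a *\<^sub>v v = w)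
          \<and> (\<forall>v\<in>carrier_vec (dimv E a).
               g a *\<^sub>v v = 0\<^sub>v (dimv Z a) \<longleftrightarrow> (\<exists>u\<in>carrier_vec (dimv X a). f a *\<^sub>v u = v)))"

definition AR_sequence :: "('v \<Rightarrow> 'v \<Rightarrow> bool) \<Rightarrow> ('v \<Rightarrow> bool) \<Rightarrow> ('v, 'k::field) rep
     \<Rightarrow> ('v, 'k) rep \<Rightarrow> ('v, 'k) rep \<Rightarrow> ('v \<Rightarrow> 'k mat) \<Rightarrow> ('v \<Rightarrow> 'k mat) \<Rightarrow> bool" where
  "AR_sequence adj sk X E Z f g \<longleftrightarrow> short_exact adj sk X E Z f g
     \<and> left_almost_split adj sk X E f \<and> right_almost_split adj sk E Z g"

definition is_eta :: "('v \<Rightarrow> 'v \<Rightarrow> bool) \<Rightarrow> ('v \<Rightarrow> bool) \<Rightarrow> ('v, 'k::field) rep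
     \<Rightarrow> ('v, 'k) rep \<Rightarrow> bool" where
  "is_eta adj sk Y Y' \<longleftrightarrow> indecomposable adj sk Y' \<and> rep_length Y < rep_length Y'
     \<and> (\<exists>X E Z f g. AR_sequence adj sk X E Z f g \<and> rep_iso adj sk E (dsum Y Y'))"

text \<open>N \<cong> sigma M: reflection at all sinks of sk. M lives on sk, N on the opposite
  orientation. At a source b of sk, N_b = M_b; at a sink a of sk, N_a is the kernel of
  (M_(a,b))_b : \<Oplus>_{b~a} M_b \<rightarrow> M_a, with the new arrows a \<rightarrow> b the components of the
  inclusion.\<close>
definition sigma_rel :: "('v \<Rightarrow> 'v \<Rightarrow> bool) \<Rightarrow> ('v \<Rightarrow> bool) \<Rightarrow> ('v, 'k::field) rep
     \<Rightarrow> ('v, 'k) rep \<Rightarrow> bool" where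
  "sigma_rel adj sk M N \<longleftrightarrow> valid_rep adj sk M \<and> valid_rep adj (\<lambda>v. \<not> sk v) N
     \<and> (\<forall>b. \<not> sk b \<longrightarrow> dimv N b = dimv M b)
     \<and> (\<forall>a. sk a \<longrightarrow>
          (\<forall>u\<in>carrier_vec (dimv N a).
             (\<forall>b. adj a b \<longrightarrow> mapv N b a *\<^sub>v u = 0\<^sub>v (dimv M b)) \<longrightarrow> u = 0\<^sub>v (dimv N a))
        \<and> (\<forall>u\<in>carrier_vec (dimv N a). \<forall>i<dimv M a.
             (\<Sum>b\<in>{b. adj a b}. (mapv M a b *\<^sub>v (mapv N b a *\<^sub>v u)) $ i) = 0)
        \<and> (\<forall>x. (\<forall>b. adj a b \<longrightarrow> x b \<in> carrier_vec (dimv M b))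
              \<and> (\<forall>i<dimv M a. (\<Sum>b\<in>{b. adj a b}. (mapv M a b *\<^sub>v x b) $ i) = 0)
              \<longrightarrow> (\<exists>u\<in>carrier_vec (dimv N a). \<forall>b. adj a b \<longrightarrow> mapv N b a *\<^sub>v u = x b)))"

text \<open>N \<cong> sigma^- M: reflection at all sources of sk. At a sink a of sk, N_a = M_a; at a
  source b of sk, N_b is the cokernel of (M_(a,b))_a : M_b \<rightarrow> \<Oplus>_{a~b} M_a, with the new
  arrows a \<rightarrow> b the components of the projection.\<close>
definition sigma_minus_rel :: "('v \<Rightarrow> 'v \<Rightarrow> bool) \<Rightarrow> ('v \<Rightarrow> bool) \<Rightarrow> ('v, 'k::field) rep
     \<Rightarrow> ('v, 'k) rep \<Rightarrow> bool" where
  "sigma_minus_rel adj sk M N \<longleftrightarrow> valid_rep adj sk M \<and> valid_rep adj (\<lambda>v. \<not> sk v) N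
     \<and> (\<forall>a. sk a \<longrightarrow> dimv N a = dimv M a)
     \<and> (\<forall>b. \<not> sk b \<longrightarrow>
          (\<forall>w\<in>carrier_vec (dimv N b). \<exists>x. (\<forall>a. adj b a \<longrightarrow> x a \<in> carrier_vec (dimv M a))
              \<and> (\<forall>i<dimv N b. (\<Sum>a\<in>{a. adj b a}. (mapv N b a *\<^sub>v x a) $ i) = w $ i))
        \<and> (\<forall>u\<in>carrier_vec (dimv M b). \<forall>i<dimv N b.
             (\<Sum>a\<in>{a. adj b a}. (mapv N b a *\<^sub>v (mapv M a b *\<^sub>v u)) $ i) = 0)
        \<and> (\<forall>x. (\<forall>a. adj b a \<longrightarrow> x a \<in> carrier_vec (dimv M a))
              \<and> (\<forall>i<dimv N b. (\<Sum>a\<in>{a. adj b a}. (mapv N b a *\<^sub>v x a) $ i) = 0)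
              \<longrightarrow> (\<exists>u\<in>carrier_vec (dimv M b). \<forall>a. adj b a \<longrightarrow> mapv M a b *\<^sub>v u = x a)))"

fun sigma_pow :: "('v \<Rightarrow> 'v \<Rightarrow> bool) \<Rightarrow> ('v \<Rightarrow> bool) \<Rightarrow> nat \<Rightarrow> ('v, 'k::field) rep
     \<Rightarrow> ('v, 'k) rep \<Rightarrow> bool" where
  "sigma_pow adj sk 0 M N = (N = M)"
| "sigma_pow adj sk (Suc t) M N =
     (\<exists>P. sigma_rel adj sk M P \<and> sigma_pow adj (\<lambda>v. \<not> sk v) t P N)"

fun sigma_minus_pow :: "('v \<Rightarrow> 'v \<Rightarrow> bool) \<Rightarrow> ('v \<Rightarrow> bool) \<Rightarrow> nat \<Rightarrow> ('v, 'k::field) rep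
     \<Rightarrow> ('v, 'k) rep \<Rightarrow> bool" where
  "sigma_minus_pow adj sk 0 M N = (N = M)"
| "sigma_minus_pow adj sk (Suc t) M N =
     (\<exists>P. sigma_minus_rel adj sk M P \<and> sigma_minus_pow adj (\<lambda>v. \<not> sk v) t P N)"

definition regular_rep :: "('v \<Rightarrow> 'v \<Rightarrow> bool) \<Rightarrow> ('v \<Rightarrow> bool) \<Rightarrow> ('v, 'k::field) rep \<Rightarrow> bool" where
  "regular_rep adj sk M \<longleftrightarrow>
     (\<forall>t. \<exists>N. sigma_pow adj sk t M N \<and> nonzero_rep N)
     \<and> (\<forall>t. \<exists>N. sigma_minus_pow adj sk t M N \<and> nonzero_rep N)"

definition diameter :: "('v \<Rightarrow> 'v \<Rightarrow> bool) \<Rightarrow> ('v, 'k) rep \<Rightarrow> nat" where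
  "diameter adj M = Max {plen xs | xs. nb_path adj (support M) xs}"

definition diameter_path :: "('v \<Rightarrow> 'v \<Rightarrow> bool) \<Rightarrow> ('v, 'k) rep \<Rightarrow> 'v list \<Rightarrow> bool" where
  "diameter_path adj M xs \<longleftrightarrow> nb_path adj (support M) xs \<and> plen xs = diameter adj M"

definition path_center :: "'v list \<Rightarrow> 'v set" where
  "path_center xs = (if even (plen xs) then {xs ! (plen xs div 2)}
                     else {xs ! (plen xs div 2), xs ! (plen xs div 2 + 1)})"

definition center :: "('v \<Rightarrow> 'v \<Rightarrow> bool) \<Rightarrow> ('v, 'k) rep \<Rightarrow> 'v set" where
  "center adj M = path_center (SOME xs. diameter_path adj M xs)"

definition radius :: "('v \<Rightarrow> 'v \<Rightarrow> bool) \<Rightarrow> ('v, 'k) rep \<Rightarrow> nat" where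
  "radius adj M = diameter adj M div 2"

definition sink_module :: "('v \<Rightarrow> 'v \<Rightarrow> bool) \<Rightarrow> ('v \<Rightarrow> bool) \<Rightarrow> ('v, 'k) rep \<Rightarrow> bool" where
  "sink_module adj sk M \<longleftrightarrow> (\<forall>xs. diameter_path adj M xs \<longrightarrow> sk (hd xs) \<and> sk (last xs))"

definition source_module :: "('v \<Rightarrow> 'v \<Rightarrow> bool) \<Rightarrow> ('v \<Rightarrow> bool) \<Rightarrow> ('v, 'k) rep \<Rightarrow> bool" where
  "source_module adj sk M \<longleftrightarrow> (\<forall>xs. diameter_path adj M xs \<longrightarrow> \<not> sk (hd xs) \<and> \<not> sk (last xs))"

definition flow_module :: "('v \<Rightarrow> 'v \<Rightarrow> bool) \<Rightarrow> ('v, 'k) rep \<Rightarrow> bool" where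
  "flow_module adj M \<longleftrightarrow> odd (diameter adj M)"

end

(*
The AR sequence 0 -> X -> E -> Z -> 0 with E = Y + Y' gives irreducible maps u: X -> Y and v: Y -> Z, each
of which is injective or surjective. As |Y| < |Y'|, it is impossible that u is injective and v surjective.
If both were injective, sigma^2 Y would embed into sigma^2 Z = X and hence into Y, so the supports of all
sigma^t Y would stay in a fixed finite set; but a nonzero orbit leaves every finite set, since a source in
the support spreads to its neighbours outside the support. Dually, u and v are not both surjective. So u is
surjective and v is injective, and T(Y) is contained in T(Y').

Modifying X at a single vertex shows by irreducibility of u (dually of v) that T(X) and T(Z) lie in the
2-neighbourhood of T(Y), hence so does T(Y'). Conversely, extending Z by a thin module living on the arrow
e -> c beyond a source end b of a diameter path of Y yields a map V -> Z that does not split. It lifts to E,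
and this forces E, hence Y', to be nonzero at c and e. So a diameter path of Y' is obtained from one of Y by
adding two steps at either end. Supports of indecomposables are connected, and in a tree all longest paths
of a connected set have the same center.

The isomorphism X = sigma^2 Z needed above comes from the explicit duality between Ext^1(Z, X) and
Hom(sigma^- X, sigma Z) given by the trace pairing: a homomorphism that pairs nontrivially with the class of
an AR sequence factors neither through a morphism out of X that is not split mono nor through a morphism
into Z that is not split epi.
*)
theory Submission
  imports Defs "Jordan_Normal_Form.Determinant"
begin

section \<open>Matrices\<close>

text \<open>The hypotheses on the almost split sequence become matrix identities at single vertices,
  and these are stable under transposition. Transposition reverses the orientation and exchanges X
  with Z, so each fact about u serves v as well, and sigma^- becomes the transpose of sigma. The
  isomorphism of X with sigma^2 Z enters as a lifting property. Maps from X at sinks to Z at sources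
  that pair nontrivially with the extension class make up a representation P of the opposite
  orientation. Vectors in the kernels defining sigma Z lift to P, and those in the kernels defining
  sigma P lift to X. If a vector did not lift, Z or X could be enlarged by one dimension at one
  vertex so that the family factors through the enlargement, against the almost split property. Left
  exactness of sigma then carries v to sigma Y \<rightarrow> P and to sigma^2 Y \<rightarrow> X. The
  2 in the radius reflects the two kinds of vertices: a sink in the support of X is within one step
  of the support of Y, and a source in the support of X that lies outside that of Y is one step away
  from such a sink.\<close>

lemma mult_assoc_dim:
  "dim_col A = dim_row B \<Longrightarrow> dim_col B = dim_row C \<Longrightarrow> A * B * C = A * (B * (C :: 'k::semiring_0 mat))"
  by (rule assoc_mult_mat[of A "dim_row A" "dim_col A" B "dim_col B" C "dim_col C"]) auto

lemma mult_distrib_dim: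
  "dim_row A = dim_row B \<Longrightarrow> dim_col A = dim_col B \<Longrightarrow> dim_col B = dim_row C \<Longrightarrow> (A + B) * C = A * C + B * (C :: 'k::ring mat)"
  "dim_row A = dim_row B \<Longrightarrow> dim_col A = dim_col B \<Longrightarrow> dim_col B = dim_row C \<Longrightarrow> (A - B) * C = A * C - B * (C :: 'k::ring mat)"
  "dim_row A = dim_row B \<Longrightarrow> dim_col A = dim_col B \<Longrightarrow> dim_col C = dim_row B \<Longrightarrow> C * (A + B) = C * A + C * (B :: 'k::ring mat)"
  "dim_row A = dim_row B \<Longrightarrow> dim_col A = dim_col B \<Longrightarrow> dim_col C = dim_row B \<Longrightarrow> C * (A - B) = C * A - C * (B :: 'k::ring mat)"
  by (auto intro!: add_mult_distrib_mat[of _ "dim_row A" "dim_col A"] minus_mult_distrib_mat[of _ "dim_row A" "dim_col A"]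
      mult_add_distrib_mat[of _ "dim_row C" "dim_col C"] mult_minus_distrib_mat[of _ "dim_row C" "dim_col C"])

text \<open>The side conditions are equations between dimensions, which the simplifier solves from
  the declared \<open>dim_row\<close> and \<open>dim_col\<close> facts. Products are normalised to
  the right and differences are expanded.\<close>

lemmas mat_ring = mult_assoc_dim mult_distrib_dim

lemma mult_mat_vec_assoc_dim:
  assumes "dim_col A = dim_row B" "dim_col B = dim_vec v"
  shows "(A * B) *\<^sub>v v = A *\<^sub>v (B *\<^sub>v (v :: 'k::semiring_0 vec))"
proof (rule assoc_mult_mat_vec)
  show "A \<in> carrier_mat (dim_row A) (dim_col A)" "B \<in> carrier_mat (dim_col A) (dim_col B)"
    using assms(1) by (auto intro!: carrier_matI)
  show "v \<in> carrier_vec (dim_col B)" unfolding assms(2) by (rule carrier_vec_dim_vec)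
qed

lemma transpose_mult_dim:
  assumes "dim_col A = dim_row B"
  shows "(A * B)\<^sup>T = B\<^sup>T * (A :: 'k::comm_semiring_0 mat)\<^sup>T"
proof (rule transpose_mult)
  show "A \<in> carrier_mat (dim_row A) (dim_col A)" "B \<in> carrier_mat (dim_col A) (dim_col B)"
    using assms by (auto intro!: carrier_matI)
qed

lemma mult_mat_vec_unit:
  "j < dim_col A \<Longrightarrow> A *\<^sub>v unit_vec (dim_col A) j = col (A :: 'k::semiring_1 mat) j"
  by (intro eq_vecI) auto

lemma col_mult_dim: "dim_col A = dim_row B \<Longrightarrow> j < dim_col B \<Longrightarrow> col (A * B) j = A *\<^sub>v col B j"
  by (rule eq_vecI) auto

lemma mat_eq_colI:
  "dim_row A = dim_row B \<Longrightarrow> dim_col A = dim_col B \<Longrightarrow> (\<And>j. j < dim_col B \<Longrightarrow> col A j = col B j) \<Longrightarrow> A = B"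
  by (rule mat_col_eqI) auto

lemma choose_matrix_columns:
  assumes "\<And>j. j < n \<Longrightarrow> \<exists>x\<in>carrier_vec m. P j x"
  obtains B where "B \<in> carrier_mat m n" "\<And>j. j < n \<Longrightarrow> P j (col B j)"
proof -
  from assms obtain x where x: "\<And>j. j < n \<Longrightarrow> x j \<in> carrier_vec m \<and> P j (x j)" by metis
  let ?B = "mat m n (\<lambda>(i,j). x j $ i)"
  have "col ?B j = x j" if "j < n" for j using x[OF that] that by (intro eq_vecI) auto
  thus ?thesis using x by (intro that[of ?B]) auto
qed

lemma right_inverse_if_surj:
  fixes A :: "'k::semiring_1 mat"
  assumes A: "A \<in> carrier_mat m n" and s: "\<And>w. w \<in> carrier_vec m \<Longrightarrow> \<exists>v\<in>carrier_vec n. A *\<^sub>v v = w"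
  obtains B where "B \<in> carrier_mat n m" "A * B = 1\<^sub>m m"
proof -
  have "\<And>j. j < m \<Longrightarrow> \<exists>x\<in>carrier_vec n. A *\<^sub>v x = unit_vec m j" using s by auto
  then obtain B where B: "B \<in> carrier_mat n m" "\<And>j. j < m \<Longrightarrow> A *\<^sub>v col B j = unit_vec m j"
    using choose_matrix_columns[of m n "\<lambda>j x. A *\<^sub>v x = unit_vec m j"] by blast
  have "A * B = 1\<^sub>m m" using A B by (intro mat_eq_colI) (auto simp: col_mult_dim simp del: col_mult)
  thus ?thesis using that B by blast
qed

text \<open>With a pivot k where x is nonzero, P is 1 - x e_k^T / x_k. Hence A P = A - (A x) e_k^T /
  x_k, so right multiplication by P fixes every A that kills x. P stands in for the quotient by x
  without changing the dimension.\<close>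

lemma projection_along_vector:
  fixes x :: "'k::field vec"
  assumes x: "x \<in> carrier_vec m" "x \<noteq> 0\<^sub>v m"
  obtains P where "P \<in> carrier_mat m m" "P *\<^sub>v x = 0\<^sub>v m"
    "\<And>A. dim_col A = m \<Longrightarrow> A *\<^sub>v x = 0\<^sub>v (dim_row A) \<Longrightarrow> A * P = A"
proof -
  from x obtain k where k: "k < m" "x $ k \<noteq> 0" by (auto simp: vec_eq_iff)
  let ?P = "mat m m (\<lambda>(i,j). (if i = j then 1 else 0) - (if j = k then x $ i / x $ k else 0))"
  have "?P *\<^sub>v x = 0\<^sub>v m"
    using x k by (intro eq_vecI) (auto simp: scalar_prod_def left_diff_distrib sum_subtractf if_distrib[of "\<lambda>t. t * _"] cong: if_cong)
  moreover have "A * ?P = A" if A: "dim_col A = m" "A *\<^sub>v x = 0\<^sub>v (dim_row A)" for A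
  proof (rule eq_matI)
    fix i j assume ij: "i < dim_row A" "j < dim_col A"
    have "(\<Sum>l = 0..<m. A $$ (i,l) * x $ l) = (A *\<^sub>v x) $ i" using A(1) ij x by (simp add: scalar_prod_def)
    hence s: "(\<Sum>l = 0..<m. A $$ (i,l) * x $ l) = 0" using A(2) ij by simp
    have "(A * ?P) $$ (i,j) = (\<Sum>l = 0..<m. A $$ (i,l) * ((if l = j then 1 else 0) - (if j = k then x $ l / x $ k else 0)))"
      using A ij by (simp add: scalar_prod_def)
    also have "\<dots> = A $$ (i,j) - (if j = k then (\<Sum>l = 0..<m. A $$ (i,l) * x $ l) / x $ k else 0)"
      using ij A by (simp add: right_diff_distrib sum_subtractf if_distrib[of "\<lambda>t. _ * t"] sum_divide_distrib cong: if_cong)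
    finally show "(A * ?P) $$ (i,j) = A $$ (i,j)" using s by simp
  qed (use A in auto)
  ultimately show ?thesis using that[of ?P] by simp
qed

text \<open>One step of Gaussian elimination in coordinate i: S is replaced by its members vanishing
  at i, and z is corrected by a member of S so that it vanishes there as well.\<close>
lemma separating_functional:
  fixes S :: "('i \<Rightarrow> 'k::field) set"
  assumes "finite I" "\<And>x y. x \<in> S \<Longrightarrow> y \<in> S \<Longrightarrow> (\<lambda>i. x i + y i) \<in> S" "\<And>c x. x \<in> S \<Longrightarrow> (\<lambda>i. c * x i) \<in> S"
    "S \<noteq> {}" "\<And>x. x \<in> S \<Longrightarrow> \<exists>i\<in>I. x i \<noteq> z i"
  shows "\<exists>l. (\<forall>x\<in>S. (\<Sum>i\<in>I. l i * x i) = 0) \<and> (\<Sum>i\<in>I. l i * z i) \<noteq> 0"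
  using assms
proof (induction I arbitrary: S z rule: finite_induct)
  case empty
  then show ?case by auto
next
  case (insert i I)
  have ext: "(\<Sum>j\<in>insert i I. (l(i := c)) j * x j) = c * x i + (\<Sum>j\<in>I. l j * x j)" for l c x
  proof -
    have "(\<Sum>j\<in>I. (l(i := c)) j * x j) = (\<Sum>j\<in>I. l j * x j)" using insert.hyps by (intro sum.cong) auto
    thus ?thesis using insert.hyps by simp
  qed
  show ?case
  proof (cases "\<exists>s\<in>S. s i \<noteq> 0")
    case True
    then obtain s where s: "s \<in> S" "s i \<noteq> 0" by blast
    let ?T = "{x\<in>S. x i = 0}" and ?w = "\<lambda>j. z j + (- z i / s i) * s j"
    have wi: "?w i = 0" using s by simp
    have T0: "?T \<noteq> {}" using insert.prems(2)[OF s(1), of 0] by auto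
    have Tw: "\<exists>j\<in>I. x j \<noteq> ?w j" if x: "x \<in> ?T" for x
    proof (rule ccontr)
      assume "\<not> ?thesis"
      hence eq: "\<And>j. j \<in> I \<Longrightarrow> x j = ?w j" by blast
      have "(\<lambda>j. x j + (z i / s i) * s j) \<in> S"
        using insert.prems(1)[OF _ insert.prems(2)[OF s(1)]] x by blast
      from insert.prems(4)[OF this] obtain j where "j \<in> insert i I" "x j + (z i / s i) * s j \<noteq> z j" by blast
      thus False using eq x s by (cases "j = i") auto
    qed
    have "\<exists>l. (\<forall>x\<in>?T. (\<Sum>i\<in>I. l i * x i) = 0) \<and> (\<Sum>i\<in>I. l i * ?w i) \<noteq> 0"
      by (rule insert.IH[OF _ _ T0 Tw]) (use insert.prems(1,2) in auto)
    then obtain l where l: "\<And>x. x \<in> ?T \<Longrightarrow> (\<Sum>j\<in>I. l j * x j) = 0" "(\<Sum>j\<in>I. l j * ?w j) \<noteq> 0" by blast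
    \<comment> \<open>The coefficient at \<open>i\<close> is forced by the requirement that the
      functional kill s. Adding multiples of s then changes no value, so that each x may be replaced
      by a member of \<open>?T\<close> and z by \<open>?w\<close>.\<close>
    let ?c = "- (\<Sum>j\<in>I. l j * s j) / s i"
    let ?L = "l(i := ?c)"
    have Ls: "(\<Sum>j\<in>insert i I. ?L j * s j) = 0" unfolding ext using s by simp
    have lin: "(\<Sum>j\<in>insert i I. ?L j * (x j + c * s j)) = (\<Sum>j\<in>insert i I. ?L j * x j)" for x c
    proof -
      have "(\<Sum>j\<in>insert i I. ?L j * (x j + c * s j)) = (\<Sum>j\<in>insert i I. ?L j * x j) + c * (\<Sum>j\<in>insert i I. ?L j * s j)"
        unfolding sum_distrib_left sum.distrib[symmetric] by (intro sum.cong) (auto simp: algebra_simps)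
      thus ?thesis unfolding Ls by simp
    qed
    have "(\<Sum>j\<in>insert i I. ?L j * x j) = 0" if x: "x \<in> S" for x
    proof -
      have "(\<lambda>j. x j + (- x i / s i) * s j) \<in> ?T"
        using insert.prems(1)[OF x insert.prems(2)[OF s(1)], of "- x i / s i"] s by simp
      from l(1)[OF this] have 0: "(\<Sum>j\<in>I. l j * (x j + (- x i / s i) * s j)) = 0" .
      have "(\<Sum>j\<in>insert i I. ?L j * x j) = (\<Sum>j\<in>insert i I. ?L j * (x j + (- x i / s i) * s j))"
        by (rule lin[symmetric])
      also have "\<dots> = ?c * (x i + (- x i / s i) * s i)" unfolding ext 0 by (rule add_0_right)
      also have "\<dots> = 0" using s(2) by simp
      finally show ?thesis .
    qed
    moreover have "(\<Sum>j\<in>insert i I. ?L j * z j) \<noteq> 0"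
    proof -
      have "(\<Sum>j\<in>insert i I. ?L j * z j) = (\<Sum>j\<in>insert i I. ?L j * ?w j)" by (rule lin[symmetric])
      also have "\<dots> = (\<Sum>j\<in>I. l j * ?w j)" unfolding ext wi by (simp only: mult_zero_right add_0_left)
      finally show ?thesis using l(2) by (simp only: not_False_eq_True)
    qed
    ultimately show ?thesis by blast
  next
    case False
    show ?thesis
    proof (cases "z i = 0")
      case True
      have "\<exists>l. (\<forall>x\<in>S. (\<Sum>i\<in>I. l i * x i) = 0) \<and> (\<Sum>i\<in>I. l i * z i) \<noteq> 0"
        by (rule insert.IH) (use insert.prems True False in auto)
      then obtain l where l: "\<And>x. x \<in> S \<Longrightarrow> (\<Sum>j\<in>I. l j * x j) = 0" "(\<Sum>j\<in>I. l j * z j) \<noteq> 0" by blast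
      show ?thesis by (rule exI[of _ "l(i := 0)"], unfold ext) (use l in simp)
    next
      case nz: False
      show ?thesis by (rule exI[of _ "(\<lambda>_. 0)(i := 1)"], unfold ext) (use False nz in simp)
    qed
  qed
qed

text \<open>Fredholm alternative for several matrices applied to one unknown. The coordinates are
  the pairs (b, j), the subspace is the set of reachable right-hand sides, and the separating
  functional is returned as one vector for each b.\<close>

lemma unsolvable_certificate:
  fixes A :: "'b \<Rightarrow> 'k::field mat"
  assumes B: "finite B" and A: "\<And>b. b \<in> B \<Longrightarrow> A b \<in> carrier_mat (n b) m"
    and x: "\<And>b. b \<in> B \<Longrightarrow> x b \<in> carrier_vec (n b)"
    and no: "\<not> (\<exists>u\<in>carrier_vec m. \<forall>b\<in>B. A b *\<^sub>v u = x b)"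
  obtains z where "\<And>b. z b \<in> carrier_vec (n b)"
    "\<And>u. u \<in> carrier_vec m \<Longrightarrow> (\<Sum>b\<in>B. (A b *\<^sub>v u) \<bullet> z b) = 0" "(\<Sum>b\<in>B. x b \<bullet> z b) \<noteq> 0"
proof -
  let ?I = "SIGMA b:B. {0..<n b}"
  have fin: "finite ?I" using B by (intro finite_SigmaI) auto
  have Ad: "dim_row (A b) = n b" "dim_col (A b) = m" if "b \<in> B" for b using A[OF that] by auto
  let ?y = "\<lambda>u (b,j). (A b *\<^sub>v u) $ j"
  \<comment> \<open>Members are functions on all pairs and are prescribed only on the finite index
    set, which is all that the functional sees.\<close>
  define S where "S = {y. \<exists>u\<in>carrier_vec m. \<forall>i\<in>?I. y i = ?y u i}"
  have "\<exists>l. (\<forall>y\<in>S. (\<Sum>i\<in>?I. l i * y i) = 0) \<and> (\<Sum>i\<in>?I. l i * (\<lambda>(b,j). x b $ j) i) \<noteq> 0"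
  proof (rule separating_functional[OF fin])
    fix y z assume "y \<in> S" "z \<in> S"
    then obtain u v where u: "u \<in> carrier_vec m" "\<forall>i\<in>?I. y i = ?y u i" and v: "v \<in> carrier_vec m" "\<forall>i\<in>?I. z i = ?y v i"
      unfolding S_def by blast
    have "?y (u + v) i = ?y u i + ?y v i" if "i \<in> ?I" for i
      using that Ad carrier_vecD[OF u(1)] carrier_vecD[OF v(1)] by (auto simp: scalar_prod_def distrib_left sum.distrib)
    thus "(\<lambda>i. y i + z i) \<in> S" unfolding S_def using u v by (intro CollectI bexI[of _ "u + v"]) auto
  next
    fix c y assume "y \<in> S"
    then obtain u where u: "u \<in> carrier_vec m" "\<forall>i\<in>?I. y i = ?y u i" unfolding S_def by blast
    have "?y (c \<cdot>\<^sub>v u) i = c * ?y u i" if "i \<in> ?I" for i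
      using that Ad carrier_vecD[OF u(1)] by (auto simp: scalar_prod_def sum_distrib_left mult_ac)
    thus "(\<lambda>i. c * y i) \<in> S" unfolding S_def using u by (intro CollectI bexI[of _ "c \<cdot>\<^sub>v u"]) auto
  next
    have "?y (0\<^sub>v m) \<in> S" unfolding S_def by (intro CollectI bexI[of _ "0\<^sub>v m"]) auto
    thus "S \<noteq> {}" by blast
  next
    fix y assume "y \<in> S"
    then obtain u where u: "u \<in> carrier_vec m" "\<forall>i\<in>?I. y i = ?y u i" unfolding S_def by blast
    then obtain b where b: "b \<in> B" "A b *\<^sub>v u \<noteq> x b" using no by blast
    then obtain j where "j < n b" "(A b *\<^sub>v u) $ j \<noteq> x b $ j" using Ad[OF b(1)] carrier_vecD[OF x[OF b(1)]] by (auto simp: vec_eq_iff)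
    thus "\<exists>i\<in>?I. y i \<noteq> (\<lambda>(b,j). x b $ j) i" using b(1) u(2) by (intro bexI[of _ "(b,j)"]) auto
  qed
  then obtain l where l: "\<And>y. y \<in> S \<Longrightarrow> (\<Sum>i\<in>?I. l i * y i) = 0" and lx: "(\<Sum>i\<in>?I. l i * (\<lambda>(b,j). x b $ j) i) \<noteq> 0" by blast
  let ?z = "\<lambda>b. vec (n b) (\<lambda>j. l (b,j))"
  have pair: "(\<Sum>i\<in>?I. l i * (\<lambda>(b,j). w b $ j) i) = (\<Sum>b\<in>B. w b \<bullet> ?z b)" for w
    using B by (simp add: sum.Sigma split_def scalar_prod_def mult.commute)
  show ?thesis
  proof (rule that[of ?z])
    fix u :: "'k vec" assume "u \<in> carrier_vec m"
    hence "?y u \<in> S" unfolding S_def by auto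
    from l[OF this] show "(\<Sum>b\<in>B. (A b *\<^sub>v u) \<bullet> ?z b) = 0" unfolding pair .
  qed (use lx in \<open>simp_all add: pair\<close>)
qed

text \<open>If m < n, appending zero rows makes the matrix square and keeps it injective, so its
  determinant is nonzero. But row m is zero, hence the transpose kills the unit vector m.\<close>

lemma dim_le_if_injective:
  fixes A :: "'k::field mat"
  assumes A: "A \<in> carrier_mat m n" and inj: "\<And>x. x \<in> carrier_vec n \<Longrightarrow> A *\<^sub>v x = 0\<^sub>v m \<Longrightarrow> x = 0\<^sub>v n"
  shows "n \<le> m"
proof (rule ccontr)
  assume "\<not> n \<le> m"
  hence mn: "m < n" by simp
  let ?B = "mat n n (\<lambda>(i,j). if i < m then A $$ (i,j) else 0)"
  have B: "?B \<in> carrier_mat n n" by simp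
  have "?B *\<^sub>v x = 0\<^sub>v n \<longrightarrow> x = 0\<^sub>v n" if x: "x \<in> carrier_vec n" for x
  proof
    assume b: "?B *\<^sub>v x = 0\<^sub>v n"
    have "A *\<^sub>v x = 0\<^sub>v m"
    proof (rule eq_vecI)
      fix i assume i: "i < dim_vec (0\<^sub>v m :: 'k vec)"
      have "(?B *\<^sub>v x) $ i = 0" using b i mn by simp
      thus "(A *\<^sub>v x) $ i = 0\<^sub>v m $ i" using i mn A x by (simp add: scalar_prod_def)
    qed (use A in auto)
    thus "x = 0\<^sub>v n" using inj x by blast
  qed
  hence "det ?B \<noteq> 0" using det_0_iff_vec_prod_zero_field[OF B] by blast
  hence "det ?B\<^sup>T \<noteq> 0" using det_transpose[OF B] by simp
  moreover have "?B\<^sup>T *\<^sub>v unit_vec n m = 0\<^sub>v n"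
    using mn by (intro eq_vecI) auto
  moreover have "unit_vec n m \<noteq> (0\<^sub>v n :: 'k vec)" using mn by simp
  ultimately show False using det_0_iff_vec_prod_zero_field[of "?B\<^sup>T" n] 
    using B transpose_carrier_mat[of ?B n n] unit_vec_carrier[of n m] by blast
qed

lemma dim_le_if_one_sided_inverse:
  fixes A B :: "'k::field mat"
  assumes "A \<in> carrier_mat m n" "B \<in> carrier_mat n m" "A * B = 1\<^sub>m m"
  shows "m \<le> n"
proof (rule dim_le_if_injective[OF assms(2)])
  fix x :: "'k vec" assume x: "x \<in> carrier_vec m" "B *\<^sub>v x = 0\<^sub>v n"
  have "x = (A * B) *\<^sub>v x" using assms x by simp
  also have "\<dots> = A *\<^sub>v (B *\<^sub>v x)" using assms x by (intro assoc_mult_mat_vec) auto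
  also have "\<dots> = 0\<^sub>v m" using assms x by (intro eq_vecI) auto
  finally show "x = 0\<^sub>v m" .
qed

section \<open>Representations and duality\<close>

definition dual :: "('v, 'k::field) rep \<Rightarrow> ('v, 'k) rep" where
  "dual M = \<lparr>dimv = dimv M, mapv = (\<lambda>a b. (mapv M b a)\<^sup>T)\<rparr>"

definition inj_family :: "('v \<Rightarrow> 'k::field mat) \<Rightarrow> bool" where
  "inj_family f \<longleftrightarrow> (\<forall>a x. dim_vec x = dim_col (f a) \<longrightarrow> f a *\<^sub>v x = 0\<^sub>v (dim_row (f a)) \<longrightarrow> x = 0\<^sub>v (dim_col (f a)))"

text \<open>Vertexwise surjectivity. The right inverses are linear maps at single vertices and need
  not form a morphism, in contrast to \<open>split_epi\<close>. Given as matrices, they become left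
  inverses under transposition.\<close>

definition right_invertible :: "('v \<Rightarrow> 'k::field mat) \<Rightarrow> bool" where
  "right_invertible f \<longleftrightarrow> (\<forall>a. \<exists>t\<in>carrier_mat (dim_col (f a)) (dim_row (f a)). f a * t = 1\<^sub>m (dim_row (f a)))"

lemma dual_simps [simp]:
  "dimv (dual M) = dimv M" "mapv (dual M) a b = (mapv M b a)\<^sup>T" "support (dual M) = support M"
  "nonzero_rep (dual M) = nonzero_rep M" "rep_length (dual M) = rep_length M"
  by (simp_all add: dual_def support_def nonzero_rep_def rep_length_def)

lemma dual_dual [simp]: "dual (dual M) = M"
  by (simp add: dual_def)

lemma valid_dim:
  "valid_rep adj sk M \<Longrightarrow> adj a b \<Longrightarrow> sk a \<Longrightarrow> dim_row (mapv M a b) = dimv M a"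
  "valid_rep adj sk M \<Longrightarrow> adj a b \<Longrightarrow> sk a \<Longrightarrow> dim_col (mapv M a b) = dimv M b"
  by (auto simp: valid_rep_def)

lemma morph_dim:
  "morph adj sk M N f \<Longrightarrow> dim_row (f a) = dimv N a"
  "morph adj sk M N f \<Longrightarrow> dim_col (f a) = dimv M a"
  by (auto simp: morph_def)

lemma morph_eq:
  "morph adj sk M N f \<Longrightarrow> adj a b \<Longrightarrow> sk a \<Longrightarrow> mapv N a b * f b = f a * mapv M a b"
  by (auto simp: morph_def)

lemma morphI:
  assumes "\<And>a. dim_row (f a) = dimv N a" "\<And>a. dim_col (f a) = dimv M a"
    "\<And>a b. adj a b \<Longrightarrow> sk a \<Longrightarrow> mapv N a b * f b = f a * mapv M a b"
  shows "morph adj sk M N f"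
  using assms unfolding morph_def by (auto intro!: carrier_matI)

lemma morph_comp:
  assumes "valid_rep adj sk L" "valid_rep adj sk M" "valid_rep adj sk N"
    and f: "morph adj sk L M f" and g: "morph adj sk M N g"
  shows "morph adj sk L N (\<lambda>a. g a * f a)"
proof (rule morphI)
  fix a b assume ab: "adj a b" "sk a"
  note d = morph_dim[OF f] morph_dim[OF g] valid_dim[OF assms(1) ab] valid_dim[OF assms(2) ab] valid_dim[OF assms(3) ab]
  have "mapv N a b * (g b * f b) = (g a * mapv M a b) * f b"
    using morph_eq[OF g ab] by (simp add: mult_assoc_dim[symmetric] d)
  also have "\<dots> = g a * (f a * mapv L a b)"
    using morph_eq[OF f ab] by (simp add: mult_assoc_dim d)
  finally show "mapv N a b * (g b * f b) = g a * f a * mapv L a b"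
    by (simp add: mult_assoc_dim d)
qed (simp_all add: morph_dim[OF f] morph_dim[OF g])

lemma morph_one: "valid_rep adj sk M \<Longrightarrow> morph adj sk M M (\<lambda>a. 1\<^sub>m (dimv M a))"
  by (rule morphI) (simp_all add: valid_dim)

lemma morph_add:
  assumes "valid_rep adj sk M" "valid_rep adj sk N" and f: "morph adj sk M N f" and g: "morph adj sk M N g"
  shows "morph adj sk M N (\<lambda>a. f a + g a)"
  by (rule morphI) (simp_all add: morph_dim[OF f] morph_dim[OF g] valid_dim[OF assms(1)] valid_dim[OF assms(2)]
      mult_distrib_dim morph_eq[OF f] morph_eq[OF g])

lemma morph_diff:
  assumes "valid_rep adj sk M" "valid_rep adj sk N" and f: "morph adj sk M N f" and g: "morph adj sk M N g"
  shows "morph adj sk M N (\<lambda>a. f a - g a)"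
  by (rule morphI) (simp_all add: morph_dim[OF f] morph_dim[OF g] valid_dim[OF assms(1)] valid_dim[OF assms(2)]
      mult_distrib_dim morph_eq[OF f] morph_eq[OF g])

text \<open>Reflections and extensions are local: they involve a vertex and its finitely many
  neighbours. These axioms survive reversal of the orientation, so the locale is entered again for
  dual representations and along reflection chains.\<close>

locale bipartite =
  fixes adj :: "'v \<Rightarrow> 'v \<Rightarrow> bool" and sk :: "'v \<Rightarrow> bool"
  assumes sym: "adj a b \<Longrightarrow> adj b a"
    and bip: "adj a b \<Longrightarrow> sk a \<longleftrightarrow> \<not> sk b"
    and finite_nbrs: "finite {b. adj a b}"
begin

lemma dual_bipartite: "bipartite adj (\<lambda>v. \<not> sk v)"
  using sym bip finite_nbrs by unfold_locales auto

lemma valid_dual: "valid_rep adj sk M \<Longrightarrow> valid_rep adj (\<lambda>v. \<not> sk v) (dual M)"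
  unfolding valid_rep_def using sym bip by auto

lemma morph_dual:
  assumes M: "valid_rep adj sk M" and N: "valid_rep adj sk N" and f: "morph adj sk M N f"
  shows "morph adj (\<lambda>v. \<not> sk v) (dual N) (dual M) (\<lambda>a. (f a)\<^sup>T)"
proof (rule morphI)
  fix a b assume ab: "adj a b" "\<not> sk a"
  hence ba: "adj b a" "sk b" using sym bip by auto
  have "(mapv M b a)\<^sup>T * (f b)\<^sup>T = (f b * mapv M b a)\<^sup>T"
    using valid_dim[OF M ba] morph_dim[OF f] by (simp add: transpose_mult_dim)
  also have "\<dots> = (mapv N b a * f a)\<^sup>T" using morph_eq[OF f ba] by simp
  also have "\<dots> = (f a)\<^sup>T * (mapv N b a)\<^sup>T"
    using valid_dim[OF N ba] morph_dim[OF f] by (simp add: transpose_mult_dim)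
  finally show "mapv (dual M) a b * (f b)\<^sup>T = (f a)\<^sup>T * mapv (dual N) a b" by simp
qed (simp_all add: morph_dim[OF f])

end

text \<open>Here \<open>r\<close> and \<open>s\<close> split the exact sequence linearly at each
  vertex, \<open>i\<close> and \<open>p\<close> are the morphisms of the summand Y of E, and
  \<open>i'\<close> and \<open>p'\<close> complete them to a decomposition of each E_a. In this form
  the list of axioms is symmetric under transposition.\<close>

locale almost_split = bipartite adj sk
  for adj :: "'v \<Rightarrow> 'v \<Rightarrow> bool" and sk +
  fixes X E Z Y Y' :: "('v, 'k::field) rep" and f g r s i p i' p' :: "'v \<Rightarrow> 'k mat"
  assumes valid [simp]: "valid_rep adj sk X" "valid_rep adj sk E" "valid_rep adj sk Z" "valid_rep adj sk Y"
    and f [simp]: "morph adj sk X E f" and g [simp]: "morph adj sk E Z g"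
    and i [simp]: "morph adj sk Y E i" and p [simp]: "morph adj sk E Y p"
    and splitting_dims [simp]: "dim_row (r a) = dimv X a" "dim_col (r a) = dimv E a" "dim_row (s a) = dimv E a" "dim_col (s a) = dimv Z a"
      "dim_row (i' a) = dimv E a" "dim_col (i' a) = dimv Y' a" "dim_row (p' a) = dimv Y' a" "dim_col (p' a) = dimv E a"
    and rf: "r a * f a = 1\<^sub>m (dimv X a)" and gs: "g a * s a = 1\<^sub>m (dimv Z a)"
    and fr_sg: "f a * r a + s a * g a = 1\<^sub>m (dimv E a)"
    and gf: "g a * f a = 0\<^sub>m (dimv Z a) (dimv X a)" and rs: "r a * s a = 0\<^sub>m (dimv X a) (dimv Z a)"
    and pi: "p a * i a = 1\<^sub>m (dimv Y a)" and ip: "i a * p a + i' a * p' a = 1\<^sub>m (dimv E a)"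
    and left: "left_almost_split adj sk X E f" and right: "right_almost_split adj sk E Z g"
    and Y_nonzero: "nonzero_rep Y"
begin

lemma dims [simp]:
  "dim_row (f a) = dimv E a" "dim_col (f a) = dimv X a" "dim_row (g a) = dimv Z a" "dim_col (g a) = dimv E a"
  "dim_row (i a) = dimv E a" "dim_col (i a) = dimv Y a" "dim_row (p a) = dimv Y a" "dim_col (p a) = dimv E a"
  using morph_dim[OF f] morph_dim[OF g] morph_dim[OF i] morph_dim[OF p] by auto

text \<open>Transposition turns split epimorphisms into split monomorphisms and lifts through g into
  extensions along its transpose. Through this lemma every result on \<open>p f\<close> also holds
  for the transpose of \<open>g i\<close>.\<close>

lemma dual_almost_split:
  "almost_split adj (\<lambda>v. \<not> sk v) (dual Z) (dual E) (dual X) (dual Y) (dual Y')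
     (\<lambda>a. (g a)\<^sup>T) (\<lambda>a. (f a)\<^sup>T) (\<lambda>a. (s a)\<^sup>T) (\<lambda>a. (r a)\<^sup>T) (\<lambda>a. (p a)\<^sup>T) (\<lambda>a. (i a)\<^sup>T) (\<lambda>a. (p' a)\<^sup>T) (\<lambda>a. (i' a)\<^sup>T)"
proof -
  interpret D: bipartite adj "\<lambda>v. \<not> sk v" by (rule dual_bipartite)
  have no_split: "\<not> split_epi adj sk W Z h"
    if "\<not> split_mono adj (\<lambda>v. \<not> sk v) (dual Z) (dual W) (\<lambda>a. (h a)\<^sup>T)" "valid_rep adj sk W" "morph adj sk W Z h" for W h
  proof
    assume "split_epi adj sk W Z h"
    then obtain t where t: "morph adj sk Z W t" "\<And>a. h a * t a = 1\<^sub>m (dimv Z a)" by (auto simp: split_epi_def)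
    have "(t a)\<^sup>T * (h a)\<^sup>T = 1\<^sub>m (dimv Z a)" for a
      using t(2)[of a] morph_dim[OF t(1)] morph_dim[OF that(3)] by (metis transpose_mult_dim transpose_one)
    hence "split_mono adj (\<lambda>v. \<not> sk v) (dual Z) (dual W) (\<lambda>a. (h a)\<^sup>T)"
      using morph_dual[OF _ that(2) t(1)] by (auto simp: split_mono_def)
    thus False using that by blast
  qed
  have no_split': "\<not> split_mono adj sk X W h"
    if "\<not> split_epi adj (\<lambda>v. \<not> sk v) (dual W) (dual X) (\<lambda>a. (h a)\<^sup>T)" "valid_rep adj sk W" "morph adj sk X W h" for W h
  proof
    assume "split_mono adj sk X W h"
    then obtain t where t: "morph adj sk W X t" "\<And>a. t a * h a = 1\<^sub>m (dimv X a)" by (auto simp: split_mono_def)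
    have "(h a)\<^sup>T * (t a)\<^sup>T = 1\<^sub>m (dimv X a)" for a
      using t(2)[of a] morph_dim[OF t(1)] morph_dim[OF that(3)] by (metis transpose_mult_dim transpose_one)
    hence "split_epi adj (\<lambda>v. \<not> sk v) (dual W) (dual X) (\<lambda>a. (h a)\<^sup>T)"
      using morph_dual[OF that(2) _ t(1)] by (auto simp: split_epi_def)
    thus False using that by blast
  qed
  have L: "left_almost_split adj (\<lambda>v. \<not> sk v) (dual Z) (dual E) (\<lambda>a. (g a)\<^sup>T)"
    unfolding left_almost_split_def
  proof (intro conjI allI impI)
    show "morph adj (\<lambda>v. \<not> sk v) (dual Z) (dual E) (\<lambda>a. (g a)\<^sup>T)" by (rule morph_dual) simp_all
    show "\<not> split_mono adj (\<lambda>v. \<not> sk v) (dual Z) (dual E) (\<lambda>a. (g a)\<^sup>T)"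
    proof
      assume "split_mono adj (\<lambda>v. \<not> sk v) (dual Z) (dual E) (\<lambda>a. (g a)\<^sup>T)"
      then obtain t where t: "morph adj (\<lambda>v. \<not> sk v) (dual E) (dual Z) t" "\<And>a. t a * (g a)\<^sup>T = 1\<^sub>m (dimv Z a)"
        by (auto simp: split_mono_def)
      have "g a * (t a)\<^sup>T = 1\<^sub>m (dimv Z a)" for a
        using t(2)[of a] morph_dim[OF t(1), of a] transpose_mult_dim[of "t a" "(g a)\<^sup>T"] by simp
      hence "split_epi adj sk E Z g"
        using D.morph_dual[OF valid_dual[OF valid(2)] valid_dual[OF valid(3)] t(1)] by (auto simp: split_epi_def)
      thus False using right by (simp add: right_almost_split_def)
    qed
    fix W h assume "valid_rep adj (\<lambda>v. \<not> sk v) W \<and> morph adj (\<lambda>v. \<not> sk v) (dual Z) W h \<and> \<not> split_mono adj (\<lambda>v. \<not> sk v) (dual Z) W h"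
    hence W: "valid_rep adj (\<lambda>v. \<not> sk v) W" and h: "morph adj (\<lambda>v. \<not> sk v) (dual Z) W h"
      and ns: "\<not> split_mono adj (\<lambda>v. \<not> sk v) (dual Z) W h" by auto
    have W': "valid_rep adj sk (dual W)" using D.valid_dual[OF W] by simp
    have h': "morph adj sk (dual W) Z (\<lambda>a. (h a)\<^sup>T)"
      using D.morph_dual[OF valid_dual[OF valid(3)] W h] by simp
    have "\<not> split_epi adj sk (dual W) Z (\<lambda>a. (h a)\<^sup>T)"
      using no_split[OF _ W' h'] ns by simp
    then obtain k where k: "morph adj sk (dual W) E k" "\<And>a. g a * k a = (h a)\<^sup>T"
      using right W' h' unfolding right_almost_split_def by blast
    have "(k a)\<^sup>T * (g a)\<^sup>T = h a" for a
      using k(2)[of a] morph_dim[OF k(1), of a] transpose_mult_dim[of "g a" "k a"] by simp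
    thus "\<exists>h'. morph adj (\<lambda>v. \<not> sk v) (dual E) W h' \<and> (\<forall>a. h' a * (g a)\<^sup>T = h a)"
      using morph_dual[OF W' _ k(1)] by (intro exI[of _ "\<lambda>a. (k a)\<^sup>T"]) simp
  qed
  have R: "right_almost_split adj (\<lambda>v. \<not> sk v) (dual E) (dual X) (\<lambda>a. (f a)\<^sup>T)"
    unfolding right_almost_split_def
  proof (intro conjI allI impI)
    show "morph adj (\<lambda>v. \<not> sk v) (dual E) (dual X) (\<lambda>a. (f a)\<^sup>T)" by (rule morph_dual) simp_all
    show "\<not> split_epi adj (\<lambda>v. \<not> sk v) (dual E) (dual X) (\<lambda>a. (f a)\<^sup>T)"
    proof
      assume "split_epi adj (\<lambda>v. \<not> sk v) (dual E) (dual X) (\<lambda>a. (f a)\<^sup>T)"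
      then obtain t where t: "morph adj (\<lambda>v. \<not> sk v) (dual X) (dual E) t" "\<And>a. (f a)\<^sup>T * t a = 1\<^sub>m (dimv X a)"
        by (auto simp: split_epi_def)
      have "(t a)\<^sup>T * f a = 1\<^sub>m (dimv X a)" for a
        using t(2)[of a] morph_dim[OF t(1), of a] transpose_mult_dim[of "(f a)\<^sup>T" "t a"] by simp
      hence "split_mono adj sk X E f"
        using D.morph_dual[OF valid_dual[OF valid(1)] valid_dual[OF valid(2)] t(1)] by (auto simp: split_mono_def)
      thus False using left by (simp add: left_almost_split_def)
    qed
    fix W h assume "valid_rep adj (\<lambda>v. \<not> sk v) W \<and> morph adj (\<lambda>v. \<not> sk v) W (dual X) h \<and> \<not> split_epi adj (\<lambda>v. \<not> sk v) W (dual X) h"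
    hence W: "valid_rep adj (\<lambda>v. \<not> sk v) W" and h: "morph adj (\<lambda>v. \<not> sk v) W (dual X) h"
      and ns: "\<not> split_epi adj (\<lambda>v. \<not> sk v) W (dual X) h" by auto
    have W': "valid_rep adj sk (dual W)" using D.valid_dual[OF W] by simp
    have h': "morph adj sk X (dual W) (\<lambda>a. (h a)\<^sup>T)"
      using D.morph_dual[OF W valid_dual[OF valid(1)] h] by simp
    have "\<not> split_mono adj sk X (dual W) (\<lambda>a. (h a)\<^sup>T)"
      using no_split'[OF _ W' h'] ns by simp
    then obtain k where k: "morph adj sk E (dual W) k" "\<And>a. k a * f a = (h a)\<^sup>T"
      using left W' h' unfolding left_almost_split_def by blast
    have "(f a)\<^sup>T * (k a)\<^sup>T = h a" for a
      using k(2)[of a] morph_dim[OF k(1), of a] transpose_mult_dim[of "k a" "f a"] by simp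
    thus "\<exists>h'. morph adj (\<lambda>v. \<not> sk v) W (dual E) h' \<and> (\<forall>a. (f a)\<^sup>T * h' a = h a)"
      using morph_dual[OF _ W' k(1)] by (intro exI[of _ "\<lambda>a. (k a)\<^sup>T"]) simp
  qed
  have t0: "A\<^sup>T = 0\<^sub>m n m" if "A = 0\<^sub>m m n" for A :: "'k mat" and m n using that by (auto simp: mat_eq_iff)
  show ?thesis
  proof (unfold_locales; (rule L R)?; (rule morph_dual valid_dual)?)
    fix a
    show "(s a)\<^sup>T * (g a)\<^sup>T = 1\<^sub>m (dimv (dual Z) a)" using transpose_mult_dim[of "g a" "s a"] gs by simp
    show "(f a)\<^sup>T * (r a)\<^sup>T = 1\<^sub>m (dimv (dual X) a)" using transpose_mult_dim[of "r a" "f a"] rf by simp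
    show "(i a)\<^sup>T * (p a)\<^sup>T = 1\<^sub>m (dimv (dual Y) a)" using transpose_mult_dim[of "p a" "i a"] pi by simp
    show "(f a)\<^sup>T * (g a)\<^sup>T = 0\<^sub>m (dimv (dual X) a) (dimv (dual Z) a)" using transpose_mult_dim[of "g a" "f a"] t0[OF gf] by simp
    show "(s a)\<^sup>T * (r a)\<^sup>T = 0\<^sub>m (dimv (dual Z) a) (dimv (dual X) a)" using transpose_mult_dim[of "r a" "s a"] t0[OF rs] by simp
    have "(f a * r a + s a * g a)\<^sup>T = 1\<^sub>m (dimv E a)" unfolding fr_sg by simp
    moreover have "(f a * r a + s a * g a)\<^sup>T = (g a)\<^sup>T * (s a)\<^sup>T + (r a)\<^sup>T * (f a)\<^sup>T"
      by (subst transpose_add[of _ "dimv E a" "dimv E a"]) (auto intro!: carrier_matI comm_add_mat[of _ "dimv E a" "dimv E a"] simp: transpose_mult_dim)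
    ultimately show "(g a)\<^sup>T * (s a)\<^sup>T + (r a)\<^sup>T * (f a)\<^sup>T = 1\<^sub>m (dimv (dual E) a)" by simp
    have "(i a * p a + i' a * p' a)\<^sup>T = 1\<^sub>m (dimv E a)" unfolding ip by simp
    moreover have "(i a * p a + i' a * p' a)\<^sup>T = (p a)\<^sup>T * (i a)\<^sup>T + (p' a)\<^sup>T * (i' a)\<^sup>T"
      by (subst transpose_add[of _ "dimv E a" "dimv E a"]) (auto intro!: carrier_matI simp: transpose_mult_dim)
    ultimately show "(p a)\<^sup>T * (i a)\<^sup>T + (p' a)\<^sup>T * (i' a)\<^sup>T = 1\<^sub>m (dimv (dual E) a)" by simp
  qed (use sym bip finite_nbrs Y_nonzero in \<open>auto\<close>)
qed

end

section \<open>Irreducible maps and their supports\<close>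

text \<open>An identity matrix cut to shape: the projection onto the leading coordinates or their
  inclusion. One-dimensional enlargements below always append the new basis vector last, so that
  these are the canonical maps.\<close>

definition rect_id :: "nat \<Rightarrow> nat \<Rightarrow> 'k::field mat" where
  "rect_id m n = mat m n (\<lambda>(i,j). if i = j then 1 else 0)"

lemma rect_id_dim [simp]: "dim_row (rect_id m n) = m" "dim_col (rect_id m n) = n"
  by (simp_all add: rect_id_def)

lemma rect_id_square [simp]: "rect_id n n = 1\<^sub>m n"
  by (simp add: rect_id_def one_mat_def)

lemma rect_id_mult:
  "i < m \<Longrightarrow> j < dim_col A \<Longrightarrow> dim_row A = n \<Longrightarrow> (rect_id m n * A) $$ (i,j) = (if i < n then A $$ (i,j) else 0)"
  by (auto simp: rect_id_def scalar_prod_def if_distrib[of "\<lambda>t. t * _"] cong: if_cong)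

lemma mult_rect_id:
  "i < dim_row A \<Longrightarrow> j < n \<Longrightarrow> dim_col A = m \<Longrightarrow> (A * rect_id m n) $$ (i,j) = (if j < m then A $$ (i,j) else 0)"
  by (auto simp: rect_id_def scalar_prod_def if_distrib[of "\<lambda>t. _ * t"] cong: if_cong)

lemma rect_id_retract: "m \<le> n \<Longrightarrow> rect_id m n * rect_id n m = (1\<^sub>m m :: 'k::field mat)"
  by (rule eq_matI) (auto simp: rect_id_mult simp del: index_mult_mat(1), auto simp: rect_id_def)

lemma mat_eq_if_no_cols: "dim_col A = 0 \<Longrightarrow> dim_col B = 0 \<Longrightarrow> dim_row A = dim_row B \<Longrightarrow> A = B"
  by (rule eq_matI) auto

context almost_split
begin

text \<open>If w: Z \<rightarrow> Y satisfies p - h c = w g, then w v = 1 - h c i for v = g i. As g is right almost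
  split, 1 - v w has a right inverse t, and 1 + w t v is then a right inverse of h c i.\<close>
lemma irreducible:
  assumes W: "valid_rep adj sk W" and q: "morph adj sk X W q" and h: "morph adj sk W Y h"
    and hq: "\<And>a. h a * q a = p a * f a" and ns: "\<not> split_mono adj sk X W q"
  shows "split_epi adj sk W Y h"
proof -
  from left W q ns obtain c where c: "morph adj sk E W c" and cf: "\<And>a. c a * f a = q a"
    unfolding left_almost_split_def by blast
  note [simp] = morph_dim[OF h] morph_dim[OF c] morph_dim[OF q]
  define d where "d a = p a - h a * c a" for a
  have d: "morph adj sk E Y d"
    unfolding d_def by (rule morph_diff) (auto intro: morph_comp[OF _ W _ c h] W)
  note [simp] = morph_dim[OF d]
  have df: "d a * f a = 0\<^sub>m (dimv Y a) (dimv X a)" for a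
    unfolding d_def using hq[of a] by (simp add: mat_ring cf) (auto simp: mat_eq_iff)
  define w where "w a = d a * s a" for a
  have w_dim [simp]: "dim_row (w a) = dimv Y a" "dim_col (w a) = dimv Z a" for a by (simp_all add: w_def)
  have wg: "w a * g a = d a" for a
  proof -
    have "d a = d a * (f a * r a + s a * g a)" unfolding fr_sg by simp
    also have "\<dots> = (d a * f a) * r a + w a * g a" unfolding w_def by (simp add: mat_ring)
    also have "\<dots> = w a * g a" unfolding df by (auto simp: mat_eq_iff)
    finally show ?thesis by simp
  qed
  \<comment> \<open>The splitting \<open>s\<close> does not commute with the arrows. That
    \<open>w\<close> does follows from w g = d, since d is a morphism and g is surjective.\<close>
  have w: "morph adj sk Z Y w"
  proof (rule morphI)
    fix a b assume ab: "adj a b" "sk a"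
    note [simp] = valid_dim[OF valid(1) ab] valid_dim[OF valid(2) ab] valid_dim[OF valid(3) ab] valid_dim[OF valid(4) ab]
    have "w a * mapv Z a b = w a * (mapv Z a b * g b) * s b" using gs[of b] by (simp add: mat_ring)
    also have "\<dots> = (w a * g a) * mapv E a b * s b" unfolding morph_eq[OF g ab] by (simp add: mat_ring)
    also have "\<dots> = mapv Y a b * d b * s b" unfolding wg morph_eq[OF d ab] ..
    also have "\<dots> = mapv Y a b * w b" unfolding w_def by (simp add: mat_ring)
    finally show "mapv Y a b * w b = w a * mapv Z a b" by simp
  qed (simp_all add: w_def)
  define v where "v a = g a * i a" for a
  have v: "morph adj sk Y Z v" unfolding v_def by (rule morph_comp[OF _ _ _ i g]) simp_all
  note [simp] = morph_dim[OF v]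
  have wv: "w a * v a = 1\<^sub>m (dimv Y a) - h a * (c a * i a)" for a
  proof -
    have "w a * v a = (w a * g a) * i a" unfolding v_def by (simp add: mat_ring)
    thus ?thesis unfolding wg d_def by (simp add: mat_ring pi)
  qed
  \<comment> \<open>Otherwise 1 - v w would lift through g, and adding i w to the lift would split
    g.\<close>
  have "split_epi adj sk Z Z (\<lambda>a. 1\<^sub>m (dimv Z a) - v a * w a)"
  proof (rule ccontr)
    assume nse: "\<not> ?thesis"
    have "morph adj sk Z Z (\<lambda>a. 1\<^sub>m (dimv Z a) - v a * w a)"
      by (rule morph_diff) (auto intro: morph_one morph_comp[OF _ _ _ w v])
    then obtain m where m: "morph adj sk Z E m" "\<And>a. g a * m a = 1\<^sub>m (dimv Z a) - v a * w a"
      using right nse valid(3) unfolding right_almost_split_def by blast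
    note [simp] = morph_dim[OF m(1)]
    have "morph adj sk Z E (\<lambda>a. m a + i a * w a)"
      by (rule morph_add) (auto intro: m morph_comp[OF _ _ _ w i])
    moreover have "g a * (m a + i a * w a) = 1\<^sub>m (dimv Z a)" for a
    proof -
      have "g a * (m a + i a * w a) = g a * m a + v a * w a" unfolding v_def by (simp add: mat_ring)
      thus ?thesis unfolding m(2) by (auto simp: mat_eq_iff)
    qed
    ultimately have "split_epi adj sk E Z g" unfolding split_epi_def by blast
    thus False using right unfolding right_almost_split_def by blast
  qed
  then obtain t where t: "morph adj sk Z Z t" "\<And>a. (1\<^sub>m (dimv Z a) - v a * w a) * t a = 1\<^sub>m (dimv Z a)"
    unfolding split_epi_def by blast
  note [simp] = morph_dim[OF t(1)]
  have wtv: "morph adj sk Y Y (\<lambda>a. w a * t a * v a)"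
    by (rule morph_comp[OF _ _ _ v morph_comp[OF _ _ _ t(1) w]]) simp_all
  have wtv1: "morph adj sk Y Y (\<lambda>a. 1\<^sub>m (dimv Y a) + w a * t a * v a)"
    by (rule morph_add[OF _ _ morph_one wtv]) simp_all
  have ci: "morph adj sk Y W (\<lambda>a. c a * i a)" by (rule morph_comp[OF _ _ W i c]) simp_all
  have "h a * (c a * i a * (1\<^sub>m (dimv Y a) + w a * t a * v a)) = 1\<^sub>m (dimv Y a)" for a
  proof -
    have k: "h a * (c a * i a) = 1\<^sub>m (dimv Y a) - w a * v a" unfolding wv by (auto simp: mat_eq_iff)
    have "h a * (c a * i a * (1\<^sub>m (dimv Y a) + w a * t a * v a)) = (h a * (c a * i a)) * (1\<^sub>m (dimv Y a) + w a * t a * v a)"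
      by (simp add: mat_ring)
    also have "\<dots> = (1\<^sub>m (dimv Y a) - w a * v a) + w a * (((1\<^sub>m (dimv Z a) - v a * w a) * t a) * v a)"
      unfolding k by (simp add: mat_ring)
    also have "\<dots> = 1\<^sub>m (dimv Y a)" unfolding t(2) by (auto simp: mat_eq_iff)
    finally show ?thesis .
  qed
  thus ?thesis unfolding split_epi_def using morph_comp[OF _ _ W wtv1 ci] valid(4) by blast
qed

lemma pf_morph: "morph adj sk X Y (\<lambda>a. p a * f a)"
  by (rule morph_comp[OF _ _ _ f p]) simp_all

lemma gi_morph: "morph adj sk Y Z (\<lambda>a. g a * i a)"
  by (rule morph_comp[OF _ _ _ i g]) simp_all

text \<open>Given a section t of p f, the endomorphism e = 1 - t p f of X satisfies e t = 0. If e
  were not split mono, it would extend along f, and adding t p to the extension would give a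
  retraction of f. So e is split mono, hence t = 0, although Y is nonzero.\<close>

lemma pf_not_split_epi: "\<not> split_epi adj sk X Y (\<lambda>a. p a * f a)"
proof
  assume "split_epi adj sk X Y (\<lambda>a. p a * f a)"
  then obtain t where t: "morph adj sk Y X t" "\<And>a. p a * f a * t a = 1\<^sub>m (dimv Y a)" unfolding split_epi_def by blast
  note [simp] = morph_dim[OF t(1)]
  let ?e = "\<lambda>a. 1\<^sub>m (dimv X a) - t a * (p a * f a)"
  have e: "morph adj sk X X ?e" by (rule morph_diff[OF _ _ morph_one morph_comp[OF _ _ _ pf_morph t(1)]]) simp_all
  have "split_mono adj sk X X ?e"
  proof (rule ccontr)
    assume "\<not> ?thesis"
    then obtain m where m: "morph adj sk E X m" "\<And>a. m a * f a = ?e a"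
      using left e valid(1) unfolding left_almost_split_def by blast
    note [simp] = morph_dim[OF m(1)]
    have "morph adj sk E X (\<lambda>a. m a + t a * p a)"
      by (rule morph_add[OF _ _ m(1) morph_comp[OF _ _ _ p t(1)]]) simp_all
    moreover have "(m a + t a * p a) * f a = 1\<^sub>m (dimv X a)" for a
      using m(2)[of a] by (simp add: mat_ring) (auto simp: mat_eq_iff)
    ultimately have "split_mono adj sk X E f" unfolding split_mono_def by blast
    thus False using left unfolding left_almost_split_def by blast
  qed
  then obtain m where m: "morph adj sk X X m" "\<And>a. m a * ?e a = 1\<^sub>m (dimv X a)" unfolding split_mono_def by blast
  note [simp] = morph_dim[OF m(1)]
  obtain a where a: "dimv Y a \<noteq> 0" using Y_nonzero unfolding nonzero_rep_def by blast
  have "?e a * t a = t a - t a * (p a * f a * t a)" by (simp add: mat_ring)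
  also have "\<dots> = 0\<^sub>m (dimv X a) (dimv Y a)" unfolding t(2) by (auto simp: mat_eq_iff)
  finally have et: "?e a * t a = 0\<^sub>m (dimv X a) (dimv Y a)" .
  have "t a = (m a * ?e a) * t a" unfolding m(2) by simp
  also have "\<dots> = m a * (?e a * t a)" by (rule mult_assoc_dim) simp_all
  also have "\<dots> = 0\<^sub>m (dimv X a) (dimv Y a)" unfolding et by simp
  finally have "1\<^sub>m (dimv Y a) = p a * f a * 0\<^sub>m (dimv X a) (dimv Y a)" using t(2)[of a] by simp
  hence "1\<^sub>m (dimv Y a) = (0\<^sub>m (dimv Y a) (dimv Y a) :: 'k mat)" by simp
  from arg_cong[OF this, of "\<lambda>A. A $$ (0,0)"] show False using a by simp
qed

lemma no_split_if_kills:
  assumes q: "\<And>a. dim_col (q a) = dimv X a"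
    and x: "x \<in> carrier_vec (dimv X a)" "x \<noteq> 0\<^sub>v (dimv X a)" "q a *\<^sub>v x = 0\<^sub>v (dimv W a)" and W: "dim_row (q a) = dimv W a"
  shows "\<not> split_mono adj sk X W q"
proof
  assume "split_mono adj sk X W q"
  then obtain m where m: "morph adj sk W X m" "\<And>a. m a * q a = 1\<^sub>m (dimv X a)" unfolding split_mono_def by blast
  have "x = (m a * q a) *\<^sub>v x" unfolding m(2) using x by simp
  also have "\<dots> = m a *\<^sub>v (q a *\<^sub>v x)"
    using x(1) q W morph_dim[OF m(1)] by (intro mult_mat_vec_assoc_dim) simp_all
  also have "\<dots> = 0\<^sub>v (dimv X a)" unfolding x(3) using morph_dim[OF m(1)] by (intro eq_vecI) (simp_all add: scalar_prod_def)
  finally show False using x by simp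
qed

text \<open>At a sink, x spans a subrepresentation. W is X with the arrows into \<open>a0\<close>
  followed by the projection along x, so p f passes through X \<rightarrow> W \<rightarrow> Y with a
  first map that kills x. Irreducibility yields a section of W \<rightarrow> Y; as W has the spaces
  of X, it is a family of maps into X that can fail to commute only on arrows into
  \<open>a0\<close>.\<close>

lemma sink_quotient:
  assumes a0: "sk a0" and x: "x \<in> carrier_vec (dimv X a0)" "x \<noteq> 0\<^sub>v (dimv X a0)"
    and ux: "p a0 * f a0 *\<^sub>v x = 0\<^sub>v (dimv Y a0)"
  obtains t where "\<And>a. t a \<in> carrier_mat (dimv X a) (dimv Y a)" "\<And>a. p a * f a * t a = 1\<^sub>m (dimv Y a)"
    "\<And>a b. adj a b \<Longrightarrow> sk a \<Longrightarrow> a \<noteq> a0 \<Longrightarrow> mapv X a b * t b = t a * mapv Y a b"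
proof -
  obtain P where P: "P \<in> carrier_mat (dimv X a0) (dimv X a0)" "P *\<^sub>v x = 0\<^sub>v (dimv X a0)"
    "\<And>A. dim_col A = dimv X a0 \<Longrightarrow> A *\<^sub>v x = 0\<^sub>v (dim_row A) \<Longrightarrow> A * P = A"
    using projection_along_vector[OF x] by metis
  let ?W = "X\<lparr>mapv := (\<lambda>a b. if a = a0 then P * mapv X a b else mapv X a b)\<rparr>"
  let ?q = "\<lambda>a. if a = a0 then P else 1\<^sub>m (dimv X a)"
  have W: "valid_rep adj sk ?W"
    using valid(1) P(1) unfolding valid_rep_def support_def by auto
  have uP: "p a0 * f a0 * P = p a0 * f a0" by (rule P(3)) (simp_all add: ux)
  have q: "morph adj sk X ?W ?q"
  proof (rule morphI)
    fix a b assume ab: "adj a b" "sk a"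
    hence "b \<noteq> a0" using bip a0 by blast
    thus "mapv ?W a b * ?q b = ?q a * mapv X a b" using P(1) valid_dim[OF valid(1) ab] by auto
  qed (use P in auto)
  have h: "morph adj sk ?W Y (\<lambda>a. p a * f a)"
  proof (rule morphI)
    fix a b assume ab: "adj a b" "sk a"
    have "p a * f a * (P * mapv X a b) = p a * f a * mapv X a b" if "a = a0"
      unfolding that using P(1) valid_dim[OF valid(1) ab] that uP
      by (subst mult_assoc_dim[symmetric]) auto
    thus "mapv Y a b * (p b * f b) = p a * f a * mapv ?W a b" using morph_eq[OF pf_morph ab] by auto
  qed auto
  have "\<not> split_mono adj sk X ?W ?q"
    by (rule no_split_if_kills[OF _ x]) (use P in auto)
  hence "split_epi adj sk ?W Y (\<lambda>a. p a * f a)"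
    by (rule irreducible[OF W q h, rotated]) (auto simp: uP)
  then obtain t where t: "morph adj sk Y ?W t" "\<And>a. p a * f a * t a = 1\<^sub>m (dimv Y a)" unfolding split_epi_def by blast
  show ?thesis
  proof (rule that[of t])
    show "t a \<in> carrier_mat (dimv X a) (dimv Y a)" for a using morph_dim[OF t(1), of a] by (auto intro!: carrier_matI)
    show "mapv X a b * t b = t a * mapv Y a b" if "adj a b" "sk a" "a \<noteq> a0" for a b
      using morph_eq[OF t(1) that(1,2)] that(3) by simp
  qed (rule t(2))
qed

text \<open>Since the arrows leaving \<open>b0\<close> kill x, the projection along x is an
  endomorphism of X. It is not split mono and p f factors through it, so irreducibility would make p
  f itself a split epimorphism.\<close>

lemma no_source_kernel:
  assumes b0: "\<not> sk b0" and x: "x \<in> carrier_vec (dimv X b0)" "x \<noteq> 0\<^sub>v (dimv X b0)"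
    and ux: "p b0 * f b0 *\<^sub>v x = 0\<^sub>v (dimv Y b0)"
    and Xx: "\<And>a. adj a b0 \<Longrightarrow> mapv X a b0 *\<^sub>v x = 0\<^sub>v (dimv X a)"
  shows False
proof -
  obtain P where P: "P \<in> carrier_mat (dimv X b0) (dimv X b0)" "P *\<^sub>v x = 0\<^sub>v (dimv X b0)"
    "\<And>A. dim_col A = dimv X b0 \<Longrightarrow> A *\<^sub>v x = 0\<^sub>v (dim_row A) \<Longrightarrow> A * P = A"
    using projection_along_vector[OF x] by metis
  let ?q = "\<lambda>a. if a = b0 then P else 1\<^sub>m (dimv X a)"
  have uP: "p b0 * f b0 * P = p b0 * f b0" by (rule P(3)) (simp_all add: ux)
  have q: "morph adj sk X X ?q"
  proof (rule morphI)
    fix a b assume ab: "adj a b" "sk a"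
    hence "a \<noteq> b0" using b0 by blast
    moreover have "mapv X a b * P = mapv X a b" if "b = b0"
      using P(3)[of "mapv X a b"] Xx[of a] ab valid_dim[OF valid(1) ab] that by auto
    ultimately show "mapv X a b * ?q b = ?q a * mapv X a b" using P(1) valid_dim[OF valid(1) ab] by auto
  qed (use P in auto)
  have "\<not> split_mono adj sk X X ?q"
    by (rule no_split_if_kills[OF _ x]) (use P in auto)
  hence "split_epi adj sk X Y (\<lambda>a. p a * f a)"
    by (rule irreducible[OF valid(1) q pf_morph, rotated]) (auto simp: uP)
  thus False using pf_not_split_epi by blast
qed

text \<open>A kernel vector at a sink already yields right inverses at all vertices. If there is
  none, the arrows send a kernel vector at a source into zero kernels, and then
  \<open>no_source_kernel\<close> excludes it.\<close>

lemma pf_inj_or_right_invertible: "inj_family (\<lambda>a. p a * f a) \<or> right_invertible (\<lambda>a. p a * f a)"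
proof (rule disjCI)
  assume nr: "\<not> right_invertible (\<lambda>a. p a * f a)"
  have sink: "x = 0\<^sub>v (dimv X a)" if a: "sk a" and x: "x \<in> carrier_vec (dimv X a)" "p a * f a *\<^sub>v x = 0\<^sub>v (dimv Y a)" for a x
  proof (rule ccontr)
    assume "x \<noteq> 0\<^sub>v (dimv X a)"
    from sink_quotient[OF a x(1) this x(2)] obtain t where
      "\<And>a. t a \<in> carrier_mat (dimv X a) (dimv Y a)" "\<And>a. p a * f a * t a = 1\<^sub>m (dimv Y a)" by metis
    hence "right_invertible (\<lambda>a. p a * f a)" unfolding right_invertible_def by (intro allI bexI[of _ "t _"]) auto
    thus False using nr by blast
  qed
  have source: "x = 0\<^sub>v (dimv X b)" if b: "\<not> sk b" and x: "x \<in> carrier_vec (dimv X b)" "p b * f b *\<^sub>v x = 0\<^sub>v (dimv Y b)" for b x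
  proof (rule ccontr)
    assume nz: "x \<noteq> 0\<^sub>v (dimv X b)"
    show False
    proof (rule no_source_kernel[OF b x(1) nz x(2)])
      fix a assume ab: "adj a b"
      hence a: "sk a" using bip b by blast
      note [simp] = valid_dim[OF valid(1) ab a] valid_dim[OF valid(4) ab a]
      have "p a * f a *\<^sub>v (mapv X a b *\<^sub>v x) = (p a * f a * mapv X a b) *\<^sub>v x"
        using x(1) by (intro mult_mat_vec_assoc_dim[symmetric]) simp_all
      also have "\<dots> = (mapv Y a b * (p b * f b)) *\<^sub>v x" unfolding morph_eq[OF pf_morph ab a] ..
      also have "\<dots> = mapv Y a b *\<^sub>v (p b * f b *\<^sub>v x)" using x(1) by (intro mult_mat_vec_assoc_dim) simp_all
      also have "\<dots> = 0\<^sub>v (dimv Y a)" unfolding x(2) by (intro eq_vecI) (simp_all add: scalar_prod_def)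
      finally show "mapv X a b *\<^sub>v x = 0\<^sub>v (dimv X a)" by (intro sink[OF a] carrier_vecI) simp_all
    qed
  qed
  show "inj_family (\<lambda>a. p a * f a)"
    unfolding inj_family_def
  proof (intro allI impI)
    fix a x assume x: "dim_vec x = dim_col (p a * f a)" "p a * f a *\<^sub>v x = 0\<^sub>v (dim_row (p a * f a))"
    have "x \<in> carrier_vec (dimv X a)" by (rule carrier_vecI) (use x(1) in simp)
    moreover have "p a * f a *\<^sub>v x = 0\<^sub>v (dimv Y a)" using x(2) by simp
    ultimately have "x \<in> carrier_vec (dimv X a)" "p a * f a *\<^sub>v x = 0\<^sub>v (dimv Y a)" by blast+
    thus "x = 0\<^sub>v (dim_col (p a * f a))" using sink[of a x] source[of a x] by (cases "sk a") simp_all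
  qed
qed

text \<open>The maps t from \<open>sink_quotient\<close> can fail to commute only on arrows into a.
  If Y vanishes at all neighbours of a, the two sides there are matrices without columns; then t is
  a morphism that splits p f.\<close>

lemma support_X_sink:
  assumes a: "sk a" "dimv X a \<noteq> 0"
  shows "dimv Y a \<noteq> 0 \<or> (\<exists>b. adj a b \<and> dimv Y b \<noteq> 0)"
proof (rule ccontr)
  assume "\<not> ?thesis"
  hence Ya: "dimv Y a = 0" and Yb: "\<And>b. adj a b \<Longrightarrow> dimv Y b = 0" by auto
  have "unit_vec (dimv X a) 0 \<noteq> (0\<^sub>v (dimv X a) :: 'k vec)" using a(2) by simp
  moreover have "p a * f a *\<^sub>v unit_vec (dimv X a) 0 = 0\<^sub>v (dimv Y a)" using Ya by (intro eq_vecI) auto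
  ultimately obtain t where t: "\<And>a. t a \<in> carrier_mat (dimv X a) (dimv Y a)" "\<And>a. p a * f a * t a = 1\<^sub>m (dimv Y a)"
    "\<And>a' b. adj a' b \<Longrightarrow> sk a' \<Longrightarrow> a' \<noteq> a \<Longrightarrow> mapv X a' b * t b = t a' * mapv Y a' b"
    using sink_quotient[OF a(1) unit_vec_carrier] by metis
  have "morph adj sk Y X t"
  proof (rule morphI)
    fix a' b assume ab: "adj a' b" "sk a'"
    show "mapv X a' b * t b = t a' * mapv Y a' b"
    proof (cases "a' = a")
      case True
      thus ?thesis using t(1)[of b] t(1)[of a'] Yb[of b] ab valid_dim[OF valid(1) ab] valid_dim[OF valid(4) ab]
        by (intro mat_eq_if_no_cols) auto
    qed (use t(3) ab in blast)
  qed (use t(1) in auto)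
  hence "split_epi adj sk X Y (\<lambda>a. p a * f a)" unfolding split_epi_def using t(2) by blast
  thus False using pf_not_split_epi by blast
qed

lemma support_X_source:
  assumes b: "\<not> sk b" "dimv X b \<noteq> 0"
  shows "dimv Y b \<noteq> 0 \<or> (\<exists>a. adj a b \<and> dimv X a \<noteq> 0)"
proof (rule ccontr)
  assume "\<not> ?thesis"
  hence Yb: "dimv Y b = 0" and Xa: "\<And>a. adj a b \<Longrightarrow> dimv X a = 0" by auto
  show False
  proof (rule no_source_kernel[OF b(1)])
    show "unit_vec (dimv X b) 0 \<in> carrier_vec (dimv X b)" by simp
    show "unit_vec (dimv X b) 0 \<noteq> (0\<^sub>v (dimv X b) :: 'k vec)" using b(2) by simp
    show "p b * f b *\<^sub>v unit_vec (dimv X b) 0 = 0\<^sub>v (dimv Y b)" using Yb by (intro eq_vecI) auto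
    show "mapv X a b *\<^sub>v unit_vec (dimv X b) 0 = 0\<^sub>v (dimv X a)" if "adj a b" for a
      using Xa[OF that] that valid_dim(1)[OF valid(1), of a b] b(1) bip[OF that] by (intro eq_vecI) auto
  qed
qed

lemma support_X_near:
  assumes "dimv X a \<noteq> 0"
  shows "\<exists>b c. (b = a \<or> adj a b) \<and> (c = b \<or> adj b c) \<and> dimv Y c \<noteq> 0"
proof (cases "sk a")
  case True
  thus ?thesis using support_X_sink[OF True assms] by blast
next
  case False
  from support_X_source[OF this assms] show ?thesis
  proof
    assume "\<exists>c. adj c a \<and> dimv X c \<noteq> 0"
    then obtain c where c: "adj c a" "dimv X c \<noteq> 0" by blast
    hence "sk c" using False bip by blast
    from support_X_sink[OF this c(2)] c(1) show ?thesis using sym by blast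
  qed blast
qed

lemma dim_Z_le_E: "dimv Z a \<le> dimv E a"
  by (rule dim_le_if_one_sided_inverse[of "g a" _ _ "s a"]) (auto simp: gs)

text \<open>V is an extension of Z by the representation with value k at c and e; it is glued to Z along a
  functional on Z_b that does not vanish on z, so that V \<rightarrow> Z does not split. If E_c = 0 or E_e = 0, a
  lift V \<rightarrow> E would vanish on the new basis vector at c and hence induce a splitting of g.\<close>
lemma extension_support:
  assumes cb: "adj c b" and ce: "adj c e" and c: "sk c" and be: "b \<noteq> e"
    and z: "z \<in> carrier_vec (dimv Z b)" "z \<noteq> 0\<^sub>v (dimv Z b)" "mapv Z c b *\<^sub>v z = 0\<^sub>v (dimv Z c)"
  shows "dimv E c \<noteq> 0 \<and> dimv E e \<noteq> 0"
proof (rule ccontr)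
  assume "\<not> ?thesis"
  hence E0: "dimv E c = 0 \<or> dimv E e = 0" by blast
  from z(1,2) obtain k where k: "k < dimv Z b" "z $ k \<noteq> 0" by (auto simp: vec_eq_iff)
  have nc: "\<not> sk b" "\<not> sk e" using bip[OF cb] bip[OF ce] c by auto
  hence bc: "b \<noteq> c" "e \<noteq> c" using c by auto
  define dV where "dV a = (if a = c \<or> a = e then dimv Z a + 1 else dimv Z a)" for a
  \<comment> \<open>Row \<open>dimv Z c\<close> belongs to the new basis vector at c. In the arrow
    from b it reads off coordinate k, where z is nonzero; in the arrow from e its 1 sends the new
    basis vector at e to the one at c.\<close>
  define V :: "('v, 'k) rep" where "V = \<lparr>dimv = dV, mapv = (\<lambda>a b'. mat (dV a) (dV b') (\<lambda>(i,j).
     if i < dimv Z a \<and> j < dimv Z b' then mapv Z a b' $$ (i,j)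
     else if a = c \<and> i = dimv Z c \<and> (b' = b \<and> j = k \<or> b' = e \<and> j = dimv Z e) then 1 else 0))\<rparr>"
  have dV: "dimv V = dV" by (simp add: V_def)
  have le: "dimv Z a \<le> dV a" for a by (simp add: dV_def)
  have V: "valid_rep adj sk V"
  proof -
    have "support V \<subseteq> support Z \<union> {c, e}" by (auto simp: support_def dV dV_def split: if_splits)
    moreover have "finite (support Z)" using valid(3) by (simp add: valid_rep_def)
    ultimately show ?thesis unfolding valid_rep_def by (auto intro: finite_subset simp: dV) (simp add: V_def)
  qed
  let ?p = "\<lambda>a. rect_id (dimv Z a) (dV a)" and ?j = "\<lambda>a. rect_id (dV a) (dimv Z a)"
  have pj: "?p a * ?j a = (1\<^sub>m (dimv Z a) :: 'k mat)" for a using le by (rule rect_id_retract)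
  have p: "morph adj sk V Z ?p"
  proof (rule morphI)
    fix a b' assume ab: "adj a b'" "sk a"
    note [simp] = valid_dim[OF valid(3) ab] valid_dim[OF V ab]
    show "mapv Z a b' * ?p b' = ?p a * mapv V a b'"
    proof (rule eq_matI)
      fix i l assume "i < dim_row (?p a * mapv V a b')" "l < dim_col (?p a * mapv V a b')"
      hence il: "i < dimv Z a" "l < dV b'" by (simp_all add: dV)
      have "(mapv Z a b' * ?p b') $$ (i,l) = (if l < dimv Z b' then mapv Z a b' $$ (i,l) else 0)"
        by (rule mult_rect_id) (use il in simp_all)
      moreover have "(?p a * mapv V a b') $$ (i,l) = (if i < dV a then mapv V a b' $$ (i,l) else 0)"
        by (rule rect_id_mult) (use il in \<open>simp_all add: dV\<close>)
      ultimately show "(mapv Z a b' * ?p b') $$ (i,l) = (?p a * mapv V a b') $$ (i,l)"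
        using il le[of a] by (auto simp: V_def)
    qed (simp_all add: dV)
  qed (simp_all add: dV)
  have "\<not> split_epi adj sk V Z ?p"
  proof
    assume "split_epi adj sk V Z ?p"
    then obtain t where t: "morph adj sk Z V t" "\<And>a. ?p a * t a = 1\<^sub>m (dimv Z a)" unfolding split_epi_def by blast
    note [simp] = morph_dim[OF t(1)] valid_dim[OF valid(3) cb c] valid_dim[OF V cb c]
    have dVb: "dV b = dimv Z b" using bc be by (simp add: dV_def)
    \<comment> \<open>V agrees with Z at b, so a section is the identity there. Its naturality on c
      - b would make the new coordinate of the image of z both \<open>z $ k\<close> and 0.\<close>
    have tb: "t b = 1\<^sub>m (dimv Z b)" using t(2)[of b] by (simp add: dVb dV)
    have "mapv V c b *\<^sub>v z = mapv V c b * t b *\<^sub>v z" using z(1) by (simp add: tb dV dVb)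
    also have "\<dots> = t c *\<^sub>v (mapv Z c b *\<^sub>v z)"
      unfolding morph_eq[OF t(1) cb c] by (rule mult_mat_vec_assoc_dim) (use z(1) in simp_all)
    also have "\<dots> = 0\<^sub>v (dV c)" unfolding z(3) by (intro eq_vecI) (simp_all add: scalar_prod_def dV)
    finally have "(mapv V c b *\<^sub>v z) $ dimv Z c = 0" by (simp add: dV_def)
    moreover have "(mapv V c b *\<^sub>v z) $ dimv Z c = z $ k"
    proof -
      have "(mapv V c b *\<^sub>v z) $ dimv Z c = (\<Sum>l = 0..<dimv Z b. (if l = k then 1 else 0) * z $ l)"
        using z(1) dVb be by (simp add: V_def scalar_prod_def dV_def)
      also have "\<dots> = (\<Sum>l = 0..<dimv Z b. if l = k then z $ l else 0)" by (rule sum.cong) auto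
      also have "\<dots> = z $ k" using k by simp
      finally show ?thesis .
    qed
    ultimately show False using k by simp
  qed
  then obtain h where h: "morph adj sk V E h" "\<And>a. g a * h a = ?p a"
    using right V p unfolding right_almost_split_def by blast
  note [simp] = morph_dim[OF h(1)]
  have last_col: "h c $$ (i, dimv Z c) = 0" if i: "i < dimv E c" for i
  proof -
    have Ee: "dimv E e = 0" using E0 i by auto
    hence Ze: "dimv Z e = 0" using dim_Z_le_E[of e] by simp
    note [simp] = valid_dim[OF valid(2) ce c] valid_dim[OF V ce c]
    \<comment> \<open>As Z_e = 0, column 0 at e is the new basis vector; V sends it to the one at c,
      while h sends it into E_e = 0.\<close>
    have "0 = (mapv E c e * h e) $$ (i, 0)" using i Ee by (simp add: dV dV_def scalar_prod_def)
    also have "\<dots> = (h c * mapv V c e) $$ (i, 0)" unfolding morph_eq[OF h(1) ce c] ..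
    also have "\<dots> = (\<Sum>l = 0..<dV c. h c $$ (i, l) * (if l = dimv Z c then 1 else 0))"
      using i Ze bc by (simp add: dV dV_def scalar_prod_def V_def)
    also have "\<dots> = (\<Sum>l = 0..<dV c. if l = dimv Z c then h c $$ (i, l) else 0)" by (rule sum.cong) auto
    also have "\<dots> = h c $$ (i, dimv Z c)" by (simp add: dV_def)
    finally show ?thesis by simp
  qed
  \<comment> \<open>Naturality of h j inserts j p only at the target of an arrow, so the identity is
    wanted at sinks. Among them V differs from Z at c alone, where h vanishes on the new
    vector.\<close>
  have hjp: "h a * ?j a * ?p a = h a" if a: "sk a" for a
  proof (cases "a = c")
    case True
    show ?thesis unfolding True
    proof (rule eq_matI)
      fix i l assume "i < dim_row (h c)" "l < dim_col (h c)"
      hence il: "i < dimv E c" "l < dV c" by (simp_all add: dV)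
      have "(h c * ?j c * ?p c) $$ (i,l) = (if l < dimv Z c then (h c * ?j c) $$ (i,l) else 0)"
        by (rule mult_rect_id) (use il in \<open>simp_all add: dV\<close>)
      also have "\<dots> = (if l < dimv Z c then h c $$ (i,l) else 0)"
      proof (cases "l < dimv Z c")
        case True
        have "(h c * ?j c) $$ (i,l) = (if l < dV c then h c $$ (i,l) else 0)"
          by (rule mult_rect_id) (use il True in \<open>simp_all add: dV\<close>)
        thus ?thesis using il by simp
      qed simp
      also have "\<dots> = h c $$ (i,l)" using il last_col[OF il(1)] by (auto simp: dV_def less_Suc_eq)
      finally show "(h c * ?j c * ?p c) $$ (i,l) = h c $$ (i,l)" .
    qed (simp_all add: dV)
  next
    case False
    hence "dV a = dimv Z a" using a nc by (auto simp: dV_def)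
    thus ?thesis by (simp add: dV)
  qed
  let ?s = "\<lambda>a. h a * ?j a"
  have "morph adj sk Z E ?s"
  proof (rule morphI)
    fix a b' assume ab: "adj a b'" "sk a"
    note [simp] = valid_dim[OF valid(3) ab] valid_dim[OF V ab] valid_dim[OF valid(2) ab]
    have "mapv E a b' * ?s b' = (h a * mapv V a b') * ?j b'"
      unfolding morph_eq[OF h(1) ab, symmetric] by (simp add: mat_ring dV)
    also have "\<dots> = (h a * ?j a * ?p a * mapv V a b') * ?j b'" unfolding hjp[OF ab(2)] ..
    also have "\<dots> = h a * ?j a * (?p a * mapv V a b') * ?j b'" by (simp add: mat_ring dV)
    also have "\<dots> = h a * ?j a * mapv Z a b' * (?p b' * ?j b')"
      unfolding morph_eq[OF p ab, symmetric] by (simp add: mat_ring dV)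
    also have "\<dots> = ?s a * mapv Z a b'" unfolding pj by (simp add: dV)
    finally show "mapv E a b' * ?s b' = ?s a * mapv Z a b'" .
  qed (simp_all add: dV)
  moreover have "g a * ?s a = 1\<^sub>m (dimv Z a)" for a
  proof -
    have "g a * ?s a = (g a * h a) * ?j a" by (simp add: mat_ring dV)
    thus ?thesis unfolding h(2) pj .
  qed
  ultimately have "split_epi adj sk E Z g" unfolding split_epi_def by blast
  thus False using right unfolding right_almost_split_def by blast
qed

end

section \<open>The trace pairing\<close>

definition mat_trace :: "'k::field mat \<Rightarrow> 'k" where
  "mat_trace A = (\<Sum>i<dim_row A. A $$ (i,i))"

lemma mat_trace_mult:
  "dim_col A = dim_row B \<Longrightarrow> dim_col B = dim_row A \<Longrightarrow>
    mat_trace (A * B) = (\<Sum>i<dim_row A. \<Sum>j<dim_row B. A $$ (i,j) * B $$ (j,i))"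
  unfolding mat_trace_def by (auto simp: scalar_prod_def atLeast0LessThan intro!: sum.cong)

lemma mat_trace_comm:
  "dim_col A = dim_row B \<Longrightarrow> dim_col B = dim_row A \<Longrightarrow> mat_trace (A * B) = mat_trace (B * A)"
  by (simp add: mat_trace_mult sum.swap[of _ "{..<dim_row A}"] mult.commute)

lemma mat_trace_diff:
  "dim_row A = dim_row B \<Longrightarrow> dim_col A = dim_row A \<Longrightarrow> dim_col B = dim_row B \<Longrightarrow> mat_trace (A - B) = mat_trace A - mat_trace B"
  by (simp add: mat_trace_def sum_subtractf)

lemma mat_trace_sum:
  assumes "finite B" "\<And>b. b \<in> B \<Longrightarrow> dim_row (C b) = dim_col T \<and> dim_col (C b) = dim_row T"
  shows "(\<Sum>b\<in>B. mat_trace (T * C b)) = (\<Sum>i<dim_row T. \<Sum>k<dim_col T. T $$ (i,k) * (\<Sum>b\<in>B. C b $$ (k,i)))"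
proof -
  have "(\<Sum>b\<in>B. mat_trace (T * C b)) = (\<Sum>b\<in>B. \<Sum>i<dim_row T. \<Sum>k<dim_col T. T $$ (i,k) * C b $$ (k,i))"
    using assms(2) by (intro sum.cong) (simp_all add: mat_trace_mult)
  also have "\<dots> = (\<Sum>i<dim_row T. \<Sum>b\<in>B. \<Sum>k<dim_col T. T $$ (i,k) * C b $$ (k,i))" by (rule sum.swap)
  also have "\<dots> = (\<Sum>i<dim_row T. \<Sum>k<dim_col T. \<Sum>b\<in>B. T $$ (i,k) * C b $$ (k,i))"
    by (intro sum.cong refl sum.swap)
  finally show ?thesis by (simp add: sum_distrib_left)
qed

context bipartite
begin

text \<open>Links sums cut off to a finite set F with the sums over all neighbours in
  \<open>balanced\<close>: neighbours outside F contribute zero.\<close>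

lemma mat_trace_sum_neighbours:
  assumes F: "finite F" and t: "dim_row t = m" "dim_col t = n"
    and C: "\<And>c. adj v c \<Longrightarrow> C c \<in> carrier_mat n m"
    and zero: "\<And>c k i. adj v c \<Longrightarrow> c \<notin> F \<Longrightarrow> k < n \<Longrightarrow> i < m \<Longrightarrow> C c $$ (k,i) = 0"
  shows "(\<Sum>c\<in>{c\<in>F. adj v c}. mat_trace (t * C c)) = (\<Sum>i<m. \<Sum>k<n. t $$ (i,k) * (\<Sum>c\<in>{c. adj v c}. C c $$ (k,i)))"
proof -
  have "(\<Sum>c\<in>{c\<in>F. adj v c}. mat_trace (t * C c)) = (\<Sum>i<m. \<Sum>k<n. t $$ (i,k) * (\<Sum>c\<in>{c\<in>F. adj v c}. C c $$ (k,i)))"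
    unfolding t[symmetric] by (rule mat_trace_sum) (use F C t in auto)
  moreover have "(\<Sum>c\<in>{c\<in>F. adj v c}. C c $$ (k,i)) = (\<Sum>c\<in>{c. adj v c}. C c $$ (k,i))" if "i < m" "k < n" for i k
    by (rule sum.mono_neutral_left) (use finite_nbrs zero that in auto)
  ultimately show ?thesis by simp
qed

text \<open>A balanced family is the same thing as a morphism from sigma^- W to sigma V. The trace pairing
  identifies the space of balanced families with the dual of Ext^1(V, W).\<close>
definition balanced :: "('v, 'k::field) rep \<Rightarrow> ('v, 'k) rep \<Rightarrow> ('v \<Rightarrow> 'v \<Rightarrow> 'k mat) \<Rightarrow> bool" where
  "balanced W V \<phi> \<longleftrightarrow> (\<forall>a b. adj a b \<and> sk a \<longrightarrow> \<phi> b a \<in> carrier_mat (dimv V b) (dimv W a))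
    \<and> (\<forall>a. sk a \<longrightarrow> (\<forall>k<dimv V a. \<forall>i<dimv W a. (\<Sum>b\<in>{b. adj a b}. (mapv V a b * \<phi> b a) $$ (k,i)) = 0))
    \<and> (\<forall>b. \<not> sk b \<longrightarrow> (\<forall>l<dimv V b. \<forall>i<dimv W b. (\<Sum>a\<in>{a. adj b a}. (\<phi> b a * mapv W a b) $$ (l,i)) = 0))"

text \<open>The cutoff F makes the sum finite on an infinite tree. For F containing both supports
  the value does not depend on F, which leaves room for enlarged representations.\<close>

definition pairing :: "'v set \<Rightarrow> ('v \<Rightarrow> 'v \<Rightarrow> 'k::field mat) \<Rightarrow> ('v \<Rightarrow> 'v \<Rightarrow> 'k mat) \<Rightarrow> 'k" where
  "pairing F \<epsilon> \<phi> = (\<Sum>a\<in>{a\<in>F. sk a}. \<Sum>b\<in>{b\<in>F. adj a b}. mat_trace (\<epsilon> a b * \<phi> b a))"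

text \<open>Cyclicity of the trace brings each t to the front. After regrouping by vertices, the
  coefficients of the entries of t are the sums that \<open>balanced\<close> requires to vanish.
  Read in one direction, balanced families kill coboundaries; read in the other, a family that kills
  all coboundaries is balanced.\<close>

lemma pairing_coboundary:
  assumes W: "valid_rep adj sk W" and V: "valid_rep adj sk V"
    and t: "\<And>v. dim_row (t v) = dimv W v" "\<And>v. dim_col (t v) = dimv V v"
    and \<phi>: "\<And>a b. adj a b \<Longrightarrow> sk a \<Longrightarrow> \<phi> b a \<in> carrier_mat (dimv V b) (dimv W a)"
    and F: "finite F" "support W \<subseteq> F" "support V \<subseteq> F"
  shows "pairing F (\<lambda>a b. mapv W a b * t b - t a * mapv V a b) \<phi> =
    (\<Sum>b\<in>{b\<in>F. \<not> sk b}. \<Sum>i<dimv W b. \<Sum>l<dimv V b. t b $$ (i,l) * (\<Sum>a\<in>{a. adj b a}. (\<phi> b a * mapv W a b) $$ (l,i)))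
    - (\<Sum>a\<in>{a\<in>F. sk a}. \<Sum>i<dimv W a. \<Sum>k<dimv V a. t a $$ (i,k) * (\<Sum>b\<in>{b. adj a b}. (mapv V a b * \<phi> b a) $$ (k,i)))"
proof -
  have \<phi>d: "dim_row (\<phi> b a) = dimv V b" "dim_col (\<phi> b a) = dimv W a" if "adj a b" "sk a" for a b using \<phi>[OF that] by auto
  have 1: "mat_trace ((mapv W a b * t b - t a * mapv V a b) * \<phi> b a) = mat_trace (t b * (\<phi> b a * mapv W a b)) - mat_trace (t a * (mapv V a b * \<phi> b a))"
    if ab: "adj a b" "sk a" for a b
  proof -
    note [simp] = valid_dim[OF W ab] valid_dim[OF V ab] \<phi>d[OF ab] t
    have "mat_trace ((mapv W a b * t b - t a * mapv V a b) * \<phi> b a)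
      = mat_trace (mapv W a b * (t b * \<phi> b a)) - mat_trace (t a * (mapv V a b * \<phi> b a))"
      by (simp add: mat_ring mat_trace_diff)
    also have "mat_trace (mapv W a b * (t b * \<phi> b a)) = mat_trace (t b * \<phi> b a * mapv W a b)"
      by (rule mat_trace_comm) simp_all
    finally show ?thesis by (simp add: mat_ring)
  qed
  have "pairing F (\<lambda>a b. mapv W a b * t b - t a * mapv V a b) \<phi> =
      (\<Sum>a\<in>{a\<in>F. sk a}. \<Sum>b\<in>{b\<in>F. adj a b}. mat_trace (t b * (\<phi> b a * mapv W a b)))
      - (\<Sum>a\<in>{a\<in>F. sk a}. \<Sum>b\<in>{b\<in>F. adj a b}. mat_trace (t a * (mapv V a b * \<phi> b a)))"
    unfolding pairing_def sum_subtractf[symmetric] by (intro sum.cong refl 1) auto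
  also have "(\<Sum>a\<in>{a\<in>F. sk a}. \<Sum>b\<in>{b\<in>F. adj a b}. mat_trace (t b * (\<phi> b a * mapv W a b)))
      = (\<Sum>b\<in>F. \<Sum>a\<in>{a\<in>{a\<in>F. sk a}. adj a b}. mat_trace (t b * (\<phi> b a * mapv W a b)))"
    by (rule sum.swap_restrict) (use F in auto)
  also have "\<dots> = (\<Sum>b\<in>{b\<in>F. \<not> sk b}. \<Sum>a\<in>{a\<in>F. adj b a}. mat_trace (t b * (\<phi> b a * mapv W a b)))"
  proof (rule sum.mono_neutral_cong_right)
    show "\<forall>b\<in>F - {b\<in>F. \<not> sk b}. (\<Sum>a\<in>{a\<in>{a\<in>F. sk a}. adj a b}. mat_trace (t b * (\<phi> b a * mapv W a b))) = 0"
      using bip by (auto intro!: sum.neutral)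
    show "(\<Sum>a\<in>{a\<in>{a\<in>F. sk a}. adj a b}. mat_trace (t b * (\<phi> b a * mapv W a b)))
      = (\<Sum>a\<in>{a\<in>F. adj b a}. mat_trace (t b * (\<phi> b a * mapv W a b)))" if "b \<in> {b\<in>F. \<not> sk b}" for b
      using that bip sym by (intro sum.cong) auto
  qed (use F in auto)
  also have "\<dots> = (\<Sum>b\<in>{b\<in>F. \<not> sk b}. \<Sum>i<dimv W b. \<Sum>l<dimv V b. t b $$ (i,l) * (\<Sum>a\<in>{a. adj b a}. (\<phi> b a * mapv W a b) $$ (l,i)))"
  proof (intro sum.cong refl mat_trace_sum_neighbours F t)
    fix b a assume b: "b \<in> {b\<in>F. \<not> sk b}" and "adj b a"
    hence ab: "adj a b" "sk a" using bip sym by auto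
    note [simp] = valid_dim[OF W ab] \<phi>d[OF ab]
    show "\<phi> b a * mapv W a b \<in> carrier_mat (dimv V b) (dimv W b)" by (intro carrier_matI) simp_all
    show "(\<phi> b a * mapv W a b) $$ (l,i) = 0" if "a \<notin> F" "l < dimv V b" "i < dimv W b" for l i
    proof -
      have "dimv W a = 0" using that(1) F(2) by (auto simp: support_def)
      thus ?thesis using that by (simp add: scalar_prod_def)
    qed
  qed
  also have "(\<Sum>a\<in>{a\<in>F. sk a}. \<Sum>b\<in>{b\<in>F. adj a b}. mat_trace (t a * (mapv V a b * \<phi> b a)))
     = (\<Sum>a\<in>{a\<in>F. sk a}. \<Sum>i<dimv W a. \<Sum>k<dimv V a. t a $$ (i,k) * (\<Sum>b\<in>{b. adj a b}. (mapv V a b * \<phi> b a) $$ (k,i)))"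
  proof (intro sum.cong refl mat_trace_sum_neighbours F t)
    fix a b assume a: "a \<in> {a\<in>F. sk a}" and ab: "adj a b"
    hence sa: "sk a" by simp
    note [simp] = valid_dim[OF V ab sa] \<phi>d[OF ab sa]
    show "mapv V a b * \<phi> b a \<in> carrier_mat (dimv V a) (dimv W a)" by (intro carrier_matI) simp_all
    show "(mapv V a b * \<phi> b a) $$ (k,i) = 0" if "b \<notin> F" "k < dimv V a" "i < dimv W a" for k i
    proof -
      have "dimv V b = 0" using that(1) F(3) by (auto simp: support_def)
      thus ?thesis using that by (simp add: scalar_prod_def)
    qed
  qed
  finally show ?thesis .
qed

lemma pairing_coboundary_zero:
  assumes W: "valid_rep adj sk W" and V: "valid_rep adj sk V"
    and t: "\<And>v. dim_row (t v) = dimv W v" "\<And>v. dim_col (t v) = dimv V v"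
    and \<phi>: "balanced W V \<phi>" and F: "finite F" "support W \<subseteq> F" "support V \<subseteq> F"
  shows "pairing F (\<lambda>a b. mapv W a b * t b - t a * mapv V a b) \<phi> = 0"
proof -
  have "\<And>a b. adj a b \<Longrightarrow> sk a \<Longrightarrow> \<phi> b a \<in> carrier_mat (dimv V b) (dimv W a)" using \<phi> by (auto simp: balanced_def)
  from pairing_coboundary[OF W V t this F] show ?thesis using \<phi> by (simp add: balanced_def)
qed

lemma pairing_support:
  assumes "finite F" "F0 \<subseteq> F"
    and d: "\<And>a b. adj a b \<Longrightarrow> sk a \<Longrightarrow> \<epsilon> a b \<in> carrier_mat (m a) (n b) \<and> \<phi> b a \<in> carrier_mat (n b) (m a)"
    and z: "\<And>a. a \<notin> F0 \<Longrightarrow> m a = 0 \<and> n a = 0"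
  shows "pairing F \<epsilon> \<phi> = pairing F0 \<epsilon> \<phi>"
  unfolding pairing_def
proof (rule sum.mono_neutral_cong_right)
  have tr0: "mat_trace (\<epsilon> a b * \<phi> b a) = 0" if "adj a b" "sk a" "a \<notin> F0 \<or> b \<notin> F0" for a b
    using d[OF that(1,2)] z[of a] z[of b] that(3) by (auto simp: mat_trace_mult)
  show "\<forall>a\<in>{a\<in>F. sk a} - {a\<in>F0. sk a}. (\<Sum>b\<in>{b\<in>F. adj a b}. mat_trace (\<epsilon> a b * \<phi> b a)) = 0"
    using tr0 by (auto intro!: sum.neutral)
  show "(\<Sum>b\<in>{b\<in>F. adj a b}. mat_trace (\<epsilon> a b * \<phi> b a)) = (\<Sum>b\<in>{b\<in>F0. adj a b}. mat_trace (\<epsilon> a b * \<phi> b a))"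
    if "a \<in> {a\<in>F0. sk a}" for a
    by (rule sum.mono_neutral_right) (use assms(1,2) tr0 that in auto)
qed (use assms in auto)

end

context almost_split
begin

text \<open>The off-diagonal block of the arrows of E when E_a is identified with the sum of X_a and
  Z_a through the splittings. It represents the class of the sequence in Ext^1(Z, X).\<close>

definition cocycle :: "'v \<Rightarrow> 'v \<Rightarrow> 'k mat" where
  "cocycle a b = r a * mapv E a b * s b"

lemma cocycle_dim [simp]: "dim_row (cocycle a b) = dimv X a" "dim_col (cocycle a b) = dimv Z b"
  by (simp_all add: cocycle_def)

text \<open>A trivialisation t corrects the linear section s to s - f t, which commutes with the
  arrows and would split g.\<close>

lemma cocycle_not_coboundary:
  assumes t: "\<And>v. dim_row (t v) = dimv X v" "\<And>v. dim_col (t v) = dimv Z v"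
    and co: "\<And>a b. adj a b \<Longrightarrow> sk a \<Longrightarrow> cocycle a b = mapv X a b * t b - t a * mapv Z a b"
  shows False
proof -
  note [simp] = t
  let ?s = "\<lambda>a. s a - f a * t a"
  have "morph adj sk Z E ?s"
  proof (rule morphI)
    fix a b assume ab: "adj a b" "sk a"
    note [simp] = valid_dim[OF valid(1) ab] valid_dim[OF valid(2) ab] valid_dim[OF valid(3) ab]
    have "mapv E a b * s b = (f a * r a + s a * g a) * (mapv E a b * s b)" unfolding fr_sg by simp
    also have "\<dots> = f a * cocycle a b + s a * (g a * mapv E a b) * s b" unfolding cocycle_def by (simp add: mat_ring)
    also have "\<dots> = f a * cocycle a b + s a * mapv Z a b * (g b * s b)"
      unfolding morph_eq[OF g ab, symmetric] by (simp add: mat_ring)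
    also have "\<dots> = f a * cocycle a b + s a * mapv Z a b" unfolding gs by simp
    finally have 1: "mapv E a b * s b = f a * (mapv X a b * t b - t a * mapv Z a b) + s a * mapv Z a b" unfolding co[OF ab] .
    have 2: "mapv E a b * (f b * t b) = f a * (mapv X a b * t b)"
    proof -
      have "mapv E a b * (f b * t b) = (mapv E a b * f b) * t b" by (simp add: mat_ring)
      thus ?thesis unfolding morph_eq[OF f ab] by (simp add: mat_ring)
    qed
    have "mapv E a b * ?s b = mapv E a b * s b - mapv E a b * (f b * t b)" by (simp add: mat_ring)
    also have "\<dots> = s a * mapv Z a b - f a * (t a * mapv Z a b)"
      unfolding 1 2 by (simp add: mat_ring) (auto simp: mat_eq_iff simp del: index_mult_mat(1))
    also have "\<dots> = ?s a * mapv Z a b" by (simp add: mat_ring)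
    finally show "mapv E a b * ?s b = ?s a * mapv Z a b" .
  qed simp_all
  moreover have "g a * ?s a = 1\<^sub>m (dimv Z a)" for a
  proof -
    have "g a * ?s a = g a * s a - (g a * f a) * t a" by (simp add: mat_ring)
    thus ?thesis unfolding gs gf by (auto simp: mat_eq_iff)
  qed
  ultimately have "split_epi adj sk E Z g" unfolding split_epi_def by blast
  thus False using right unfolding right_almost_split_def by blast
qed

text \<open>As q extends along f to some c : E \<rightarrow> W, the pushout of the sequence along q
  is trivial: q times the cocycle is the coboundary of c s. Cyclicity of the trace moves q from the
  family onto the cocycle.\<close>

lemma pairing_zero_if_factors_mono:
  assumes W: "valid_rep adj sk W" and q: "morph adj sk X W q" "\<not> split_mono adj sk X W q"
    and \<phi>': "balanced W Z \<phi>'" and \<phi>: "\<And>a b. adj a b \<Longrightarrow> sk a \<Longrightarrow> \<phi> b a = \<phi>' b a * q a"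
    and F: "finite F" "support W \<subseteq> F" "support Z \<subseteq> F"
  shows "pairing F cocycle \<phi> = 0"
proof -
  from left W q obtain c where c: "morph adj sk E W c" "\<And>a. c a * f a = q a" unfolding left_almost_split_def by blast
  note [simp] = morph_dim[OF c(1)] morph_dim[OF q(1)]
  have "pairing F cocycle \<phi> = pairing F (\<lambda>a b. mapv W a b * (c b * s b) - (c a * s a) * mapv Z a b) \<phi>'"
    unfolding pairing_def
  proof (intro sum.cong refl)
    fix a b assume "a \<in> {a\<in>F. sk a}" "b \<in> {b\<in>F. adj a b}"
    hence ab: "adj a b" "sk a" by auto
    note [simp] = valid_dim[OF W ab] valid_dim[OF valid(2) ab] valid_dim[OF valid(3) ab]
    have \<phi>d [simp]: "dim_row (\<phi>' b a) = dimv Z b" "dim_col (\<phi>' b a) = dimv W a" using \<phi>' ab by (auto simp: balanced_def)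
    have "mapv W a b * (c b * s b) = (mapv W a b * c b) * s b" by (simp add: mat_ring)
    also have "\<dots> = c a * ((f a * r a + s a * g a) * mapv E a b * s b)" unfolding morph_eq[OF c(1) ab] fr_sg by (simp add: mat_ring)
    also have "\<dots> = (c a * f a) * cocycle a b + c a * s a * (g a * mapv E a b) * s b"
      unfolding cocycle_def by (simp add: mat_ring)
    also have "\<dots> = q a * cocycle a b + c a * s a * mapv Z a b * (g b * s b)"
      unfolding c(2) morph_eq[OF g ab, symmetric] by (simp add: mat_ring)
    finally have "mapv W a b * (c b * s b) = q a * cocycle a b + c a * s a * mapv Z a b" unfolding gs by simp
    hence "q a * cocycle a b = mapv W a b * (c b * s b) - (c a * s a) * mapv Z a b"
      by (auto simp: mat_eq_iff simp del: index_mult_mat(1))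
    moreover have "mat_trace (cocycle a b * \<phi> b a) = mat_trace (q a * cocycle a b * \<phi>' b a)"
    proof -
      have "mat_trace (cocycle a b * \<phi> b a) = mat_trace ((cocycle a b * \<phi>' b a) * q a)" unfolding \<phi>[OF ab] by (simp add: mat_ring)
      also have "\<dots> = mat_trace (q a * (cocycle a b * \<phi>' b a))" by (rule mat_trace_comm) simp_all
      finally show ?thesis by (simp add: mat_ring)
    qed
    ultimately show "mat_trace (cocycle a b * \<phi> b a) = mat_trace ((mapv W a b * (c b * s b) - (c a * s a) * mapv Z a b) * \<phi>' b a)"
      by simp
  qed
  also have "\<dots> = 0" by (rule pairing_coboundary_zero[OF W valid(3) _ _ \<phi>' F]) simp_all
  finally show ?thesis .
qed

lemma pairing_zero_if_factors_epi:
  assumes V: "valid_rep adj sk V" and h: "morph adj sk V Z h" "\<not> split_epi adj sk V Z h"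
    and \<phi>': "balanced X V \<phi>'" and \<phi>: "\<And>a b. adj a b \<Longrightarrow> sk a \<Longrightarrow> \<phi> b a = h b * \<phi>' b a"
    and F: "finite F" "support X \<subseteq> F" "support V \<subseteq> F"
  shows "pairing F cocycle \<phi> = 0"
proof -
  from right V h obtain c where c: "morph adj sk V E c" "\<And>a. g a * c a = h a" unfolding right_almost_split_def by blast
  note [simp] = morph_dim[OF c(1)] morph_dim[OF h(1)]
  \<comment> \<open>The lift c of h trivialises the pullback of the sequence along h. The sign turns
    r c V - X r c into a coboundary X t - t V.\<close>
  define t where "t a = - (r a * c a)" for a
  have t [simp]: "dim_row (t a) = dimv X a" "dim_col (t a) = dimv V a" for a by (simp_all add: t_def)
  have "pairing F cocycle \<phi> = pairing F (\<lambda>a b. mapv X a b * t b - t a * mapv V a b) \<phi>'"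
    unfolding pairing_def
  proof (intro sum.cong refl)
    fix a b assume "a \<in> {a\<in>F. sk a}" "b \<in> {b\<in>F. adj a b}"
    hence ab: "adj a b" "sk a" by auto
    note [simp] = valid_dim[OF V ab] valid_dim[OF valid(2) ab] valid_dim[OF valid(1) ab]
    have \<phi>d [simp]: "dim_row (\<phi>' b a) = dimv V b" "dim_col (\<phi>' b a) = dimv X a" using \<phi>' ab by (auto simp: balanced_def)
    have "r a * (mapv E a b * c b) = r a * (mapv E a b * ((f b * r b + s b * g b) * c b))" unfolding fr_sg by simp
    also have "\<dots> = r a * (mapv E a b * f b) * (r b * c b) + cocycle a b * (g b * c b)"
      unfolding cocycle_def by (simp add: mat_ring)
    also have "\<dots> = (r a * f a) * (mapv X a b * (r b * c b)) + cocycle a b * h b"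
      unfolding c(2) morph_eq[OF f ab] by (simp add: mat_ring)
    finally have "r a * (c a * mapv V a b) = mapv X a b * (r b * c b) + cocycle a b * h b"
      unfolding rf morph_eq[OF c(1) ab] by simp
    hence 1: "cocycle a b * h b = r a * (c a * mapv V a b) - mapv X a b * (r b * c b)"
      by (auto simp: mat_eq_iff simp del: index_mult_mat(1))
    have "cocycle a b * h b = mapv X a b * t b - t a * mapv V a b"
      unfolding 1 t_def by (simp add: mat_ring) (auto simp: mat_eq_iff simp del: index_mult_mat(1))
    moreover have "cocycle a b * \<phi> b a = cocycle a b * h b * \<phi>' b a" unfolding \<phi>[OF ab] by (simp add: mat_ring)
    ultimately show "mat_trace (cocycle a b * \<phi> b a) = mat_trace ((mapv X a b * t b - t a * mapv V a b) * \<phi>' b a)"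
      by simp
  qed
  also have "\<dots> = 0" by (rule pairing_coboundary_zero[OF valid(1) V _ _ \<phi>' F]) simp_all
  finally show ?thesis .
qed

text \<open>The coboundaries form a linear space that does not contain the cocycle, so a functional
  on matrix entries kills the former and not the latter. Its coefficients, arranged as matrices, are
  the family.\<close>

lemma nondegenerate_balanced:
  obtains \<phi> where "balanced X Z \<phi>"
    "\<And>F. finite F \<Longrightarrow> support X \<union> support Z \<subseteq> F \<Longrightarrow> pairing F cocycle \<phi> \<noteq> 0"
proof -
  define F where "F = support X \<union> support Z"
  have F: "finite F" "support X \<subseteq> F" "support Z \<subseteq> F" using valid(1,3) by (auto simp: F_def valid_rep_def)
  define I where "I = (SIGMA a:{a\<in>F. sk a}. SIGMA b:{b\<in>F. adj a b}. {..<dimv X a} \<times> {..<dimv Z b})"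
  have finI: "finite I" unfolding I_def using F(1) by (intro finite_SigmaI) auto
  define co where "co t a b = mapv X a b * t b - t a * mapv Z a b" for t :: "'v \<Rightarrow> 'k mat" and a b
  define S where "S = {x. \<exists>t. (\<forall>v. t v \<in> carrier_mat (dimv X v) (dimv Z v)) \<and> (\<forall>(a,b,i,j)\<in>I. x (a,b,i,j) = co t a b $$ (i,j))}"
  have co_entry: "co t a b $$ (i,j) = (mapv X a b * t b) $$ (i,j) - (t a * mapv Z a b) $$ (i,j)"
    if "(a,b,i,j) \<in> I" "\<And>v. t v \<in> carrier_mat (dimv X v) (dimv Z v)" for t a b i j
    using that(1) that(2)[of a] valid_dim[OF valid(3), of a b] unfolding co_def I_def by auto
  have I_dims: "adj a b \<and> sk a \<and> i < dimv X a \<and> j < dimv Z b" if "(a,b,i,j) \<in> I" for a b i j using that by (auto simp: I_def)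
  have "\<exists>l. (\<forall>x\<in>S. (\<Sum>i\<in>I. l i * x i) = 0) \<and> (\<Sum>i\<in>I. l i * (\<lambda>(a,b,i,j). cocycle a b $$ (i,j)) i) \<noteq> 0"
  proof (rule separating_functional[OF finI])
    fix x y assume "x \<in> S" "y \<in> S"
    then obtain t u where t: "\<And>v. t v \<in> carrier_mat (dimv X v) (dimv Z v)" "\<forall>(a,b,i,j)\<in>I. x (a,b,i,j) = co t a b $$ (i,j)"
      and u: "\<And>v. u v \<in> carrier_mat (dimv X v) (dimv Z v)" "\<forall>(a,b,i,j)\<in>I. y (a,b,i,j) = co u a b $$ (i,j)"
      unfolding S_def by blast
    have tu: "t v + u v \<in> carrier_mat (dimv X v) (dimv Z v)" for v using t(1)[of v] u(1)[of v] by auto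
    have "x (a,b,i,j) + y (a,b,i,j) = co (\<lambda>v. t v + u v) a b $$ (i,j)" if ab: "(a,b,i,j) \<in> I" for a b i j
    proof -
      note d = I_dims[OF ab]
      have "co (\<lambda>v. t v + u v) a b $$ (i,j) = (mapv X a b * (t b + u b)) $$ (i,j) - ((t a + u a) * mapv Z a b) $$ (i,j)"
        by (rule co_entry[OF ab tu])
      also have "\<dots> = co t a b $$ (i,j) + co u a b $$ (i,j)"
        unfolding co_entry[OF ab t(1)] co_entry[OF ab u(1)]
        using d t(1)[of a] t(1)[of b] u(1)[of a] u(1)[of b] valid_dim[OF valid(1), of a b] valid_dim[OF valid(3), of a b]
        by (simp add: mat_ring del: index_mult_mat(1))
      finally show ?thesis using bspec[OF t(2) ab] bspec[OF u(2) ab] by simp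
    qed
    thus "(\<lambda>i. x i + y i) \<in> S" unfolding S_def using tu by (intro CollectI exI[of _ "\<lambda>v. t v + u v"]) auto
  next
    fix c x assume "x \<in> S"
    then obtain t where t: "\<And>v. t v \<in> carrier_mat (dimv X v) (dimv Z v)" "\<forall>(a,b,i,j)\<in>I. x (a,b,i,j) = co t a b $$ (i,j)"
      unfolding S_def by blast
    have tu: "c \<cdot>\<^sub>m t v \<in> carrier_mat (dimv X v) (dimv Z v)" for v using t(1)[of v] by auto
    have "c * x (a,b,i,j) = co (\<lambda>v. c \<cdot>\<^sub>m t v) a b $$ (i,j)" if ab: "(a,b,i,j) \<in> I" for a b i j
    proof -
      note d = I_dims[OF ab]
      have "co (\<lambda>v. c \<cdot>\<^sub>m t v) a b $$ (i,j) = (mapv X a b * (c \<cdot>\<^sub>m t b)) $$ (i,j) - ((c \<cdot>\<^sub>m t a) * mapv Z a b) $$ (i,j)"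
        by (rule co_entry[OF ab tu])
      also have "\<dots> = c * co t a b $$ (i,j)"
        unfolding co_entry[OF ab t(1)]
        using d t(1)[of a] t(1)[of b] valid_dim[OF valid(1), of a b] valid_dim[OF valid(3), of a b]
        by (simp add: right_diff_distrib)
      finally show ?thesis using bspec[OF t(2) ab] by simp
    qed
    thus "(\<lambda>i. c * x i) \<in> S" unfolding S_def using tu by (intro CollectI exI[of _ "\<lambda>v. c \<cdot>\<^sub>m t v"]) auto
  next
    have "(\<lambda>(a,b,i,j). co (\<lambda>v. 0\<^sub>m (dimv X v) (dimv Z v)) a b $$ (i,j)) \<in> S"
      unfolding S_def by (intro CollectI exI[of _ "\<lambda>v. 0\<^sub>m (dimv X v) (dimv Z v)"]) auto
    thus "S \<noteq> {}" by blast
  next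
    fix x assume "x \<in> S"
    then obtain t where t: "\<And>v. t v \<in> carrier_mat (dimv X v) (dimv Z v)" "\<forall>(a,b,i,j)\<in>I. x (a,b,i,j) = co t a b $$ (i,j)"
      unfolding S_def by blast
    show "\<exists>i\<in>I. x i \<noteq> (\<lambda>(a,b,i,j). cocycle a b $$ (i,j)) i"
    proof (rule ccontr)
      assume "\<not> ?thesis"
      hence eq: "co t a b $$ (i,j) = cocycle a b $$ (i,j)" if "(a,b,i,j) \<in> I" for a b i j using that t(2) by fastforce
      show False
      proof (rule cocycle_not_coboundary[of t])
        fix a b assume ab: "adj a b" "sk a"
        show "cocycle a b = mapv X a b * t b - t a * mapv Z a b"
        proof (rule eq_matI)
          fix i j assume "i < dim_row (mapv X a b * t b - t a * mapv Z a b)" "j < dim_col (mapv X a b * t b - t a * mapv Z a b)"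
          hence ij: "i < dimv X a" "j < dimv Z b" using t(1)[of a] valid_dim[OF valid(3) ab] by auto
          hence "(a,b,i,j) \<in> I" using ab F(2,3) by (auto simp: I_def support_def)
          from eq[OF this] show "cocycle a b $$ (i,j) = (mapv X a b * t b - t a * mapv Z a b) $$ (i,j)" by (simp add: co_def)
        qed (use t(1)[of a] valid_dim[OF valid(3) ab] in auto)
      qed (use t(1) in auto)
    qed
  qed
  then obtain l where l: "\<And>x. x \<in> S \<Longrightarrow> (\<Sum>i\<in>I. l i * x i) = 0"
    and lc: "(\<Sum>i\<in>I. l i * (\<lambda>(a,b,i,j). cocycle a b $$ (i,j)) i) \<noteq> 0" by blast
  \<comment> \<open>The indices are transposed so that the trace of a product is the sum of
    coefficient times entry.\<close>
  define \<phi> where "\<phi> b a = mat (dimv Z b) (dimv X a) (\<lambda>(j,i). l (a,b,i,j))" for b a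
  have \<phi>d: "\<phi> b a \<in> carrier_mat (dimv Z b) (dimv X a)" for a b by (simp add: \<phi>_def)
  have pair: "pairing F \<epsilon> \<phi> = (\<Sum>x\<in>I. l x * (\<lambda>(a,b,i,j). \<epsilon> a b $$ (i,j)) x)"
    if \<epsilon>: "\<And>a b. adj a b \<Longrightarrow> sk a \<Longrightarrow> \<epsilon> a b \<in> carrier_mat (dimv X a) (dimv Z b)" for \<epsilon>
  proof -
    have "pairing F \<epsilon> \<phi> = (\<Sum>a\<in>{a\<in>F. sk a}. \<Sum>b\<in>{b\<in>F. adj a b}. \<Sum>i<dimv X a. \<Sum>j<dimv Z b. l (a,b,i,j) * \<epsilon> a b $$ (i,j))"
      unfolding pairing_def
    proof (intro sum.cong refl)
      fix a b assume "a \<in> {a\<in>F. sk a}" "b \<in> {b\<in>F. adj a b}"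
      hence "\<epsilon> a b \<in> carrier_mat (dimv X a) (dimv Z b)" using \<epsilon> by auto
      thus "mat_trace (\<epsilon> a b * \<phi> b a) = (\<Sum>i<dimv X a. \<Sum>j<dimv Z b. l (a,b,i,j) * \<epsilon> a b $$ (i,j))"
        by (simp add: mat_trace_mult \<phi>_def mult.commute)
    qed
    also have "\<dots> = (\<Sum>x\<in>I. l x * (\<lambda>(a,b,i,j). \<epsilon> a b $$ (i,j)) x)"
      unfolding I_def using F(1) by (simp add: sum.Sigma sum.cartesian_product split_def)
    finally show ?thesis .
  qed
  have pair_co: "pairing F (co t) \<phi> = 0" if t: "\<And>v. t v \<in> carrier_mat (dimv X v) (dimv Z v)" for t
  proof -
    have "pairing F (co t) \<phi> = (\<Sum>x\<in>I. l x * (\<lambda>(a,b,i,j). co t a b $$ (i,j)) x)"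
      by (rule pair) (use carrier_matD[OF t] valid_dim[OF valid(1)] valid_dim[OF valid(3)] in \<open>auto simp: co_def\<close>)
    also have "\<dots> = 0" by (rule l) (use t in \<open>auto simp: S_def\<close>)
    finally show ?thesis .
  qed
  have expand: "(\<Sum>b\<in>{b\<in>F. \<not> sk b}. \<Sum>i<dimv X b. \<Sum>l<dimv Z b. t b $$ (i,l) * (\<Sum>a\<in>{a. adj b a}. (\<phi> b a * mapv X a b) $$ (l,i)))
    = (\<Sum>a\<in>{a\<in>F. sk a}. \<Sum>i<dimv X a. \<Sum>k<dimv Z a. t a $$ (i,k) * (\<Sum>b\<in>{b. adj a b}. (mapv Z a b * \<phi> b a) $$ (k,i)))"
    if t: "\<And>v. t v \<in> carrier_mat (dimv X v) (dimv Z v)" for t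
    using pairing_coboundary[OF valid(1,3) _ _ \<phi>d F, of t] pair_co[OF t] carrier_matD[OF t] unfolding co_def by auto
  \<comment> \<open>Elementary matrices as test families: each of them isolates a single balance
    equation.\<close>
  let ?t = "\<lambda>v0 i0 k0 v. mat (dimv X v) (dimv Z v) (\<lambda>(i,k). if v = v0 \<and> i = i0 \<and> k = k0 then 1 else 0)"
  have pick: "(\<Sum>v\<in>{v\<in>F. P v}. \<Sum>i<dimv X v. \<Sum>k<dimv Z v. ?t v0 i0 k0 v $$ (i,k) * c v i k) = (if P v0 then c v0 i0 k0 else 0)"
    if v0: "i0 < dimv X v0" "k0 < dimv Z v0" for P v0 i0 k0 and c :: "'v \<Rightarrow> nat \<Rightarrow> nat \<Rightarrow> 'k"
  proof -
    have "(\<Sum>i<dimv X v. \<Sum>k<dimv Z v. ?t v0 i0 k0 v $$ (i,k) * c v i k) = (if v = v0 then c v0 i0 k0 else 0)" for v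
    proof (cases "v = v0")
      case True
      have "(\<Sum>i<dimv X v. \<Sum>k<dimv Z v. ?t v0 i0 k0 v $$ (i,k) * c v i k)
        = (\<Sum>i<dimv X v. if i = i0 then \<Sum>k<dimv Z v. if k = k0 then c v i k else 0 else 0)"
        using True by (intro sum.cong refl) (auto simp: if_distrib[of "\<lambda>x. x * _"] cong: if_cong)
      also have "\<dots> = (if v = v0 then c v0 i0 k0 else 0)" using True v0 by simp
      finally show ?thesis .
    qed (auto intro!: sum.neutral)
    moreover have "v0 \<in> F" using v0 F(2) by (auto simp: support_def)
    ultimately show ?thesis using F(1) by simp
  qed
  have "balanced X Z \<phi>"
    unfolding balanced_def
  proof (intro conjI allI impI)
    fix a k i assume a: "sk a" "k < dimv Z a" "i < dimv X a"
    show "(\<Sum>b\<in>{b. adj a b}. (mapv Z a b * \<phi> b a) $$ (k,i)) = 0"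
      using expand[of "?t a i k"] a unfolding pick[OF a(3,2)] by simp
  next
    fix b k i assume b: "\<not> sk b" "k < dimv Z b" "i < dimv X b"
    show "(\<Sum>a\<in>{a. adj b a}. (\<phi> b a * mapv X a b) $$ (k,i)) = 0"
      using expand[of "?t b i k"] b unfolding pick[OF b(3,2)] by simp
  qed (simp add: \<phi>d)
  moreover have "pairing F cocycle \<phi> \<noteq> 0" using lc by (subst pair) auto
  moreover have "pairing F' cocycle \<phi> = pairing F cocycle \<phi>" if "finite F'" "support X \<union> support Z \<subseteq> F'" for F'
    by (rule pairing_support[of F' F cocycle "dimv X" "dimv Z"]) (use that F in \<open>auto simp: F_def support_def \<phi>d\<close>)
  ultimately show ?thesis using that[of \<phi>] unfolding F_def by auto
qed

end

section \<open>Exactness of a balanced family that detects the extension class\<close>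

lemma mult_mat_vec_sum_entry:
  "finite B \<Longrightarrow> i < dim_row T \<Longrightarrow> (\<And>b. b \<in> B \<Longrightarrow> dim_vec (x b) = dim_col T) \<Longrightarrow>
   (\<Sum>b\<in>B. (T *\<^sub>v x b) $ i) = (\<Sum>k<dim_col T. T $$ (i,k) * (\<Sum>b\<in>B. x b $ k))"
proof -
  assume a: "finite B" "i < dim_row T" "\<And>b. b \<in> B \<Longrightarrow> dim_vec (x b) = dim_col T"
  have "(\<Sum>b\<in>B. (T *\<^sub>v x b) $ i) = (\<Sum>b\<in>B. \<Sum>k<dim_col T. T $$ (i,k) * x b $ k)"
    using a by (intro sum.cong) (auto simp: scalar_prod_def atLeast0LessThan)
  also have "\<dots> = (\<Sum>k<dim_col T. \<Sum>b\<in>B. T $$ (i,k) * x b $ k)" by (rule sum.swap)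
  finally show ?thesis by (simp add: sum_distrib_left)
qed

context almost_split
begin

text \<open>If x is not reached, some functional l kills the image of X_a0 but not x. Let V be Z
  with one more dimension at \<open>a0\<close>, into which the neighbours map by l. A section of V
  \<rightarrow> Z would express l through the arrows of Z, and l would vanish on x. But the family
  is still balanced into V because l kills its image, so it factors through V \<rightarrow> Z and
  pairs to zero.\<close>

lemma balanced_exact_sink:
  assumes \<phi>: "balanced X Z \<phi>" and nz: "\<And>F. finite F \<Longrightarrow> support X \<union> support Z \<subseteq> F \<Longrightarrow> pairing F cocycle \<phi> \<noteq> 0"
    and a0: "sk a0" and x: "\<And>b. adj a0 b \<Longrightarrow> x b \<in> carrier_vec (dimv Z b)"
    and Zx: "\<And>i. i < dimv Z a0 \<Longrightarrow> (\<Sum>b\<in>{b. adj a0 b}. (mapv Z a0 b *\<^sub>v x b) $ i) = 0"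
  shows "\<exists>u\<in>carrier_vec (dimv X a0). \<forall>b. adj a0 b \<longrightarrow> \<phi> b a0 *\<^sub>v u = x b"
proof (rule ccontr)
  assume no: "\<not> ?thesis"
  have \<phi>d [simp]: "dim_row (\<phi> b a) = dimv Z b" "dim_col (\<phi> b a) = dimv X a" if "adj a b" "sk a" for a b
    using \<phi> that by (auto simp: balanced_def)
  have no': "\<not> (\<exists>u\<in>carrier_vec (dimv X a0). \<forall>b\<in>{b. adj a0 b}. \<phi> b a0 *\<^sub>v u = x b)" using no by blast
  have C: "\<phi> b a0 \<in> carrier_mat (dimv Z b) (dimv X a0)" "x b \<in> carrier_vec (dimv Z b)" if "b \<in> {b. adj a0 b}" for b
    using that x a0 by auto
  obtain l where lC: "\<And>b. l b \<in> carrier_vec (dimv Z b)"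
    and l: "\<And>u. u \<in> carrier_vec (dimv X a0) \<Longrightarrow> (\<Sum>b\<in>{b. adj a0 b}. (\<phi> b a0 *\<^sub>v u) \<bullet> l b) = 0"
    and lx: "(\<Sum>b\<in>{b. adj a0 b}. x b \<bullet> l b) \<noteq> 0"
    by (rule unsolvable_certificate[OF finite_nbrs C no'], assumption, assumption, rule that) blast+
  define dV where "dV a = (if a = a0 then dimv Z a + 1 else dimv Z a)" for a
  define V :: "('v, 'k) rep" where "V = \<lparr>dimv = dV, mapv = (\<lambda>a b. if a = a0
     then mat (dimv Z a + 1) (dimv Z b) (\<lambda>(i,j). if i < dimv Z a then mapv Z a b $$ (i,j) else l b $ j) else mapv Z a b)\<rparr>"
  have dV: "dimv V = dV" by (simp add: V_def)
  have nb: "b \<noteq> a0" if "adj a b" "sk a" for a b using that bip a0 by blast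
  have V: "valid_rep adj sk V"
  proof -
    have "support V \<subseteq> insert a0 (support Z)" by (auto simp: support_def dV dV_def split: if_splits)
    moreover have "finite (support Z)" using valid(3) by (simp add: valid_rep_def)
    ultimately show ?thesis unfolding valid_rep_def
      using nb valid_dim[OF valid(3)] by (auto intro: finite_subset simp: dV) (auto simp: V_def dV_def)
  qed
  let ?p = "\<lambda>a. rect_id (dimv Z a) (dV a)"
  have V_row: "(mapv V a0 b * A) $$ (i,j) = (if i < dimv Z a0 then (mapv Z a0 b * A) $$ (i,j) else col A j \<bullet> l b)"
    if "adj a0 b" "i < dimv Z a0 + 1" "j < dim_col A" "dim_row A = dimv Z b" for A b i j
    using that valid_dim[OF valid(3) that(1) a0] carrier_vecD[OF lC[of b]]
    by (auto simp: V_def scalar_prod_def mult.commute)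
  have p: "morph adj sk V Z ?p"
  proof (rule morphI)
    fix a b assume ab: "adj a b" "sk a"
    note [simp] = valid_dim[OF valid(3) ab] valid_dim[OF V ab]
    have db: "dV b = dimv Z b" using nb[OF ab] by (simp add: dV_def)
    have "?p a * mapv V a b = mapv Z a b"
    proof (rule eq_matI)
      fix i j assume ij: "i < dim_row (mapv Z a b)" "j < dim_col (mapv Z a b)"
      have "(?p a * mapv V a b) $$ (i,j) = (if i < dV a then mapv V a b $$ (i,j) else 0)"
        by (rule rect_id_mult) (use ij in \<open>simp_all add: dV db\<close>)
      thus "(?p a * mapv V a b) $$ (i,j) = mapv Z a b $$ (i,j)" using ij by (auto simp: V_def dV_def)
    qed (simp_all add: dV db)
    thus "mapv Z a b * ?p b = ?p a * mapv V a b" by (simp add: db)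
  qed (simp_all add: dV)
  have ns: "\<not> split_epi adj sk V Z ?p"
  proof
    assume "split_epi adj sk V Z ?p"
    then obtain t where t: "morph adj sk Z V t" "\<And>a. ?p a * t a = 1\<^sub>m (dimv Z a)" unfolding split_epi_def by blast
    note [simp] = morph_dim[OF t(1)]
    have tb: "t b = 1\<^sub>m (dimv Z b)" if "adj a0 b" for b
      using t(2)[of b] nb[OF that a0] by (simp add: dV_def dV)
    have row: "x b \<bullet> l b = (t a0 *\<^sub>v (mapv Z a0 b *\<^sub>v x b)) $ dimv Z a0" if b: "adj a0 b" for b
    proof -
      note [simp] = valid_dim[OF valid(3) b a0] valid_dim[OF V b a0]
      have "t a0 *\<^sub>v (mapv Z a0 b *\<^sub>v x b) = (t a0 * mapv Z a0 b) *\<^sub>v x b"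
        by (rule mult_mat_vec_assoc_dim[symmetric]) (use x[OF b] in simp_all)
      also have "\<dots> = mapv V a0 b *\<^sub>v x b" using morph_eq[OF t(1) b a0] nb[OF b a0] by (simp add: tb[OF b] dV dV_def)
      finally show ?thesis using carrier_vecD[OF x[OF b]] carrier_vecD[OF lC[of b]] by (simp add: V_def scalar_prod_def mult.commute)
    qed
    have "(\<Sum>b\<in>{b. adj a0 b}. x b \<bullet> l b) = (\<Sum>b\<in>{b. adj a0 b}. (t a0 *\<^sub>v (mapv Z a0 b *\<^sub>v x b)) $ dimv Z a0)"
      using row by (intro sum.cong) auto
    also have "\<dots> = (\<Sum>k<dim_col (t a0). t a0 $$ (dimv Z a0,k) * (\<Sum>b\<in>{b. adj a0 b}. (mapv Z a0 b *\<^sub>v x b) $ k))"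
      by (rule mult_mat_vec_sum_entry) (use finite_nbrs valid_dim[OF valid(3) _ a0] in \<open>auto simp: dV dV_def\<close>)
    also have "\<dots> = 0" using Zx by (intro sum.neutral ballI) auto
    finally show False using lx by simp
  qed
  have "balanced X V \<phi>"
    unfolding balanced_def
  proof (intro conjI allI impI)
    fix a b assume "adj a b \<and> sk a"
    thus "\<phi> b a \<in> carrier_mat (dimv V b) (dimv X a)" using nb by (auto simp: dV dV_def)
  next
    fix a k i assume a: "sk a" "k < dimv V a" "i < dimv X a"
    show "(\<Sum>b\<in>{b. adj a b}. (mapv V a b * \<phi> b a) $$ (k,i)) = 0"
    proof (cases "a = a0 \<and> k = dimv Z a0")
      case False
      hence k: "k < dimv Z a" using a by (auto simp: dV dV_def split: if_splits)
      have "(\<Sum>b\<in>{b. adj a b}. (mapv V a b * \<phi> b a) $$ (k,i)) = (\<Sum>b\<in>{b. adj a b}. (mapv Z a b * \<phi> b a) $$ (k,i))"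
      proof (intro sum.cong refl)
        fix b assume "b \<in> {b. adj a b}"
        thus "(mapv V a b * \<phi> b a) $$ (k,i) = (mapv Z a b * \<phi> b a) $$ (k,i)"
          using V_row[of b k i "\<phi> b a"] a k by (cases "a = a0") (auto simp: V_def)
      qed
      thus ?thesis using \<phi> a k by (simp add: balanced_def)
    next
      case True
      have "(\<Sum>b\<in>{b. adj a b}. (mapv V a b * \<phi> b a) $$ (k,i)) = (\<Sum>b\<in>{b. adj a0 b}. (\<phi> b a0 *\<^sub>v unit_vec (dimv X a0) i) \<bullet> l b)"
      proof (intro sum.cong)
        fix b assume "b \<in> {b. adj a0 b}"
        hence b: "adj a0 b" by simp
        have "\<phi> b a0 *\<^sub>v unit_vec (dimv X a0) i = col (\<phi> b a0) i"
          using mult_mat_vec_unit[of i "\<phi> b a0"] a True b by simp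
        thus "(mapv V a b * \<phi> b a) $$ (k,i) = (\<phi> b a0 *\<^sub>v unit_vec (dimv X a0) i) \<bullet> l b"
          using V_row[of b k i "\<phi> b a0"] a True b by simp
      qed (use True in simp)
      also have "\<dots> = 0" by (rule l) simp
      finally show ?thesis .
    qed
  next
    fix b k i assume b: "\<not> sk b" "k < dimv V b" "i < dimv X b"
    hence "b \<noteq> a0" using a0 by blast
    thus "(\<Sum>a\<in>{a. adj b a}. (\<phi> b a * mapv X a b) $$ (k,i)) = 0" using \<phi> b by (simp add: balanced_def dV dV_def)
  qed
  moreover have "\<phi> b a = ?p b * \<phi> b a" if "adj a b" "sk a" for a b using nb[OF that] that by (simp add: dV_def)
  moreover have fin: "finite (support X \<union> support Z \<union> support V)" using valid(1,3) V by (simp add: valid_rep_def)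
  ultimately have "pairing (support X \<union> support Z \<union> support V) cocycle \<phi> = 0"
    by (intro pairing_zero_if_factors_epi[OF V p ns, of \<phi>]) auto
  thus False using nz[OF fin] by blast
qed

text \<open>Let W be X with one more dimension at \<open>b0\<close>, mapped to the neighbours by x.
  The family is balanced on W because it kills x. As its pairing is nonzero, the inclusion X
  \<rightarrow> W has a retraction, and the image of the new basis vector is the required u.\<close>

lemma balanced_exact_source:
  assumes \<phi>: "balanced X Z \<phi>" and nz: "\<And>F. finite F \<Longrightarrow> support X \<union> support Z \<subseteq> F \<Longrightarrow> pairing F cocycle \<phi> \<noteq> 0"
    and b0: "\<not> sk b0" and x: "\<And>a. adj b0 a \<Longrightarrow> x a \<in> carrier_vec (dimv X a)"
    and \<phi>x: "\<And>i. i < dimv Z b0 \<Longrightarrow> (\<Sum>a\<in>{a. adj b0 a}. (\<phi> b0 a *\<^sub>v x a) $ i) = 0"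
  shows "\<exists>u\<in>carrier_vec (dimv X b0). \<forall>a. adj b0 a \<longrightarrow> mapv X a b0 *\<^sub>v u = x a"
proof -
  have \<phi>d [simp]: "dim_row (\<phi> b a) = dimv Z b" "dim_col (\<phi> b a) = dimv X a" if "adj a b" "sk a" for a b
    using \<phi> that by (auto simp: balanced_def)
  define dW where "dW a = (if a = b0 then dimv X a + 1 else dimv X a)" for a
  define W :: "('v, 'k) rep" where "W = \<lparr>dimv = dW, mapv = (\<lambda>a b. if b = b0
     then mat (dimv X a) (dimv X b + 1) (\<lambda>(i,j). if j < dimv X b then mapv X a b $$ (i,j) else x a $ i) else mapv X a b)\<rparr>"
  have dW: "dimv W = dW" by (simp add: W_def)
  have na: "a \<noteq> b0" if "sk a" for a using that b0 by blast
  have W: "valid_rep adj sk W"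
  proof -
    have "support W \<subseteq> insert b0 (support X)" by (auto simp: support_def dW dW_def split: if_splits)
    moreover have "finite (support X)" using valid(1) by (simp add: valid_rep_def)
    ultimately show ?thesis unfolding valid_rep_def
      using na valid_dim[OF valid(1)] by (auto intro: finite_subset simp: dW) (auto simp: W_def dW_def)
  qed
  let ?q = "\<lambda>a. rect_id (dW a) (dimv X a) :: 'k mat"
  have qa: "?q a = 1\<^sub>m (dimv X a)" if "sk a" for a using na[OF that] by (simp add: dW_def)
  have q: "morph adj sk X W ?q"
  proof (rule morphI)
    fix a b assume ab: "adj a b" "sk a"
    note [simp] = valid_dim[OF valid(1) ab] valid_dim[OF W ab]
    have "mapv W a b * ?q b = mapv X a b"
    proof (rule eq_matI)
      fix i j assume ij: "i < dim_row (mapv X a b)" "j < dim_col (mapv X a b)"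
      have "(mapv W a b * ?q b) $$ (i,j) = (if j < dW b then mapv W a b $$ (i,j) else 0)"
        by (rule mult_rect_id) (use ij na[OF ab(2)] in \<open>simp_all add: dW dW_def\<close>)
      thus "(mapv W a b * ?q b) $$ (i,j) = mapv X a b $$ (i,j)" using ij by (auto simp: W_def dW_def)
    qed (use na[OF ab(2)] in \<open>simp_all add: dW dW_def\<close>)
    thus "mapv W a b * ?q b = ?q a * mapv X a b" using qa[OF ab(2)] by simp
  qed (simp_all add: dW)
  have "balanced W Z \<phi>"
    unfolding balanced_def
  proof (intro conjI allI impI)
    fix a b assume "adj a b \<and> sk a"
    thus "\<phi> b a \<in> carrier_mat (dimv Z b) (dimv W a)" using na by (auto simp: dW dW_def)
  next
    fix a k i assume a: "sk a" "k < dimv Z a" "i < dimv W a"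
    thus "(\<Sum>b\<in>{b. adj a b}. (mapv Z a b * \<phi> b a) $$ (k,i)) = 0" using \<phi> na by (simp add: balanced_def dW dW_def)
  next
    fix b l i assume b: "\<not> sk b" "l < dimv Z b" "i < dimv W b"
    have ab: "adj a b" "sk a" if "adj b a" for a using that sym bip b(1) by auto
    show "(\<Sum>a\<in>{a. adj b a}. (\<phi> b a * mapv W a b) $$ (l,i)) = 0"
    proof (cases "i < dimv X b")
      case True
      have "(\<Sum>a\<in>{a. adj b a}. (\<phi> b a * mapv W a b) $$ (l,i)) = (\<Sum>a\<in>{a. adj b a}. (\<phi> b a * mapv X a b) $$ (l,i))"
      proof (intro sum.cong refl)
        fix a assume "a \<in> {a. adj b a}"
        hence a: "adj a b" "sk a" using ab by auto
        show "(\<phi> b a * mapv W a b) $$ (l,i) = (\<phi> b a * mapv X a b) $$ (l,i)"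
          using a b True valid_dim[OF valid(1) a] valid_dim[OF W a] by (auto simp: W_def dW dW_def scalar_prod_def)
      qed
      thus ?thesis using \<phi> b True by (simp add: balanced_def)
    next
      case False
      hence bi: "b = b0" "i = dimv X b0" using b(3) by (auto simp: dW dW_def split: if_splits)
      have "(\<Sum>a\<in>{a. adj b a}. (\<phi> b a * mapv W a b) $$ (l,i)) = (\<Sum>a\<in>{a. adj b0 a}. (\<phi> b0 a *\<^sub>v x a) $ l)"
      proof (intro sum.cong)
        fix a assume "a \<in> {a. adj b0 a}"
        hence a: "adj a b0" "sk a" "adj b0 a" using ab bi by auto
        show "(\<phi> b a * mapv W a b) $$ (l,i) = (\<phi> b0 a *\<^sub>v x a) $ l"
          using a b bi x[OF a(3)] by (auto simp: W_def scalar_prod_def)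
      qed (use bi in simp)
      thus ?thesis using \<phi>x b bi by simp
    qed
  qed
  moreover have "\<phi> b a = \<phi> b a * ?q a" if "adj a b" "sk a" for a b using that by (simp add: qa)
  moreover have fin: "finite (support X \<union> support Z \<union> support W)" using valid(1,3) W by (simp add: valid_rep_def)
  ultimately have "pairing (support X \<union> support Z \<union> support W) cocycle \<phi> = 0" if "\<not> split_mono adj sk X W ?q"
    by (intro pairing_zero_if_factors_mono[OF W q that, of \<phi>]) auto
  hence "split_mono adj sk X W ?q" using nz[OF fin] by blast
  then obtain m where m: "morph adj sk W X m" "\<And>a. m a * ?q a = 1\<^sub>m (dimv X a)" unfolding split_mono_def by blast
  note [simp] = morph_dim[OF m(1)]
  \<comment> \<open>The column with index \<open>dimv X b0\<close> is the image of the new basis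
    vector. At sinks the retraction is the identity, so naturality yields x.\<close>
  let ?u = "col (m b0) (dimv X b0)"
  have "mapv X a b0 *\<^sub>v ?u = x a" if a: "adj b0 a" for a
  proof -
    have ab: "adj a b0" "sk a" using a sym bip b0 by auto
    note [simp] = valid_dim[OF valid(1) ab] valid_dim[OF W ab]
    have ma: "m a = 1\<^sub>m (dimv X a)" using m(2)[of a] qa[OF ab(2)] na[OF ab(2)] by (simp add: dW dW_def)
    have "mapv X a b0 *\<^sub>v ?u = col (mapv X a b0 * m b0) (dimv X b0)"
      by (rule col_mult_dim[symmetric]) (simp_all add: dW dW_def)
    also have "\<dots> = col (mapv W a b0) (dimv X b0)" unfolding morph_eq[OF m(1) ab] ma using na[OF ab(2)] by (simp add: dW dW_def)
    also have "\<dots> = x a" using x[OF a] by (intro eq_vecI) (auto simp: W_def)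
    finally show ?thesis .
  qed
  thus ?thesis by (intro bexI[of _ ?u]) (auto intro!: carrier_vecI)
qed

end

section \<open>Reflection functors along a chain\<close>

definition orient :: "('v \<Rightarrow> bool) \<Rightarrow> nat \<Rightarrow> 'v \<Rightarrow> bool" where
  "orient sk s = (if even s then sk else (\<lambda>v. \<not> sk v))"

lemma orient_0 [simp]: "orient sk 0 = sk" by (simp add: orient_def)

lemma orient_Suc: "orient (\<lambda>v. \<not> sk v) s = orient sk (Suc s)" "(\<lambda>v. \<not> orient sk s v) = orient sk (Suc s)"
  by (auto simp: orient_def)

lemma orient_Suc_Suc [simp]: "orient sk (Suc (Suc s)) = orient sk s" by (simp add: orient_def)

lemma bipartite_orient: "bipartite adj sk \<Longrightarrow> bipartite adj (orient sk s)"
  by (auto simp: orient_def bipartite.dual_bipartite)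

text \<open>Reflections are relations that determine the result up to isomorphism. Fixing one chain
  of representatives allows different terms to be compared; term s lives on
  \<open>orient sk s\<close>.\<close>

lemma sigma_pow_chain:
  "sigma_pow adj sk t M N \<Longrightarrow>
    \<exists>Ns. Ns 0 = M \<and> Ns t = N \<and> (\<forall>s<t. sigma_rel adj (orient sk s) (Ns s) (Ns (Suc s)))"
proof (induction t arbitrary: sk M)
  case 0
  thus ?case by auto
next
  case (Suc t)
  then obtain P where P: "sigma_rel adj sk M P" "sigma_pow adj (\<lambda>v. \<not> sk v) t P N" by auto
  from Suc.IH[OF P(2)] obtain Ns where
    Ns: "Ns 0 = P" "Ns t = N" "\<And>s. s < t \<Longrightarrow> sigma_rel adj (orient sk (Suc s)) (Ns s) (Ns (Suc s))"
    unfolding orient_Suc by blast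
  show ?case
    by (rule exI[of _ "\<lambda>s. case s of 0 \<Rightarrow> M | Suc s \<Rightarrow> Ns s"])
      (use P(1) Ns in \<open>auto split: nat.split simp: less_Suc_eq_0_disj\<close>)
qed

text \<open>The part of \<open>sigma_rel\<close> that a morphism into N calls for: kernel vectors
  lift. A balanced family provides it from Z to P and from P to X.\<close>

definition kernel_exact :: "('v \<Rightarrow> 'v \<Rightarrow> bool) \<Rightarrow> ('v \<Rightarrow> bool) \<Rightarrow> ('v, 'k::field) rep \<Rightarrow> ('v, 'k) rep \<Rightarrow> bool" where
  "kernel_exact adj sk M N \<longleftrightarrow> (\<forall>b. \<not> sk b \<longrightarrow> dimv N b = dimv M b) \<and>
    (\<forall>a x. sk a \<longrightarrow> (\<forall>b. adj a b \<longrightarrow> x b \<in> carrier_vec (dimv M b)) \<longrightarrow>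
      (\<forall>i<dimv M a. (\<Sum>b\<in>{b. adj a b}. (mapv M a b *\<^sub>v x b) $ i) = 0) \<longrightarrow>
      (\<exists>u\<in>carrier_vec (dimv N a). \<forall>b. adj a b \<longrightarrow> mapv N b a *\<^sub>v u = x b))"

lemma kernel_exact_sigma: "sigma_rel adj sk M N \<Longrightarrow> kernel_exact adj sk M N"
  unfolding sigma_rel_def kernel_exact_def by simp

lemma sigma_relD:
  assumes "sigma_rel adj sk M N"
  shows "valid_rep adj sk M" "valid_rep adj (\<lambda>v. \<not> sk v) N" "\<not> sk b \<Longrightarrow> dimv N b = dimv M b"
    "sk a \<Longrightarrow> u \<in> carrier_vec (dimv N a) \<Longrightarrow> (\<And>b. adj a b \<Longrightarrow> mapv N b a *\<^sub>v u = 0\<^sub>v (dimv M b)) \<Longrightarrow> u = 0\<^sub>v (dimv N a)"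
    "sk a \<Longrightarrow> u \<in> carrier_vec (dimv N a) \<Longrightarrow> i < dimv M a \<Longrightarrow> (\<Sum>b\<in>{b. adj a b}. (mapv M a b *\<^sub>v (mapv N b a *\<^sub>v u)) $ i) = 0"
  using assms unfolding sigma_rel_def by blast+

lemma mult_mat_vec_zero [simp]: "dim_col A = n \<Longrightarrow> A *\<^sub>v 0\<^sub>v n = (0\<^sub>v (dim_row A) :: 'k::semiring_0 vec)"
  by (intro eq_vecI) (auto simp: scalar_prod_def)

lemma inj_familyD:
  "inj_family f \<Longrightarrow> dim_vec x = dim_col (f a) \<Longrightarrow> f a *\<^sub>v x = 0\<^sub>v (dim_row (f a)) \<Longrightarrow> x = 0\<^sub>v (dim_col (f a))"
  unfolding inj_family_def by blast

lemma inj_family_dim: "inj_family f \<Longrightarrow> dim_col (f a) \<le> dim_row (f a)"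
  by (rule dim_le_if_injective[of "f a"]) (auto intro: inj_familyD[of f])

lemma inj_family_comp:
  assumes f: "inj_family f" and g: "inj_family g" and d: "\<And>a. dim_col (g a) = dim_row (f a)"
  shows "inj_family (\<lambda>a. g a * f a)"
  unfolding inj_family_def
proof (intro allI impI)
  fix a x assume x: "dim_vec x = dim_col (g a * f a)" "g a * f a *\<^sub>v x = 0\<^sub>v (dim_row (g a * f a))"
  have "g a *\<^sub>v (f a *\<^sub>v x) = g a * f a *\<^sub>v x" by (rule mult_mat_vec_assoc_dim[symmetric]) (use d x in simp_all)
  hence "g a *\<^sub>v (f a *\<^sub>v x) = 0\<^sub>v (dim_row (g a))" using x(2) by simp
  from inj_familyD[OF g _ this] have "f a *\<^sub>v x = 0\<^sub>v (dim_row (f a))" by (simp add: d)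
  from inj_familyD[OF f _ this] show "x = 0\<^sub>v (dim_col (g a * f a))" using x(1) by simp
qed

lemma inj_family_transpose:
  assumes f: "right_invertible f"
  shows "inj_family (\<lambda>a. (f a)\<^sup>T)"
  unfolding inj_family_def
proof (intro allI impI)
  fix a x assume x: "dim_vec x = dim_col (f a)\<^sup>T" "(f a)\<^sup>T *\<^sub>v x = 0\<^sub>v (dim_row (f a)\<^sup>T)"
  from f obtain t where t: "t \<in> carrier_mat (dim_col (f a)) (dim_row (f a))" "f a * t = 1\<^sub>m (dim_row (f a))"
    unfolding right_invertible_def by blast
  have "t\<^sup>T * (f a)\<^sup>T = 1\<^sub>m (dim_row (f a))" using transpose_mult_dim[of "f a" t] t by simp
  moreover have "x \<in> carrier_vec (dim_row (f a))" by (rule carrier_vecI) (use x(1) in simp)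
  ultimately have "x = (t\<^sup>T * (f a)\<^sup>T) *\<^sub>v x" by simp
  also have "\<dots> = t\<^sup>T *\<^sub>v ((f a)\<^sup>T *\<^sub>v x)" by (rule mult_mat_vec_assoc_dim) (use t x in simp_all)
  also have "\<dots> = 0\<^sub>v (dim_col (f a)\<^sup>T)" unfolding x(2) using t(1) by simp
  finally show "x = 0\<^sub>v (dim_col (f a)\<^sup>T)" .
qed

context bipartite
begin

lemma valid_dim_opposite:
  assumes "valid_rep adj (\<lambda>v. \<not> sk v) N" "adj a b" "sk a"
  shows "dim_row (mapv N b a) = dimv N b" "dim_col (mapv N b a) = dimv N a"
proof -
  have "adj b a" "\<not> sk b" using assms sym bip by auto
  from valid_dim[OF assms(1) this] show "dim_row (mapv N b a) = dimv N b" "dim_col (mapv N b a) = dimv N a" by auto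
qed

text \<open>Left exactness of a reflection. F equals f at sources. At a sink, f sends kernel tuples
  of M to kernel tuples of M', which lift to N'; the lifts of the unit vectors are the columns of F.
  If F kills x there, injectivity of f shows that all components of x vanish, and N embeds into the
  sum of its neighbours.\<close>

lemma sigma_mono:
  assumes MN: "sigma_rel adj sk M N" and M': "valid_rep adj sk M'" and N': "valid_rep adj (\<lambda>v. \<not> sk v) N'"
    and ex: "kernel_exact adj sk M' N'" and f: "morph adj sk M M' f" "inj_family f"
  shows "\<exists>F. morph adj (\<lambda>v. \<not> sk v) N N' F \<and> inj_family F"
proof -
  note M = sigma_relD(1)[OF MN] note N = sigma_relD(2)[OF MN]
  note [simp] = morph_dim[OF f(1)]
  have src: "dimv N' b = dimv M' b" "dimv N b = dimv M b" if "\<not> sk b" for b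
    using ex sigma_relD(3)[OF MN that] that by (auto simp: kernel_exact_def)
  have lift: "\<exists>u\<in>carrier_vec (dimv N' a). \<forall>b. adj a b \<longrightarrow> mapv N' b a *\<^sub>v u = f b *\<^sub>v (mapv N b a *\<^sub>v w)"
    if a: "sk a" and w: "w \<in> carrier_vec (dimv N a)" for a w
  proof -
    have "f b *\<^sub>v (mapv N b a *\<^sub>v w) \<in> carrier_vec (dimv M' b)" for b by (rule carrier_vecI) simp
    moreover have "(\<Sum>b\<in>{b. adj a b}. (mapv M' a b *\<^sub>v (f b *\<^sub>v (mapv N b a *\<^sub>v w))) $ i) = 0" if i: "i < dimv M' a" for i
    proof -
      have "(\<Sum>b\<in>{b. adj a b}. (mapv M' a b *\<^sub>v (f b *\<^sub>v (mapv N b a *\<^sub>v w))) $ i)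
        = (\<Sum>b\<in>{b. adj a b}. (f a *\<^sub>v (mapv M a b *\<^sub>v (mapv N b a *\<^sub>v w))) $ i)"
      proof (intro sum.cong refl)
        fix b assume "b \<in> {b. adj a b}"
        hence ab: "adj a b" and nb: "\<not> sk b" using bip a by auto
        note [simp] = valid_dim[OF M ab a] valid_dim[OF M' ab a] valid_dim_opposite[OF N ab a] src[OF nb]
        have "mapv M' a b *\<^sub>v (f b *\<^sub>v (mapv N b a *\<^sub>v w)) = (mapv M' a b * f b) *\<^sub>v (mapv N b a *\<^sub>v w)"
          by (rule mult_mat_vec_assoc_dim[symmetric]) simp_all
        also have "\<dots> = f a *\<^sub>v (mapv M a b *\<^sub>v (mapv N b a *\<^sub>v w))"
          unfolding morph_eq[OF f(1) ab a] by (rule mult_mat_vec_assoc_dim) simp_all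
        finally show "(mapv M' a b *\<^sub>v (f b *\<^sub>v (mapv N b a *\<^sub>v w))) $ i = (f a *\<^sub>v (mapv M a b *\<^sub>v (mapv N b a *\<^sub>v w))) $ i" by simp
      qed
      also have "\<dots> = (\<Sum>k<dim_col (f a). f a $$ (i,k) * (\<Sum>b\<in>{b. adj a b}. (mapv M a b *\<^sub>v (mapv N b a *\<^sub>v w)) $ k))"
        by (rule mult_mat_vec_sum_entry) (use i finite_nbrs valid_dim[OF M _ a] in auto)
      also have "\<dots> = 0" using sigma_relD(5)[OF MN a w] by (intro sum.neutral ballI) auto
      finally show ?thesis .
    qed
    ultimately show ?thesis using ex a unfolding kernel_exact_def by auto
  qed
  have "\<exists>B. B \<in> carrier_mat (dimv N' a) (dimv N a) \<and> (\<forall>b. adj a b \<longrightarrow> mapv N' b a * B = f b * mapv N b a)" if a: "sk a" for a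
  proof -
    obtain B where B: "B \<in> carrier_mat (dimv N' a) (dimv N a)"
      "\<And>j. j < dimv N a \<Longrightarrow> \<forall>b. adj a b \<longrightarrow> mapv N' b a *\<^sub>v col B j = f b *\<^sub>v (mapv N b a *\<^sub>v unit_vec (dimv N a) j)"
      using choose_matrix_columns[of "dimv N a" "dimv N' a" "\<lambda>j u. \<forall>b. adj a b \<longrightarrow> mapv N' b a *\<^sub>v u = f b *\<^sub>v (mapv N b a *\<^sub>v unit_vec (dimv N a) j)"]
        lift[OF a] by (metis unit_vec_carrier)
    have "mapv N' b a * B = f b * mapv N b a" if ab: "adj a b" for b
    proof (rule mat_eq_colI)
      have nb: "\<not> sk b" using bip ab a by auto
      note [simp] = valid_dim_opposite[OF N ab a] valid_dim_opposite[OF N' ab a] src[OF nb]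
      show "dim_row (mapv N' b a * B) = dim_row (f b * mapv N b a)" "dim_col (mapv N' b a * B) = dim_col (f b * mapv N b a)"
        using B(1) by simp_all
      fix j assume "j < dim_col (f b * mapv N b a)"
      hence j: "j < dimv N a" by simp
      have "col (mapv N' b a * B) j = f b *\<^sub>v (mapv N b a *\<^sub>v unit_vec (dimv N a) j)"
        using B j ab by (subst col_mult_dim) auto
      also have "\<dots> = col (f b * mapv N b a) j"
        using mult_mat_vec_unit[of j "mapv N b a"] j by (subst col_mult_dim) auto
      finally show "col (mapv N' b a * B) j = col (f b * mapv N b a) j" .
    qed
    thus ?thesis using B(1) by blast
  qed
  then obtain B where B: "\<And>a. sk a \<Longrightarrow> B a \<in> carrier_mat (dimv N' a) (dimv N a)"
    "\<And>a b. sk a \<Longrightarrow> adj a b \<Longrightarrow> mapv N' b a * B a = f b * mapv N b a" by metis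
  define F where "F a = (if sk a then B a else f a)" for a
  have F: "dim_row (F a) = dimv N' a" "dim_col (F a) = dimv N a" for a
    using B(1)[of a] src[of a] by (auto simp: F_def)
  have "morph adj (\<lambda>v. \<not> sk v) N N' F"
  proof (rule morphI)
    fix b a assume ba: "adj b a" "\<not> sk b"
    hence "sk a" "adj a b" using bip sym by auto
    thus "mapv N' b a * F a = F b * mapv N b a" using B(2) ba(2) by (simp add: F_def)
  qed (simp_all add: F)
  moreover have "inj_family F"
    unfolding inj_family_def
  proof (intro allI impI)
    fix a x assume x: "dim_vec x = dim_col (F a)" "F a *\<^sub>v x = 0\<^sub>v (dim_row (F a))"
    show "x = 0\<^sub>v (dim_col (F a))"
    proof (cases "sk a")
      case False
      thus ?thesis using x inj_familyD[OF f(2)] by (simp add: F_def)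
    next
      case True
      have xc: "x \<in> carrier_vec (dimv N a)" by (rule carrier_vecI) (use x(1) F in simp)
      have "mapv N b a *\<^sub>v x = 0\<^sub>v (dimv M b)" if ab: "adj a b" for b
      proof -
        have nb: "\<not> sk b" using bip ab True by auto
        note [simp] = valid_dim_opposite[OF N ab True] valid_dim_opposite[OF N' ab True] src[OF nb] F
        have "f b *\<^sub>v (mapv N b a *\<^sub>v x) = (f b * mapv N b a) *\<^sub>v x"
          by (rule mult_mat_vec_assoc_dim[symmetric]) (use xc in simp_all)
        also have "\<dots> = (mapv N' b a * F a) *\<^sub>v x" using B(2)[OF True ab] True by (simp add: F_def)
        also have "\<dots> = mapv N' b a *\<^sub>v (F a *\<^sub>v x)" by (rule mult_mat_vec_assoc_dim) (use xc in simp_all)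
        also have "\<dots> = 0\<^sub>v (dimv M' b)" unfolding x(2) by simp
        finally have "f b *\<^sub>v (mapv N b a *\<^sub>v x) = 0\<^sub>v (dim_row (f b))" by simp
        from inj_familyD[OF f(2) _ this] show ?thesis by simp
      qed
      from sigma_relD(4)[OF MN True xc this] show ?thesis by (simp add: F)
    qed
  qed
  ultimately show ?thesis by blast
qed

lemma sigma_support:
  assumes MN: "sigma_rel adj sk M N" and a: "sk a" "dimv N a \<noteq> 0"
  shows "\<exists>b. adj a b \<and> dimv M b \<noteq> 0"
proof (rule ccontr)
  assume "\<not> ?thesis"
  hence M0: "\<And>b. adj a b \<Longrightarrow> dimv M b = 0" by blast
  have "mapv N b a *\<^sub>v unit_vec (dimv N a) 0 = 0\<^sub>v (dimv M b)" if ab: "adj a b" for b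
    using bip[OF ab] a M0[OF ab] sigma_relD(3)[OF MN, of b] valid_dim_opposite[OF sigma_relD(2)[OF MN] ab a(1)] by (intro eq_vecI) auto
  from sigma_relD(4)[OF MN a(1) unit_vec_carrier this] show False using a(2) by simp
qed

text \<open>With M_c = 0 the kernel at c is the whole sum over the neighbours, which contains
  M_b.\<close>

lemma sigma_spreads:
  assumes MN: "sigma_rel adj sk M N" and cb: "adj c b" and c: "sk c" and b: "dimv M b \<noteq> 0" "dimv M c = 0"
  shows "dimv N c \<noteq> 0"
proof
  assume Nc: "dimv N c = 0"
  let ?x = "\<lambda>d. if d = b then unit_vec (dimv M d) 0 else 0\<^sub>v (dimv M d)"
  have "\<exists>u\<in>carrier_vec (dimv N c). \<forall>d. adj c d \<longrightarrow> mapv N d c *\<^sub>v u = ?x d"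
    using kernel_exact_sigma[OF MN] c b(2) unfolding kernel_exact_def by auto
  then obtain u where u: "u \<in> carrier_vec (dimv N c)" "mapv N b c *\<^sub>v u = unit_vec (dimv M b) 0" using cb by fastforce
  have nb: "\<not> sk b" using bip[OF cb] c by simp
  note [simp] = valid_dim_opposite[OF sigma_relD(2)[OF MN] cb c] sigma_relD(3)[OF MN nb]
  have "(mapv N b c *\<^sub>v u) $ 0 = 0" using b(1) u(1) Nc by (simp add: scalar_prod_def)
  thus False unfolding u(2) using b(1) by simp
qed

end

text \<open>A vertex b of F with a neighbour outside F cannot be in the support while it is a source, as the
  support of the next term would leave F; so b is outside the support from the second term on.\<close>
lemma sigma_chain_dies:
  assumes boundary: "\<And>F. finite F \<Longrightarrow> F \<noteq> {} \<Longrightarrow> \<exists>b\<in>F. \<exists>c. adj c b \<and> c \<notin> F"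
    and "finite F" "bipartite adj sk" "\<And>s. s \<le> 2 * card F \<Longrightarrow> support (Ns s) \<subseteq> F"
    "\<And>s. s < 2 * card F \<Longrightarrow> sigma_rel adj (orient sk s) (Ns s) (Ns (Suc s))"
  shows "\<exists>s\<le>2 * card F. support (Ns s) = {}"
  using assms(2-)
proof (induction "card F" arbitrary: F sk Ns)
  case 0
  thus ?case by (auto simp: card_eq_0_iff)
next
  case (Suc k)
  have "F \<noteq> {}" using Suc.hyps(2) by auto
  from boundary[OF Suc.prems(1) this] obtain b c where bc: "b \<in> F" "adj c b" "c \<notin> F" by blast
  have card: "card (F - {b}) = k" using Suc.hyps(2) bc(1) Suc.prems(1) by simp
  have source: "dimv (Ns s) b = 0" if s: "s < 2 * card F" and b: "\<not> orient sk s b" for s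
  proof (rule ccontr)
    assume ne: "dimv (Ns s) b \<noteq> 0"
    interpret O: bipartite adj "orient sk s" by (rule bipartite_orient) (rule Suc.prems(2))
    have "orient sk s c" using O.bip[OF bc(2)] b by simp
    moreover have "dimv (Ns s) c = 0" using Suc.prems(3)[of s] s bc(3) by (auto simp: support_def)
    ultimately have "dimv (Ns (Suc s)) c \<noteq> 0" using O.sigma_spreads[OF Suc.prems(4)[OF s] bc(2) _ ne] by blast
    thus False using Suc.prems(3)[of "Suc s"] s bc(3) by (auto simp: support_def)
  qed
  have b0: "dimv (Ns (Suc s)) b = 0" if s: "Suc s < 2 * card F" for s
  proof (cases "orient sk s b")
    case True
    hence "\<not> orient sk (Suc s) b" by (simp add: orient_def split: if_splits)
    thus ?thesis using source s by blast
  next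
    case False
    from sigma_relD(3)[OF Suc.prems(4) this] source[OF _ False] s show ?thesis by simp
  qed
  \<comment> \<open>The induction uses terms 1 to 2 card F - 1. Term 0 is dropped because b may
    still be a sink in its support, and the last term because it has no successor into which b could
    spread. This loss of two terms per vertex explains the bound.\<close>
  have "\<exists>s\<le>2 * card (F - {b}). support (Ns (Suc s)) = {}"
  proof (rule Suc.hyps(1)[where sk = "\<lambda>v. \<not> sk v"])
    show "bipartite adj (\<lambda>v. \<not> sk v)" using Suc.prems(2) by (rule bipartite.dual_bipartite)
    show "support (Ns (Suc s)) \<subseteq> F - {b}" if "s \<le> 2 * card (F - {b})" for s
      using Suc.prems(3)[of "Suc s"] b0[of s] that card Suc.hyps(2) by (auto simp: support_def)
    show "sigma_rel adj (orient (\<lambda>v. \<not> sk v) s) (Ns (Suc s)) (Ns (Suc (Suc s)))" if "s < 2 * card (F - {b})" for s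
      unfolding orient_Suc by (rule Suc.prems(4)) (use that card Suc.hyps(2) in linarith)
  qed (use Suc.prems(1) card in auto)
  then obtain s where s: "s \<le> 2 * card (F - {b})" "support (Ns (Suc s)) = {}" by blast
  show ?case by (rule exI[of _ "Suc s"]) (use s card Suc.hyps(2) in auto)
qed

section \<open>The two irreducible maps at Y are not both injective\<close>

context almost_split
begin

text \<open>Two reflections carry v : Y \<rightarrow> Z first to an embedding of sigma Y into P,
  then to one of sigma^2 Y into X, and u continues it to Y.\<close>

lemma sigma2_mono:
  assumes u: "inj_family (\<lambda>a. p a * f a)" and v: "inj_family (\<lambda>a. g a * i a)"
    and N1: "sigma_rel adj sk Y N1" and N2: "sigma_rel adj (\<lambda>v. \<not> sk v) N1 N2"
  shows "\<exists>F. morph adj sk N2 Y F \<and> inj_family F"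
proof -
  interpret D: bipartite adj "\<lambda>v. \<not> sk v" by (rule dual_bipartite)
  obtain \<phi> where \<phi>: "balanced X Z \<phi>" "\<And>F. finite F \<Longrightarrow> support X \<union> support Z \<subseteq> F \<Longrightarrow> pairing F cocycle \<phi> \<noteq> 0"
    using nondegenerate_balanced by metis
  \<comment> \<open>P takes the place of sigma Z on the opposite orientation: Z at the old sources,
    X at the old sinks, and the balanced family as arrows.\<close>
  define P :: "('v, 'k) rep" where "P = \<lparr>dimv = (\<lambda>a. if sk a then dimv X a else dimv Z a), mapv = \<phi>\<rparr>"
  have P: "valid_rep adj (\<lambda>v. \<not> sk v) P"
  proof -
    have "support P \<subseteq> support X \<union> support Z" by (auto simp: support_def P_def split: if_splits)
    moreover have "finite (support X \<union> support Z)" using valid(1,3) by (simp add: valid_rep_def)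
    ultimately have "finite (support P)" by (rule finite_subset)
    thus ?thesis using \<phi>(1) sym bip unfolding valid_rep_def balanced_def P_def by auto
  qed
  have "kernel_exact adj sk Z P"
    unfolding kernel_exact_def
  proof (intro conjI allI impI)
    fix a x assume a: "sk a" "\<forall>b. adj a b \<longrightarrow> x b \<in> carrier_vec (dimv Z b)"
      "\<forall>i<dimv Z a. (\<Sum>b\<in>{b. adj a b}. (mapv Z a b *\<^sub>v x b) $ i) = 0"
    show "\<exists>u\<in>carrier_vec (dimv P a). \<forall>b. adj a b \<longrightarrow> mapv P b a *\<^sub>v u = x b"
      using balanced_exact_sink[OF \<phi> a(1), of x] a by (simp add: P_def)
  qed (simp add: P_def)
  from sigma_mono[OF N1 valid(3) P this gi_morph v]
  obtain F1 where F1: "morph adj (\<lambda>v. \<not> sk v) N1 P F1" "inj_family F1" by blast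
  have ex: "kernel_exact adj (\<lambda>v. \<not> sk v) P X"
    unfolding kernel_exact_def
  proof (intro conjI allI impI)
    fix b x assume b: "\<not> sk b" and x: "\<forall>a. adj b a \<longrightarrow> x a \<in> carrier_vec (dimv P a)"
      and s: "\<forall>i<dimv P b. (\<Sum>a\<in>{a. adj b a}. (mapv P b a *\<^sub>v x a) $ i) = 0"
    have "x a \<in> carrier_vec (dimv X a)" if "adj b a" for a using x that bip[OF that] b by (auto simp: P_def)
    thus "\<exists>u\<in>carrier_vec (dimv X b). \<forall>a. adj b a \<longrightarrow> mapv X a b *\<^sub>v u = x a"
      using balanced_exact_source[OF \<phi> b, of x] s b by (simp add: P_def)
  qed (simp add: P_def)
  have "\<exists>F. morph adj (\<lambda>v. \<not> \<not> sk v) N2 X F \<and> inj_family F"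
    by (rule D.sigma_mono[OF N2 P _ ex F1]) simp
  then obtain F2 where F2: "morph adj sk N2 X F2" "inj_family F2" by auto
  have "valid_rep adj sk N2" using sigma_relD(2)[OF N2] by simp
  from morph_comp[OF this valid(1,4) F2(1) pf_morph] inj_family_comp[OF F2(2) u]
  show ?thesis using morph_dim[OF F2(1)] by auto
qed

text \<open>Reflecting the embedding of sigma^2 Y into Y again and again embeds each term of the
  chain into the term two places earlier. Even terms stay in the support of Y, odd ones in that of
  sigma Y, which lies within one step of it; this is F.\<close>

lemma not_both_inj:
  assumes boundary: "\<And>F. finite F \<Longrightarrow> F \<noteq> {} \<Longrightarrow> \<exists>b\<in>F. \<exists>c. adj c b \<and> c \<notin> F"
    and u: "inj_family (\<lambda>a. p a * f a)" and v: "inj_family (\<lambda>a. g a * i a)"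
    and reg: "\<And>t. \<exists>N. sigma_pow adj sk t Y N \<and> nonzero_rep N"
  shows False
proof -
  define F where "F = support Y \<union> (\<Union>b\<in>support Y. {a. adj b a})"
  have F: "finite F" unfolding F_def using valid(4) finite_nbrs by (auto simp: valid_rep_def)
  \<comment> \<open>Large enough that the terms up to index 2 card F, among which one must vanish,
    are known to lie in F, while regularity provides a nonzero term at t.\<close>
  define t where "t = 2 * card F + 2"
  from reg[of t] obtain N where N: "sigma_pow adj sk t Y N" "nonzero_rep N" by blast
  from sigma_pow_chain[OF N(1)] obtain Ns where
    Ns: "Ns 0 = Y" "Ns t = N" "\<And>s. s < t \<Longrightarrow> sigma_rel adj (orient sk s) (Ns s) (Ns (Suc s))" by blast
  have mono: "\<exists>h. morph adj (orient sk s) (Ns (Suc (Suc s))) (Ns s) h \<and> inj_family h" if "Suc s < t" for s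
    using that
  proof (induction s)
    case 0
    have "sigma_rel adj (\<lambda>v. \<not> sk v) (Ns (Suc 0)) (Ns (Suc (Suc 0)))"
      using Ns(3)[OF 0] by (simp add: orient_def)
    from sigma2_mono[OF u v _ this] Ns(3)[of 0] 0 show ?case by (simp add: Ns(1))
  next
    case (Suc s)
    then obtain h where h: "morph adj (orient sk s) (Ns (Suc (Suc s))) (Ns s) h" "inj_family h" by auto
    interpret O: bipartite adj "orient sk s" by (rule bipartite_orient) unfold_locales
    have s: "sigma_rel adj (orient sk s) (Ns s) (Ns (Suc s))" using Suc.prems Ns(3) by simp
    have s2: "sigma_rel adj (orient sk s) (Ns (Suc (Suc s))) (Ns (Suc (Suc (Suc s))))"
      using Ns(3)[OF Suc.prems] by simp
    from O.sigma_mono[OF s2 sigma_relD(1)[OF s] sigma_relD(2)[OF s] kernel_exact_sigma[OF s] h]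
    show ?case by (simp add: orient_Suc)
  qed
  have sub: "support (Ns (Suc (Suc s))) \<subseteq> support (Ns s)" if s: "Suc s < t" for s
  proof -
    from mono[OF s] obtain h where h: "morph adj (orient sk s) (Ns (Suc (Suc s))) (Ns s) h" "inj_family h" by blast
    show ?thesis
    proof
      fix a assume "a \<in> support (Ns (Suc (Suc s)))"
      thus "a \<in> support (Ns s)"
        using inj_family_dim[OF h(2), of a] morph_dim[OF h(1), of a] by (simp add: support_def)
    qed
  qed
  have spread: "\<exists>b. (b = a \<or> adj a b) \<and> b \<in> support (Ns s)" if "s < t" "a \<in> support (Ns (Suc s))" for s a
  proof -
    interpret O: bipartite adj "orient sk s" by (rule bipartite_orient) unfold_locales
    show ?thesis
      using O.sigma_support[OF Ns(3)[OF that(1)], of a] sigma_relD(3)[OF Ns(3)[OF that(1)], of a] that(2)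
      by (cases "orient sk s a") (auto simp: support_def)
  qed
  have inF: "support (Ns s) \<subseteq> F" if "s < t" for s
    using that
  proof (induction s rule: less_induct)
    case (less s)
    consider "s = 0" | "s = 1" | s' where "s = Suc (Suc s')" by (cases s; cases "s - 1") auto
    thus ?case
    proof cases
      case 1
      thus ?thesis by (simp add: Ns(1) F_def)
    next
      case 2
      show ?thesis
      proof
        fix a assume "a \<in> support (Ns s)"
        with spread[of 0 a] 2 less.prems obtain b where "b = a \<or> adj a b" "b \<in> support Y" by (auto simp: Ns(1))
        thus "a \<in> F" using sym by (auto simp: F_def)
      qed
    next
      case 3
      thus ?thesis using sub[of s'] less.IH[of s'] less.prems by auto
    qed
  qed
  have bip': "bipartite adj sk" by unfold_locales
  have "\<exists>s\<le>2 * card F. support (Ns s) = {}"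
    by (rule sigma_chain_dies[OF boundary F bip']) (use inF Ns(3) in \<open>auto simp: t_def\<close>)
  then obtain s where s: "s \<le> 2 * card F" "support (Ns s) = {}" by blast
  \<comment> \<open>Each support lies within one step of the preceding one, so a vanishing term
    makes all later terms vanish, including the one at t.\<close>
  have "support (Ns (s + d)) = {}" if "s + d \<le> t" for d
    using that
  proof (induction d)
    case (Suc d)
    thus ?case using spread[of "s + d"] by fastforce
  qed (use s in simp)
  moreover have "s + (t - s) = t" using s(1) by (simp add: t_def)
  ultimately have "support (Ns t) = {}" using le_refl[of t] by metis
  hence "support N = {}" unfolding Ns(2) .
  thus False using N(2) by (auto simp: support_def nonzero_rep_def)
qed

end

section \<open>Duality between the two reflection functors\<close>

lemma transpose_pairing_sum:
  fixes A :: "'a \<Rightarrow> 'k::field mat"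
  assumes "finite B" "dim_vec u = m" "\<And>a. a \<in> B \<Longrightarrow> dim_row (A a) = m \<and> dim_vec (x a) = dim_col (A a)"
  shows "(\<Sum>a\<in>B. ((A a)\<^sup>T *\<^sub>v u) \<bullet> x a) = (\<Sum>i<m. u $ i * (\<Sum>a\<in>B. (A a *\<^sub>v x a) $ i))"
proof -
  have "((A a)\<^sup>T *\<^sub>v u) \<bullet> x a = (\<Sum>i<m. u $ i * (A a *\<^sub>v x a) $ i)" if a: "a \<in> B" for a
  proof -
    have "((A a)\<^sup>T *\<^sub>v u) \<bullet> x a = (\<Sum>k<dim_col (A a). \<Sum>i<m. A a $$ (i,k) * u $ i * x a $ k)"
      using assms(2) assms(3)[OF a] by (simp add: scalar_prod_def atLeast0LessThan sum_distrib_right)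
    also have "\<dots> = (\<Sum>i<m. \<Sum>k<dim_col (A a). A a $$ (i,k) * u $ i * x a $ k)" by (rule sum.swap)
    also have "\<dots> = (\<Sum>i<m. u $ i * (A a *\<^sub>v x a) $ i)"
      using assms(3)[OF a] by (intro sum.cong) (auto simp: scalar_prod_def atLeast0LessThan sum_distrib_left mult_ac)
    finally show ?thesis .
  qed
  hence "(\<Sum>a\<in>B. ((A a)\<^sup>T *\<^sub>v u) \<bullet> x a) = (\<Sum>a\<in>B. \<Sum>i<m. u $ i * (A a *\<^sub>v x a) $ i)" by (intro sum.cong) auto
  also have "\<dots> = (\<Sum>i<m. \<Sum>a\<in>B. u $ i * (A a *\<^sub>v x a) $ i)" by (rule sum.swap)
  finally show ?thesis by (simp add: sum_distrib_left)
qed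

context bipartite
begin

text \<open>The dual of a cokernel is the kernel of the transpose. Surjectivity of the projection
  gives injectivity, the zero composite gives the zero composite, and exactness is transferred by
  the Fredholm alternative.\<close>

lemma sigma_minus_dual:
  fixes M N :: "('v, 'k::field) rep"
  assumes MN: "sigma_minus_rel adj sk M N"
  shows "sigma_rel adj (\<lambda>v. \<not> sk v) (dual M) (dual N)"
proof -
  interpret D: bipartite adj "\<lambda>v. \<not> sk v" by (rule dual_bipartite)
  have M: "valid_rep adj sk M" and N: "valid_rep adj (\<lambda>v. \<not> sk v) N"
    and sink: "\<And>a. sk a \<Longrightarrow> dimv N a = dimv M a"
    and surj: "\<And>b w. \<not> sk b \<Longrightarrow> w \<in> carrier_vec (dimv N b) \<Longrightarrow> \<exists>x. (\<forall>a. adj b a \<longrightarrow> x a \<in> carrier_vec (dimv M a))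
              \<and> (\<forall>i<dimv N b. (\<Sum>a\<in>{a. adj b a}. (mapv N b a *\<^sub>v x a) $ i) = w $ i)"
    and zero: "\<And>b u i. \<not> sk b \<Longrightarrow> u \<in> carrier_vec (dimv M b) \<Longrightarrow> i < dimv N b \<Longrightarrow>
             (\<Sum>a\<in>{a. adj b a}. (mapv N b a *\<^sub>v (mapv M a b *\<^sub>v u)) $ i) = 0"
    and exact: "\<And>b x. \<not> sk b \<Longrightarrow> (\<And>a. adj b a \<Longrightarrow> x a \<in> carrier_vec (dimv M a)) \<Longrightarrow>
              (\<And>i. i < dimv N b \<Longrightarrow> (\<Sum>a\<in>{a. adj b a}. (mapv N b a *\<^sub>v x a) $ i) = 0) \<Longrightarrow>
              (\<exists>u\<in>carrier_vec (dimv M b). \<forall>a. adj b a \<longrightarrow> mapv M a b *\<^sub>v u = x a)"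
    using MN unfolding sigma_minus_rel_def by blast+
  have dims: "dim_row (mapv N b a) = dimv N b" "dim_col (mapv N b a) = dimv M a" 
     "dim_row (mapv M a b) = dimv M a" "dim_col (mapv M a b) = dimv M b" if "adj b a" "\<not> sk b" for a b
    using valid_dim[OF N that(1)] valid_dim[OF M sym[OF that(1)]] that bip[OF that(1)] sink[of a] by auto
  have inj: "u = 0\<^sub>v (dimv N b)"
    if b: "\<not> sk b" and u: "u \<in> carrier_vec (dimv N b)" and z: "\<And>a. adj b a \<Longrightarrow> (mapv N b a)\<^sup>T *\<^sub>v u = 0\<^sub>v (dimv M a)" for b u
  proof (rule eq_vecI)
    fix j assume "j < dim_vec (0\<^sub>v (dimv N b) :: 'k vec)"
    hence j: "j < dimv N b" by simp
    obtain x where x: "\<And>a. adj b a \<Longrightarrow> x a \<in> carrier_vec (dimv M a)"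
      "\<And>i. i < dimv N b \<Longrightarrow> (\<Sum>a\<in>{a. adj b a}. (mapv N b a *\<^sub>v x a) $ i) = unit_vec (dimv N b) j $ i"
      using surj[OF b unit_vec_carrier[of "dimv N b" j]] by blast
    have "(\<Sum>a\<in>{a. adj b a}. ((mapv N b a)\<^sup>T *\<^sub>v u) \<bullet> x a) = (\<Sum>i<dimv N b. u $ i * (\<Sum>a\<in>{a. adj b a}. (mapv N b a *\<^sub>v x a) $ i))"
      by (rule transpose_pairing_sum) (use u x(1) finite_nbrs dims b in auto)
    also have "\<dots> = (\<Sum>i<dimv N b. if i = j then u $ i else 0)" using x(2) j by (intro sum.cong) auto
    also have "\<dots> = u $ j" using j by simp
    finally show "u $ j = 0\<^sub>v (dimv N b) $ j" using z x(1) j by (simp add: sum.neutral)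
  qed (use u in auto)
  have comp: "(\<Sum>a\<in>{a. adj b a}. ((mapv M a b)\<^sup>T *\<^sub>v ((mapv N b a)\<^sup>T *\<^sub>v u)) $ i) = 0"
    if b: "\<not> sk b" and u: "u \<in> carrier_vec (dimv N b)" and i: "i < dimv M b" for b u i
  proof -
    let ?e = "\<lambda>a. mapv M a b *\<^sub>v unit_vec (dimv M b) i"
    have "((mapv M a b)\<^sup>T *\<^sub>v ((mapv N b a)\<^sup>T *\<^sub>v u)) $ i = ((mapv N b a)\<^sup>T *\<^sub>v u) \<bullet> ?e a" if a: "adj b a" for a
    proof -
      have c: "?e a = col (mapv M a b) i" using mult_mat_vec_unit[of i "mapv M a b"] dims[OF a b] i by simp
      have "((mapv M a b)\<^sup>T *\<^sub>v ((mapv N b a)\<^sup>T *\<^sub>v u)) $ i = col (mapv M a b) i \<bullet> ((mapv N b a)\<^sup>T *\<^sub>v u)"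
        using dims[OF a b] i by simp
      also have "\<dots> = ((mapv N b a)\<^sup>T *\<^sub>v u) \<bullet> col (mapv M a b) i"
        by (rule comm_scalar_prod[of _ "dimv M a"]) (auto intro!: carrier_vecI simp: dims[OF a b])
      finally show ?thesis unfolding c .
    qed
    hence "(\<Sum>a\<in>{a. adj b a}. ((mapv M a b)\<^sup>T *\<^sub>v ((mapv N b a)\<^sup>T *\<^sub>v u)) $ i) = (\<Sum>a\<in>{a. adj b a}. ((mapv N b a)\<^sup>T *\<^sub>v u) \<bullet> ?e a)"
      by (intro sum.cong) auto
    also have "\<dots> = (\<Sum>l<dimv N b. u $ l * (\<Sum>a\<in>{a. adj b a}. (mapv N b a *\<^sub>v ?e a) $ l))"
      by (rule transpose_pairing_sum) (use u finite_nbrs dims b in auto)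
    also have "\<dots> = 0" using zero[OF b unit_vec_carrier[of "dimv M b" i]] by (intro sum.neutral ballI) auto
    finally show ?thesis .
  qed
  have ex: "\<exists>u\<in>carrier_vec (dimv N b). \<forall>a. adj b a \<longrightarrow> (mapv N b a)\<^sup>T *\<^sub>v u = x a"
    if b: "\<not> sk b" and x: "\<And>a. adj b a \<Longrightarrow> x a \<in> carrier_vec (dimv M a)"
      and z: "\<And>i. i < dimv M b \<Longrightarrow> (\<Sum>a\<in>{a. adj b a}. ((mapv M a b)\<^sup>T *\<^sub>v x a) $ i) = 0" for b x
  proof -
    note fin = finite_nbrs[of b]
    have NC: "(mapv N b a)\<^sup>T \<in> carrier_mat (dimv M a) (dimv N b)" if "a \<in> {a. adj b a}" for a using that dims b by auto
    have False if "\<not> ?thesis"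
    proof -
      have no: "\<not> (\<exists>u\<in>carrier_vec (dimv N b). \<forall>a\<in>{a. adj b a}. (mapv N b a)\<^sup>T *\<^sub>v u = x a)" using that by auto
      have xC: "x a \<in> carrier_vec (dimv M a)" if "a \<in> {a. adj b a}" for a using x that by simp
      obtain w where w: "\<And>a. w a \<in> carrier_vec (dimv M a)"
        "\<And>u. u \<in> carrier_vec (dimv N b) \<Longrightarrow> (\<Sum>a\<in>{a. adj b a}. ((mapv N b a)\<^sup>T *\<^sub>v u) \<bullet> w a) = 0"
        "(\<Sum>a\<in>{a. adj b a}. x a \<bullet> w a) \<noteq> 0"
        by (rule unsolvable_certificate[OF fin NC xC no], assumption, assumption, rule that) blast+
      have "(\<Sum>a\<in>{a. adj b a}. (mapv N b a *\<^sub>v w a) $ l) = 0" if l: "l < dimv N b" for l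
      proof -
        have "0 = (\<Sum>a\<in>{a. adj b a}. ((mapv N b a)\<^sup>T *\<^sub>v unit_vec (dimv N b) l) \<bullet> w a)" using w(2) by simp
        also have "\<dots> = (\<Sum>i<dimv N b. unit_vec (dimv N b) l $ i * (\<Sum>a\<in>{a. adj b a}. (mapv N b a *\<^sub>v w a) $ i))"
          by (rule transpose_pairing_sum) (use w(1) fin dims b in auto)
        also have "\<dots> = (\<Sum>i<dimv N b. if i = l then \<Sum>a\<in>{a. adj b a}. (mapv N b a *\<^sub>v w a) $ i else 0)"
          by (rule sum.cong) (use l in auto)
        finally show ?thesis using l by simp
      qed
      \<comment> \<open>The certificate w of unsolvability is killed by the projection, so it comes
        from some v at b. But x is killed by the transposed arrows and therefore pairs to zero with
        every such tuple.\<close>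
      then obtain v where v: "v \<in> carrier_vec (dimv M b)" "\<And>a. adj b a \<Longrightarrow> mapv M a b *\<^sub>v v = w a"
        using exact[OF b, of w] w(1) by blast
      have "(\<Sum>a\<in>{a. adj b a}. x a \<bullet> w a) = (\<Sum>a\<in>{a. adj b a}. (((mapv M a b)\<^sup>T)\<^sup>T *\<^sub>v v) \<bullet> x a)"
        using v(2) w(1) x by (intro sum.cong) (auto intro: comm_scalar_prod)
      also have "\<dots> = (\<Sum>i<dimv M b. v $ i * (\<Sum>a\<in>{a. adj b a}. ((mapv M a b)\<^sup>T *\<^sub>v x a) $ i))"
        by (rule transpose_pairing_sum) (use v(1) x fin dims b in auto)
      also have "\<dots> = 0" using z by (intro sum.neutral ballI) auto
      finally show False using w(3) by contradiction
    qed
    thus ?thesis by blast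
  qed
  show ?thesis
    unfolding sigma_rel_def
    using valid_dual[OF M] D.valid_dual[OF N] sink inj comp ex by auto
qed

end

lemma sigma_minus_pow_dual:
  "bipartite adj sk \<Longrightarrow> sigma_minus_pow adj sk t M N \<Longrightarrow> sigma_pow adj (\<lambda>v. \<not> sk v) t (dual M) (dual N)"
proof (induction t arbitrary: sk M)
  case (Suc t)
  then obtain P where P: "sigma_minus_rel adj sk M P" "sigma_minus_pow adj (\<lambda>v. \<not> sk v) t P N" by auto
  from Suc.IH[OF bipartite.dual_bipartite[OF Suc.prems(1)] P(2)] bipartite.sigma_minus_dual[OF Suc.prems(1) P(1)]
  show ?case by auto
qed simp

section \<open>Longest paths in trees\<close>

text \<open>A recursive form of \<open>nb_path\<close>, with the ambient set split off, for
  induction along the list.\<close>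

fun nb_list :: "('v \<Rightarrow> 'v \<Rightarrow> bool) \<Rightarrow> 'v list \<Rightarrow> bool" where
  "nb_list adj [] = False"
| "nb_list adj [x] = True"
| "nb_list adj [x, y] = adj x y"
| "nb_list adj (x # y # z # zs) = (adj x y \<and> x \<noteq> z \<and> nb_list adj (y # z # zs))"

lemma all_Suc_shift: "(\<forall>i::nat. i + k < Suc m \<longrightarrow> P i) \<longleftrightarrow> (k < Suc m \<longrightarrow> P 0) \<and> (\<forall>i. i + k < m \<longrightarrow> P (Suc i))"
proof (intro iffI conjI allI impI)
  fix i assume "(k < Suc m \<longrightarrow> P 0) \<and> (\<forall>i. i + k < m \<longrightarrow> P (Suc i))" "i + k < Suc m"
  thus "P i" by (cases i) auto
qed auto

lemma nb_list_iff:
  "nb_list adj xs \<longleftrightarrow> xs \<noteq> [] \<and> (\<forall>i. i + 1 < length xs \<longrightarrow> adj (xs ! i) (xs ! (i + 1)))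
     \<and> (\<forall>i. i + 2 < length xs \<longrightarrow> xs ! i \<noteq> xs ! (i + 2))"
proof (induction adj xs rule: nb_list.induct)
  case (4 adj x y z zs)
  have s: "length (x # y # z # zs) = Suc (length (y # z # zs))" by simp
  show ?case unfolding nb_list.simps 4 s all_Suc_shift by auto
qed (auto simp: less_Suc_eq)

lemma nb_path_iff: "nb_path adj S xs \<longleftrightarrow> nb_list adj xs \<and> set xs \<subseteq> S"
  unfolding nb_path_def nb_list_iff by auto

lemma nb_list_Cons: "xs \<noteq> [] \<Longrightarrow> nb_list adj (x # xs) \<longleftrightarrow> adj x (hd xs) \<and> (length xs \<ge> 2 \<longrightarrow> x \<noteq> xs ! 1) \<and> nb_list adj xs"
  by (cases "(adj, x # xs)" rule: nb_list.cases) auto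

lemma nb_list_not_Nil: "nb_list adj xs \<Longrightarrow> xs \<noteq> []"
  by auto

lemma nb_list_prefix: "nb_list adj (xs @ ys) \<Longrightarrow> xs \<noteq> [] \<Longrightarrow> nb_list adj xs"
proof (induction xs)
  case (Cons x xs)
  thus ?case by (cases "xs = []") (auto simp: nb_list_Cons nth_append)
qed simp

lemma nb_list_suffix: "nb_list adj (xs @ ys) \<Longrightarrow> ys \<noteq> [] \<Longrightarrow> nb_list adj ys"
  by (induction xs) (auto simp: nb_list_Cons)

text \<open>Backtracking is visible in windows of three vertices. With at least two shared vertices
  every such window lies inside one of the two pieces; a single shared vertex could be the middle of
  a new window.\<close>

lemma nb_list_overlap:
  "nb_list adj (xs @ ys) \<Longrightarrow> nb_list adj (ys @ zs) \<Longrightarrow> length ys \<ge> 2 \<Longrightarrow> nb_list adj (xs @ ys @ zs)"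
proof (induction xs)
  case (Cons x xs)
  obtain a b r where r: "xs @ ys = a # b # r" using Cons.prems(3) by (cases xs; cases ys; cases "tl xs"; cases "tl ys") auto
  hence e: "xs @ ys @ zs = a # b # r @ zs" by (metis append_Cons append_assoc)
  have p: "nb_list adj (x # a # b # r)" using Cons.prems(1) r by simp
  hence "nb_list adj (xs @ ys)" using r by simp
  from Cons.IH[OF this Cons.prems(2,3)] have "nb_list adj (a # b # r @ zs)" unfolding e .
  hence "nb_list adj (x # a # b # r @ zs)" using p by simp
  thus ?case unfolding append_Cons e .
qed simp

lemma nb_list_walk: "nb_list adj xs \<Longrightarrow> successively adj xs"
  by (induction adj xs rule: nb_list.induct) auto

lemma backtrack:
  "successively adj ws \<Longrightarrow> ws \<noteq> [] \<Longrightarrow> \<not> nb_list adj ws \<Longrightarrow> \<exists>us a b vs. ws = us @ [a, b, a] @ vs"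
proof (induction adj ws rule: nb_list.induct)
  case (4 adj x y z zs)
  show ?case
  proof (cases "x = z")
    case True
    thus ?thesis by (intro exI[of _ "[]"]) auto
  next
    case False
    hence "\<exists>us a b vs. y # z # zs = us @ [a, b, a] @ vs" using 4 by auto
    thus ?thesis by (metis append_Cons)
  qed
qed auto

text \<open>Replacing a backtrack a, b, a by a shortens the walk by two and keeps its ends. The
  clause on equal lengths later identifies a path with any walk as short as it.\<close>

lemma walk_reduce:
  assumes "successively adj ws" "ws \<noteq> []"
  shows "\<exists>xs. nb_list adj xs \<and> hd xs = hd ws \<and> last xs = last ws \<and> set xs \<subseteq> set ws
    \<and> length xs \<le> length ws \<and> (length xs = length ws \<longrightarrow> xs = ws)"
  using assms
proof (induction ws rule: length_induct)
  case (1 ws)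
  show ?case
  proof (cases "nb_list adj ws")
    case False
    then obtain us a b vs where ws: "ws = us @ [a, b, a] @ vs" using backtrack 1 by metis
    let ?w = "us @ [a] @ vs"
    have "successively adj ?w" using 1(2) unfolding ws by (auto simp: successively_append_iff successively_Cons)
    moreover have "length ?w < length ws" "?w \<noteq> []" by (auto simp: ws)
    ultimately obtain xs where xs: "nb_list adj xs" "hd xs = hd ?w" "last xs = last ?w" "set xs \<subseteq> set ?w" "length xs \<le> length ?w"
      using 1(1) by blast
    have "hd ?w = hd ws" "last ?w = last ws" by (auto simp: ws hd_append)
    thus ?thesis using xs by (intro exI[of _ xs]) (auto simp: ws)
  qed auto
qed

lemma path_center_rev:
  assumes "xs \<noteq> []"
  shows "path_center (rev xs) = path_center xs"
proof -
  have 1: "rev xs ! (plen xs div 2) = xs ! (plen xs - plen xs div 2)"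
    using assms by (subst rev_nth) (auto simp: plen_def div_le_dividend less_Suc_eq_le Suc_diff_Suc, cases xs, auto simp: less_Suc_eq_le)
  have 2: "rev xs ! (plen xs div 2 + 1) = xs ! (plen xs - plen xs div 2 - 1)" if "odd (plen xs)"
  proof -
    have "length xs > 0" using assms by simp
    hence "plen xs div 2 + 1 < length xs" using that unfolding plen_def by presburger
    thus ?thesis by (subst rev_nth) (auto simp: plen_def)
  qed
  have e: "plen xs - plen xs div 2 = plen xs div 2" if "even (plen xs)" using that by (auto elim!: evenE)
  have o: "plen xs - plen xs div 2 = plen xs div 2 + 1" if "odd (plen xs)" using that by (auto elim!: oddE)
  have "plen (rev xs) = plen xs" by (simp add: plen_def)
  thus ?thesis unfolding path_center_def using 1 2 e o by auto
qed

locale tree =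
  fixes adj :: "'v \<Rightarrow> 'v \<Rightarrow> bool" and n :: nat
  assumes reg: "regular_tree adj n" and n3: "n \<ge> 3"
begin

lemma adj_sym: "adj a b \<Longrightarrow> adj b a"
  using reg by (auto simp: regular_tree_def)

lemma nb_list_rev: "nb_list adj (rev xs) = nb_list adj xs"
proof -
  have "nb_list adj (rev xs)" if "nb_list adj xs" for xs
  proof -
    have 1: "adj (rev xs ! i) (rev xs ! (i+1))" if i: "i + 1 < length xs" for i
    proof -
      have "adj (xs ! (length xs - 1 - (i + 1))) (xs ! (length xs - 1 - (i + 1) + 1))"
        using \<open>nb_list adj xs\<close> i unfolding nb_list_iff by auto
      moreover have "length xs - 1 - (i + 1) + 1 = length xs - Suc i" using i by simp
      ultimately show ?thesis using i adj_sym by (simp add: rev_nth)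
    qed
    have 2: "rev xs ! i \<noteq> rev xs ! (i+2)" if i: "i + 2 < length xs" for i
    proof -
      have "xs ! (length xs - 1 - (i + 2)) \<noteq> xs ! (length xs - 1 - (i + 2) + 2)"
        using \<open>nb_list adj xs\<close> i unfolding nb_list_iff by auto
      moreover have "length xs - 1 - (i + 2) + 2 = length xs - Suc i" using i by simp
      ultimately show ?thesis using i by (simp add: rev_nth)
    qed
    show ?thesis using that 1 2 unfolding nb_list_iff by simp
  qed
  from this[of xs] this[of "rev xs"] show ?thesis by auto
qed

lemma no_cycle: "nb_list adj xs \<Longrightarrow> length xs \<ge> 2 \<Longrightarrow> hd xs \<noteq> last xs"
  using reg unfolding regular_tree_def nb_path_iff plen_def by fastforce

text \<open>Where two paths with a common start first separate, the reverse of one continued by the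
  other does not backtrack; with a common end it would be closed, which a tree forbids.\<close>

lemma nb_list_unique:
  "nb_list adj xs \<Longrightarrow> nb_list adj ys \<Longrightarrow> hd xs = hd ys \<Longrightarrow> last xs = last ys \<Longrightarrow> xs = ys"
proof (induction xs arbitrary: ys)
  case (Cons x xs)
  then obtain ys' where ys: "ys = x # ys'" by (cases ys) auto
  show ?case
  proof (cases "xs = [] \<or> ys' = []")
    case True
    have "xs = []" if "ys' = []"
    proof (rule ccontr)
      assume "xs \<noteq> []"
      hence "hd (x # xs) \<noteq> last (x # xs)" using no_cycle[OF Cons.prems(1)] by (cases xs) auto
      thus False using Cons.prems(4) ys that by simp
    qed
    moreover have "ys' = []" if "xs = []"
    proof (rule ccontr)
      assume "ys' \<noteq> []"
      hence "hd ys \<noteq> last ys" using no_cycle[OF Cons.prems(2)] ys by (cases ys') auto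
      thus False using Cons.prems(4) ys that by simp
    qed
    ultimately show ?thesis using True ys by auto
  next
    case False
    then obtain a as b bs where ab: "xs = a # as" "ys' = b # bs" by (auto simp: neq_Nil_conv)
    show ?thesis
    proof (cases "a = b")
      case True
      have "nb_list adj xs" "nb_list adj ys'" using Cons.prems ys ab by (auto simp: nb_list_Cons)
      from Cons.IH[OF this] show ?thesis using Cons.prems ys ab True by auto
    next
      case ne: False
      have 1: "nb_list adj (rev as @ [a, x])" using Cons.prems(1) nb_list_rev[of "x # a # as"] ab by simp
      have 2: "nb_list adj (x # b # bs)" using Cons.prems(2) ys ab by simp
      have 3: "nb_list adj ([a, x] @ b # bs)" using nb_list_suffix[OF 1] 2 ne by (simp add: nb_list_Cons)
      have "nb_list adj (rev as @ [a, x] @ b # bs)" by (rule nb_list_overlap[OF 1 3]) simp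
      from no_cycle[OF this] have "hd (rev as @ [a, x] @ b # bs) \<noteq> last (b # bs)" by simp
      moreover have "hd (rev as @ [a, x] @ b # bs) = last (a # as)" by (cases as rule: rev_cases) auto
      ultimately show ?thesis using Cons.prems(4) ys ab by simp
    qed
  qed
qed simp

lemma shortest:
  assumes "nb_list adj xs" "successively adj ws" "ws \<noteq> []" "hd xs = hd ws" "last xs = last ws"
  shows "length xs \<le> length ws" "length xs = length ws \<Longrightarrow> xs = ws"
proof -
  obtain ys where ys: "nb_list adj ys" "hd ys = hd ws" "last ys = last ws" "length ys \<le> length ws" "length ys = length ws \<longrightarrow> ys = ws"
    using walk_reduce[OF assms(2,3)] by blast
  have "xs = ys" by (rule nb_list_unique[OF assms(1) ys(1)]) (use assms(4,5) ys(2,3) in simp_all)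
  thus "length xs \<le> length ws" "length xs = length ws \<Longrightarrow> xs = ws" using ys(4,5) by auto
qed

lemma nb_list_distinct: "nb_list adj xs \<Longrightarrow> distinct xs"
proof (induction xs)
  case (Cons x xs)
  show ?case
  proof (cases "xs = []")
    case False
    have "x \<notin> set xs"
    proof
      assume "x \<in> set xs"
      then obtain us vs where "xs = us @ x # vs" by (auto simp: in_set_conv_decomp)
      hence "nb_list adj ((x # us @ [x]) @ vs)" using Cons.prems by simp
      from no_cycle[OF nb_list_prefix[OF this]] show False by simp
    qed
    thus ?thesis using Cons False by (simp add: nb_list_Cons)
  qed simp
qed simp

lemma longest_exists:
  assumes S: "finite S" "S \<noteq> {}"
  obtains xs where "nb_list adj xs" "set xs \<subseteq> S" "\<And>ys. nb_list adj ys \<Longrightarrow> set ys \<subseteq> S \<Longrightarrow> length ys \<le> length xs"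
proof -
  obtain x where x: "x \<in> S" using S by blast
  have b: "length ys \<le> card S" if "nb_list adj ys" "set ys \<subseteq> S" for ys
    using distinct_card[OF nb_list_distinct[OF that(1)]] card_mono[OF S(1) that(2)] by simp
  have "nb_list adj [x] \<and> set [x] \<subseteq> S" using x by simp
  moreover have "\<forall>ys. nb_list adj ys \<and> set ys \<subseteq> S \<longrightarrow> length ys < Suc (card S)" using b by (simp add: less_Suc_eq_le)
  ultimately obtain xs where "nb_list adj xs \<and> set xs \<subseteq> S" "\<forall>ys. nb_list adj ys \<and> set ys \<subseteq> S \<longrightarrow> length ys \<le> length xs"
    using ex_has_greatest_nat[of "\<lambda>ys. nb_list adj ys \<and> set ys \<subseteq> S" "[x]" length "Suc (card S)"] by blast
  thus ?thesis using that[of xs] by blast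
qed

lemma extend:
  assumes "nb_list adj xs"
  obtains c where "adj (last xs) c" "nb_list adj (xs @ [c])"
proof -
  have c: "card {c. adj (last xs) c} = n" using reg by (simp add: regular_tree_def)
  show ?thesis
  proof (cases xs rule: rev_cases)
    case (snoc ys y)
    show ?thesis
    proof (cases ys rule: rev_cases)
      case Nil
      have "{c. adj (last xs) c} \<noteq> {}" using c n3 by (metis card.empty not_numeral_le_zero)
      then obtain c where "adj (last xs) c" by blast
      thus ?thesis using that[of c] snoc Nil by simp
    next
      case (snoc zs z)
      have "\<not> {c. adj (last xs) c} \<subseteq> {z}" using c n3 card_mono[of "{z}" "{c. adj (last xs) c}"] by auto
      then obtain c where cc: "adj (last xs) c" "c \<noteq> z" by blast
      have xs: "xs = zs @ [z, y]" using snoc \<open>xs = ys @ [y]\<close> by simp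
      have "nb_list adj [z, y, c]" using nb_list_suffix[of adj zs "[z, y]"] assms cc xs by simp
      hence "nb_list adj (zs @ [z, y] @ [c])" using assms xs by (intro nb_list_overlap) auto
      thus ?thesis using that[of c] cc xs by simp
    qed
  qed (use assms in simp)
qed

text \<open>A longest path in F can be continued beyond its last vertex, and the continuation has to
  leave F.\<close>

lemma boundary:
  assumes "finite F" "F \<noteq> {}"
  shows "\<exists>b\<in>F. \<exists>c. adj c b \<and> c \<notin> F"
proof -
  obtain xs where xs: "nb_list adj xs" "set xs \<subseteq> F" "\<And>ys. nb_list adj ys \<Longrightarrow> set ys \<subseteq> F \<Longrightarrow> length ys \<le> length xs"
    using longest_exists[OF assms] by blast
  obtain c where c: "adj (last xs) c" "nb_list adj (xs @ [c])" using extend[OF xs(1)] by blast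
  have "c \<notin> F" using xs(3)[OF c(2)] xs(2) by auto
  thus ?thesis using c(1) adj_sym xs(1,2) nb_list_not_Nil[OF xs(1)] by (metis in_mono last_in_set)
qed

section \<open>Connected sets and the center of their longest paths\<close>

definition conn :: "'v set \<Rightarrow> bool" where
  "conn S \<longleftrightarrow> (\<forall>x\<in>S. \<forall>y\<in>S. \<exists>ws. successively adj ws \<and> ws \<noteq> [] \<and> hd ws = x \<and> last ws = y \<and> set ws \<subseteq> S)"

lemma conn_path:
  assumes "conn S" "x \<in> S" "y \<in> S"
  obtains xs where "nb_list adj xs" "hd xs = x" "last xs = y" "set xs \<subseteq> S"
proof -
  obtain ws where ws: "successively adj ws" "ws \<noteq> []" "hd ws = x" "last ws = y" "set ws \<subseteq> S"
    using assms unfolding conn_def by blast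
  from walk_reduce[OF ws(1,2)] ws show ?thesis using that by (metis order_trans)
qed

text \<open>A shortest path from x to \<gamma> meets \<gamma> only at its last vertex, the foot with
  index i. It can therefore be continued along \<gamma> in either direction without backtracking.
  The foot is left out of \<open>us\<close>.\<close>

lemma projection:
  assumes S: "conn S" and g: "nb_list adj \<gamma>" "set \<gamma> \<subseteq> S" and x: "x \<in> S"
  obtains us i where "i < length \<gamma>" "hd (us @ [\<gamma> ! i]) = x" "set us \<subseteq> S"
    "nb_list adj (us @ drop i \<gamma>)" "nb_list adj (us @ rev (take (Suc i) \<gamma>))"
proof -
  let ?P = "\<lambda>xs. nb_list adj xs \<and> hd xs = x \<and> last xs \<in> set \<gamma> \<and> set xs \<subseteq> S"
  have "last \<gamma> \<in> S" using g nb_list_not_Nil[OF g(1)] by auto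
  from conn_path[OF S x this] have "\<exists>xs. ?P xs" using nb_list_not_Nil[OF g(1)] by (metis last_in_set)
  then obtain xs where xs: "?P xs" and min: "\<And>ys. ?P ys \<Longrightarrow> length xs \<le> length ys"
    using ex_has_least_nat[of ?P _ length] by blast
  obtain us z where us: "xs = us @ [z]" using xs by (cases xs rule: rev_cases) auto
  then obtain i where i: "i < length \<gamma>" "\<gamma> ! i = z" using xs by (auto simp: in_set_conv_nth)
  have notin: "last us \<notin> set \<gamma>" if "us \<noteq> []"
  proof
    assume "last us \<in> set \<gamma>"
    hence "?P us" using xs us that nb_list_prefix[of adj us "[z]"] by auto
    from min[OF this] us show False by simp
  qed
  have app: "nb_list adj (us @ z # vs)" if vs: "nb_list adj (z # vs)" "set vs \<subseteq> set \<gamma>" for vs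
  proof (cases "us = [] \<or> vs = []")
    case True
    thus ?thesis using vs xs us by auto
  next
    case False
    then obtain us' u v vs' where uv: "us = us' @ [u]" "vs = v # vs'" by (metis neq_Nil_conv rev_exhaust)
    have 1: "nb_list adj (us' @ [u, z])" using xs us uv by simp
    have "u \<noteq> v" using notin vs(2) uv False by auto
    hence "nb_list adj ([u, z] @ vs)" using nb_list_suffix[OF 1] vs uv by (simp add: nb_list_Cons)
    from nb_list_overlap[OF 1 this] show ?thesis using uv by simp
  qed
  have d: "drop i \<gamma> = z # drop (Suc i) \<gamma>" using i by (metis Cons_nth_drop_Suc)
  have t: "rev (take (Suc i) \<gamma>) = z # rev (take i \<gamma>)" using i by (simp add: take_Suc_conv_app_nth)
  show ?thesis
  proof (rule that[of i us])
    have "nb_list adj (drop i \<gamma>)" by (rule nb_list_suffix[of adj "take i \<gamma>"]) (use g(1) i in simp_all)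
    thus "nb_list adj (us @ drop i \<gamma>)" unfolding d by (intro app) (auto dest: in_set_dropD)
    have "nb_list adj (take (Suc i) \<gamma>)" 
      by (rule nb_list_prefix[of adj _ "drop (Suc i) \<gamma>"]) (use g(1) i in \<open>simp only: append_take_drop_id\<close>, use i in auto)
    hence "nb_list adj (z # rev (take i \<gamma>))" using nb_list_rev[of "take (Suc i) \<gamma>"] t by simp
    thus "nb_list adj (us @ rev (take (Suc i) \<gamma>))" unfolding t by (intro app) (auto dest: in_set_takeD)
  qed (use i xs us in auto)
qed

text \<open>Project the ends of \<delta> to \<gamma>, with feet i and j. Maximality bounds each
  branch by both pieces into which its foot divides \<gamma>. If i < j, then \<delta> runs along
  \<gamma> from i to j, and equality of lengths forces the branches to have lengths i and L - 1 - j,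
  where L is the length of \<gamma>; so \<delta> and \<gamma> agree on a stretch that contains the
  middle. If i = j, the two branches form a walk between the ends of \<delta> that can only be long
  enough if the common foot is the middle of both paths.\<close>

lemma center_unique_aux:
  assumes S: "conn S" and g: "nb_list adj \<gamma>" "set \<gamma> \<subseteq> S" and d: "nb_list adj \<delta>" "set \<delta> \<subseteq> S"
    and len: "length \<delta> = length \<gamma>" and max: "\<And>ys. nb_list adj ys \<Longrightarrow> set ys \<subseteq> S \<Longrightarrow> length ys \<le> length \<gamma>"
    and us: "i < length \<gamma>" "hd (us @ [\<gamma> ! i]) = hd \<delta>" "set us \<subseteq> S"
    "nb_list adj (us @ drop i \<gamma>)" "nb_list adj (us @ rev (take (Suc i) \<gamma>))"
    and vs: "j < length \<gamma>" "hd (vs @ [\<gamma> ! j]) = last \<delta>" "set vs \<subseteq> S"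
    "nb_list adj (vs @ drop j \<gamma>)" "nb_list adj (vs @ rev (take (Suc j) \<gamma>))"
    and ij: "i \<le> j"
  shows "path_center \<delta> = path_center \<gamma>"
proof -
  let ?L = "length \<gamma>"
  have sub: "set (drop k \<gamma>) \<subseteq> S" "set (take k \<gamma>) \<subseteq> S" for k using g(2) by (auto dest: in_set_dropD in_set_takeD)
  have u1: "length us \<le> i" using max[OF us(4)] sub us(1,3) by auto
  have u2: "length us + i + 1 \<le> ?L" using max[OF us(5)] sub us(1,3) by auto
  have v1: "length vs \<le> j" using max[OF vs(4)] sub vs(1,3) by auto
  have v2: "length vs + j + 1 \<le> ?L" using max[OF vs(5)] sub vs(1,3) by auto
  show ?thesis
  proof (cases "i = j")
    case False
    hence ij: "i < j" using ij by simp
    define B where "B = take (Suc j - i) (drop i \<gamma>)"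
    have B: "length B = Suc j - i" using vs(1) by (simp add: B_def)
    have dB: "drop i \<gamma> = B @ drop (Suc j) \<gamma>"
    proof -
      have "drop (Suc j - i) (drop i \<gamma>) = drop (Suc j) \<gamma>" using ij by simp
      thus ?thesis unfolding B_def by (metis append_take_drop_id)
    qed
    have tB: "take (Suc j) \<gamma> = take i \<gamma> @ B"
      unfolding B_def using ij take_add[of i "Suc j - i" \<gamma>] by simp
    have "nb_list adj ((us @ B) @ drop (Suc j) \<gamma>)" using us(4) unfolding dB by simp
    hence 1: "nb_list adj (us @ B)" by (rule nb_list_prefix) (use B ij in auto)
    have "nb_list adj (take (Suc j) \<gamma> @ rev vs)" using vs(5) nb_list_rev[of "vs @ rev (take (Suc j) \<gamma>)"] by simp
    hence "nb_list adj (take i \<gamma> @ B @ rev vs)" unfolding tB by simp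
    hence 2: "nb_list adj (B @ rev vs)" by (rule nb_list_suffix) (use B ij in auto)
    have path: "nb_list adj (us @ B @ rev vs)" by (rule nb_list_overlap[OF 1 2]) (use B ij in simp)
    have Bne: "B \<noteq> []" using B ij by auto
    have hB: "hd B = \<gamma> ! i" unfolding B_def using ij us(1) by (simp add: hd_drop_conv_nth)
    have lB: "last B = \<gamma> ! j" using Bne B ij vs(1) by (simp add: last_conv_nth B_def)
    have "hd (us @ B @ rev vs) = hd \<delta>" using us(2) hB Bne by (cases us) auto
    moreover have "last (us @ B @ rev vs) = last \<delta>" using vs(2) lB Bne by (cases vs) auto
    ultimately have \<delta>: "\<delta> = us @ B @ rev vs" using nb_list_unique[OF d(1) path] by simp
    have eqs: "length us = i" "length vs = ?L - 1 - j"
      using len B u1 v2 ij unfolding \<delta> by auto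
    have nth: "\<delta> ! k = \<gamma> ! k" if "i \<le> k" "k \<le> j" for k
    proof -
      have "k - i < length B" using that B by simp
      hence "\<delta> ! k = B ! (k - i)" unfolding \<delta> using eqs(1) that by (simp add: nth_append)
      also have "\<dots> = \<gamma> ! k" unfolding B_def using that vs(1) by simp
      finally show ?thesis .
    qed
    have p: "plen \<delta> = plen \<gamma>" using len by (simp add: plen_def)
    have "i \<le> plen \<gamma> div 2" "plen \<gamma> div 2 \<le> j" using u2 v1 eqs vs(1) by (auto simp: plen_def)
    moreover have "plen \<gamma> div 2 + 1 \<le> j" if "odd (plen \<gamma>)"
      using that v1 eqs(2) vs(1) unfolding plen_def by presburger
    ultimately show ?thesis unfolding path_center_def p using nth by auto
  next
    case True
    let ?w = "us @ [\<gamma> ! i] @ rev vs"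
    have di: "drop i \<gamma> = \<gamma> ! i # drop (Suc i) \<gamma>" using us(1) by (metis Cons_nth_drop_Suc)
    have "successively adj (us @ drop i \<gamma>)" "successively adj (vs @ drop i \<gamma>)"
      using nb_list_walk us(4) vs(4) True by auto
    hence a: "successively adj (us @ [\<gamma> ! i])" "successively adj (vs @ [\<gamma> ! i])"
      unfolding di by (auto simp: successively_append_iff)
    have "nb_list adj (vs @ [\<gamma> ! i])"
      using nb_list_prefix[of adj "vs @ [\<gamma> ! i]" "drop (Suc i) \<gamma>"] vs(4) True di by simp
    hence "nb_list adj (\<gamma> ! i # rev vs)" using nb_list_rev[of "vs @ [\<gamma> ! i]"] by simp
    hence "successively adj (\<gamma> ! i # rev vs)" by (rule nb_list_walk)
    hence w: "successively adj ?w" using a(1) by (auto simp: successively_append_iff)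
    have ends: "hd \<delta> = hd ?w" "last \<delta> = last ?w" using us(2) vs(2) True by (cases us; cases vs; auto)+
    have "length \<delta> \<le> length ?w" by (rule shortest(1)[OF d(1) w _ ends]) simp
    hence eqs: "length us = i" "length vs = i" "?L = 2 * i + 1" using u1 u2 v1 v2 len True by auto
    have \<delta>: "\<delta> = ?w" by (rule shortest(2)[OF d(1) w _ ends]) (use eqs len in auto)
    have "plen \<gamma> = 2 * i" "plen \<delta> = 2 * i" using eqs len by (auto simp: plen_def)
    moreover have "\<delta> ! i = \<gamma> ! i" unfolding \<delta> using eqs(1) by (simp add: nth_append)
    ultimately show ?thesis unfolding path_center_def by simp
  qed
qed

lemma center_unique:
  assumes S: "conn S" and g: "nb_list adj \<gamma>" "set \<gamma> \<subseteq> S" and d: "nb_list adj \<delta>" "set \<delta> \<subseteq> S"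
    and len: "length \<delta> = length \<gamma>" and max: "\<And>ys. nb_list adj ys \<Longrightarrow> set ys \<subseteq> S \<Longrightarrow> length ys \<le> length \<gamma>"
  shows "path_center \<delta> = path_center \<gamma>"
proof -
  have ne: "\<delta> \<noteq> []" by (rule nb_list_not_Nil[OF d(1)])
  have hS: "hd \<delta> \<in> S" and lS: "last \<delta> \<in> S" using d(2) ne by auto
  obtain us i where us: "i < length \<gamma>" "hd (us @ [\<gamma> ! i]) = hd \<delta>" "set us \<subseteq> S"
    "nb_list adj (us @ drop i \<gamma>)" "nb_list adj (us @ rev (take (Suc i) \<gamma>))" by (rule projection[OF S g hS])
  obtain vs j where vs: "j < length \<gamma>" "hd (vs @ [\<gamma> ! j]) = last \<delta>" "set vs \<subseteq> S"
    "nb_list adj (vs @ drop j \<gamma>)" "nb_list adj (vs @ rev (take (Suc j) \<gamma>))" by (rule projection[OF S g lS])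
  show ?thesis
  proof (cases "i \<le> j")
    case True
    show ?thesis by (rule center_unique_aux[OF S g d len max us vs True])
  next
    case False
    \<comment> \<open>Reversing \<delta> exchanges the two feet, and the center does not see the
      direction.\<close>
    have "path_center (rev \<delta>) = path_center \<gamma>"
      by (rule center_unique_aux[OF S g, of "rev \<delta>" j vs i us])
        (use d len max us vs False ne in \<open>simp_all add: nb_list_rev hd_rev last_rev\<close>)
    thus ?thesis using path_center_rev[OF ne] by simp
  qed
qed

end

section \<open>The support of eta Y\<close>

text \<open>Stacking r on g gives an injective matrix, because f r + s g recovers the
  argument.\<close>

lemma dim_le_if_sum_one:
  fixes f r s g :: "'k::field mat"
  assumes f: "f \<in> carrier_mat m a" and r: "r \<in> carrier_mat a m" and s: "s \<in> carrier_mat m b" and g: "g \<in> carrier_mat b m"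
    and one: "f * r + s * g = 1\<^sub>m m"
  shows "m \<le> a + b"
proof -
  let ?R = "mat (a + b) m (\<lambda>(i,j). if i < a then r $$ (i,j) else g $$ (i - a,j))"
  show ?thesis
  proof (rule dim_le_if_injective[of ?R])
    fix x :: "'k vec" assume x: "x \<in> carrier_vec m" "?R *\<^sub>v x = 0\<^sub>v (a + b)"
    have R: "(?R *\<^sub>v x) $ k = 0" if "k < a + b" for k using x(2) that by simp
    have rx: "r *\<^sub>v x = 0\<^sub>v a"
    proof (rule eq_vecI)
      fix k assume "k < dim_vec (0\<^sub>v a :: 'k vec)"
      hence k: "k < a" by simp
      have "(r *\<^sub>v x) $ k = (?R *\<^sub>v x) $ k" using k x(1) r by (simp add: scalar_prod_def)
      thus "(r *\<^sub>v x) $ k = 0\<^sub>v a $ k" using R[of k] k by simp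
    qed (use r in simp)
    have gx: "g *\<^sub>v x = 0\<^sub>v b"
    proof (rule eq_vecI)
      fix k assume "k < dim_vec (0\<^sub>v b :: 'k vec)"
      hence k: "k < b" by simp
      have "(g *\<^sub>v x) $ k = (?R *\<^sub>v x) $ (a + k)" using k x(1) g by (simp add: scalar_prod_def)
      thus "(g *\<^sub>v x) $ k = 0\<^sub>v b $ k" using R[of "a + k"] k by simp
    qed (use g in simp)
    have "x = (f * r + s * g) *\<^sub>v x" unfolding one using x(1) by simp
    also have "\<dots> = (f * r) *\<^sub>v x + (s * g) *\<^sub>v x" using f r s g x(1) by (intro add_mult_distrib_mat_vec) auto
    also have "\<dots> = f *\<^sub>v (r *\<^sub>v x) + s *\<^sub>v (g *\<^sub>v x)" using f r s g x(1) by simp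
    also have "\<dots> = 0\<^sub>v m" unfolding rx gx using f s by simp
    finally show "x = 0\<^sub>v m" .
  qed simp
qed

lemma valid_dsum:
  "valid_rep adj sk M \<Longrightarrow> valid_rep adj sk N \<Longrightarrow> valid_rep adj sk (dsum M N)"
proof -
  assume M: "valid_rep adj sk M" and N: "valid_rep adj sk N"
  have "support (dsum M N) \<subseteq> support M \<union> support N" by (auto simp: support_def dsum_def)
  moreover have "finite (support M \<union> support N)" using M N by (simp add: valid_rep_def)
  ultimately have "finite (support (dsum M N))" by (rule finite_subset)
  thus ?thesis using M N unfolding valid_rep_def by (auto simp: dsum_def)
qed

context almost_split
begin

lemma dim_E_le: "dimv E a \<le> dimv X a + dimv Z a"
  by (rule dim_le_if_sum_one[of "f a" _ _ "r a" "s a" _ "g a"]) (auto simp: fr_sg)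

text \<open>Injectivity of v is recorded by left inverses, that is, right inverses of the transpose.
  If u were injective and v surjective, X_a and Z_a would have dimension at most that of Y_a, so dim
  Y'_a = dim E_a - dim Y_a \<le> dim Y_a at every vertex, against the lengths. Two surjective maps
  are two injective ones for the dual sequence, whose sigma orbit is the dual of the sigma^- orbit
  of Y.\<close>

lemma pf_and_gi_transpose_right_invertible:
  assumes boundary: "\<And>F. finite F \<Longrightarrow> F \<noteq> {} \<Longrightarrow> \<exists>b\<in>F. \<exists>c. adj c b \<and> c \<notin> F"
    and reg: "regular_rep adj sk Y" and len: "rep_length Y < rep_length Y'"
    and dimE: "\<And>a. dimv E a = dimv Y a + dimv Y' a"
  shows "right_invertible (\<lambda>a. p a * f a) \<and> right_invertible (\<lambda>a. (g a * i a)\<^sup>T)"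
proof -
  interpret D: almost_split adj "\<lambda>v. \<not> sk v" "dual Z" "dual E" "dual X" "dual Y" "dual Y'"
    "\<lambda>a. (g a)\<^sup>T" "\<lambda>a. (f a)\<^sup>T" "\<lambda>a. (s a)\<^sup>T" "\<lambda>a. (r a)\<^sup>T" "\<lambda>a. (p a)\<^sup>T" "\<lambda>a. (i a)\<^sup>T" "\<lambda>a. (p' a)\<^sup>T" "\<lambda>a. (i' a)\<^sup>T"
    by (rule dual_almost_split)
  have tr: "(\<lambda>a. (i a)\<^sup>T * (g a)\<^sup>T) = (\<lambda>a. (g a * i a)\<^sup>T)" "(\<lambda>a. (f a)\<^sup>T * (p a)\<^sup>T) = (\<lambda>a. (p a * f a)\<^sup>T)"
    by (auto simp: transpose_mult_dim)
  note D1 = D.pf_inj_or_right_invertible[unfolded tr]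
  have r1: "\<exists>N. sigma_pow adj sk t Y N \<and> nonzero_rep N" for t
    using reg unfolding regular_rep_def by blast
  have bip': "bipartite adj sk" by unfold_locales
  have r2: "\<exists>N. sigma_pow adj (\<lambda>v. \<not> sk v) t (dual Y) N \<and> nonzero_rep N" for t
  proof -
    obtain N where "sigma_minus_pow adj sk t Y N" "nonzero_rep N" using reg unfolding regular_rep_def by blast
    thus ?thesis using sigma_minus_pow_dual[OF bip'] by (intro exI[of _ "dual N"]) auto
  qed
  have uncollapse: "inj_family (\<lambda>a. g a * i a)" if "right_invertible (\<lambda>a. (g a * i a)\<^sup>T)"
    using inj_family_transpose[OF that] by simp
  have "\<not> (inj_family (\<lambda>a. p a * f a) \<and> inj_family (\<lambda>a. (g a * i a)\<^sup>T))"
  proof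
    assume *: "inj_family (\<lambda>a. p a * f a) \<and> inj_family (\<lambda>a. (g a * i a)\<^sup>T)"
    have le: "dimv Y' a \<le> dimv Y a" for a
      using inj_family_dim[OF conjunct1[OF *], of a] inj_family_dim[OF conjunct2[OF *], of a] dim_E_le[of a] dimE[of a] by simp
    have "rep_length Y' \<le> (\<Sum>a\<in>support Y'. dimv Y a)" unfolding rep_length_def by (rule sum_mono) (rule le)
    also have "\<dots> \<le> rep_length Y" unfolding rep_length_def
    proof (rule sum_mono2)
      show "support Y' \<subseteq> support Y"
      proof
        fix a assume "a \<in> support Y'"
        thus "a \<in> support Y" using le[of a] by (simp add: support_def)
      qed
    qed (use valid(4) in \<open>auto simp: valid_rep_def\<close>)
    finally show False using len by simp
  qed
  moreover have "\<not> (inj_family (\<lambda>a. p a * f a) \<and> inj_family (\<lambda>a. g a * i a))"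
    using not_both_inj[OF boundary _ _ r1] by blast
  moreover have "\<not> (right_invertible (\<lambda>a. p a * f a) \<and> inj_family (\<lambda>a. (g a * i a)\<^sup>T))"
  proof
    assume *: "right_invertible (\<lambda>a. p a * f a) \<and> inj_family (\<lambda>a. (g a * i a)\<^sup>T)"
    show False
      by (rule D.not_both_inj[OF boundary _ _ r2]) (use * inj_family_transpose in \<open>auto simp: tr\<close>)
  qed
  ultimately show ?thesis using D1 pf_inj_or_right_invertible uncollapse by blast
qed

text \<open>Where Y' vanishes, i p is the identity of E, so v u = g i p f = g f = 0. As u has a
  right inverse, v would be zero on Y_a.\<close>

lemma support_Y_subset:
  assumes u: "right_invertible (\<lambda>a. p a * f a)" and v: "inj_family (\<lambda>a. g a * i a)" and Y: "dimv Y a \<noteq> 0"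
  shows "dimv Y' a \<noteq> 0"
proof
  assume Y'0: "dimv Y' a = 0"
  obtain t where t: "t \<in> carrier_mat (dimv X a) (dimv Y a)" "p a * f a * t = 1\<^sub>m (dimv Y a)"
    using u unfolding right_invertible_def by fastforce
  have [simp]: "dim_row t = dimv X a" "dim_col t = dimv Y a" using t(1) by auto
  have "i' a * p' a = 0\<^sub>m (dimv E a) (dimv E a)" using Y'0 by (auto simp: scalar_prod_def)
  hence ipE: "i a * p a = 1\<^sub>m (dimv E a)" using ip[of a] by (auto simp: mat_eq_iff)
  have "g a * i a = g a * i a * (p a * f a * t)" unfolding t(2) by simp
  also have "\<dots> = g a * ((i a * p a) * (f a * t))" by (simp add: mat_ring)
  also have "\<dots> = (g a * f a) * t" unfolding ipE by (simp add: mat_ring)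
  also have "\<dots> = 0\<^sub>m (dimv Z a) (dimv Y a)" unfolding gf by simp
  finally have gi0: "g a * i a = 0\<^sub>m (dimv Z a) (dimv Y a)" .
  have "g a * i a *\<^sub>v unit_vec (dimv Y a) 0 = 0\<^sub>v (dimv Z a)" unfolding gi0 using Y by (intro eq_vecI) auto
  from inj_familyD[OF v _, of "unit_vec (dimv Y a) 0" a] this Y show False by simp
qed

text \<open>Supplies the vector z for \<open>extension_support\<close>: the image under v of a
  nonzero element of Y_b. It is nonzero by injectivity and killed on the way to c since Y_c =
  0.\<close>

lemma source_end_extension:
  assumes v: "inj_family (\<lambda>a. g a * i a)" and c: "sk c" "adj c b" "adj c e" "b \<noteq> e"
    and Y: "dimv Y b \<noteq> 0" "dimv Y c = 0"
  shows "dimv E c \<noteq> 0 \<and> dimv E e \<noteq> 0"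
proof (rule extension_support[OF c(2,3,1,4)])
  let ?y = "unit_vec (dimv Y b) 0 :: 'k vec"
  let ?z = "g b * i b *\<^sub>v ?y"
  show "?z \<in> carrier_vec (dimv Z b)" by (rule carrier_vecI) simp
  show "?z \<noteq> 0\<^sub>v (dimv Z b)"
  proof
    assume "?z = 0\<^sub>v (dimv Z b)"
    with inj_familyD[OF v, of ?y b] Y(1) show False by simp
  qed
  note [simp] = valid_dim[OF valid(3) c(2,1)] valid_dim[OF valid(4) c(2,1)]
  have "mapv Z c b *\<^sub>v ?z = (mapv Z c b * (g b * i b)) *\<^sub>v ?y" by (rule mult_mat_vec_assoc_dim[symmetric]) simp_all
  also have "\<dots> = (g c * i c) *\<^sub>v (mapv Y c b *\<^sub>v ?y)"
    unfolding morph_eq[OF gi_morph c(2,1)] by (rule mult_mat_vec_assoc_dim) simp_all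
  also have "mapv Y c b *\<^sub>v ?y = 0\<^sub>v (dimv Y c)" using Y(2) by (intro eq_vecI) simp_all
  finally show "mapv Z c b *\<^sub>v ?z = 0\<^sub>v (dimv Z c)" by simp
qed

text \<open>For the second claim, Y'_a is nonzero only if X_a or Z_a is, and the bound for Z is the
  dual of that for X. In the third, the case that c is a source is the dual of the case of a
  sink.\<close>

lemma eta_support:
  assumes boundary: "\<And>F. finite F \<Longrightarrow> F \<noteq> {} \<Longrightarrow> \<exists>b\<in>F. \<exists>c. adj c b \<and> c \<notin> F"
    and reg: "regular_rep adj sk Y" and len: "rep_length Y < rep_length Y'"
    and dimE: "\<And>a. dimv E a = dimv Y a + dimv Y' a"
  shows "support Y \<subseteq> support Y'"
    and "a \<in> support Y' \<Longrightarrow> \<exists>b c. (b = a \<or> adj a b) \<and> (c = b \<or> adj b c) \<and> c \<in> support Y"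
    and "b \<in> support Y \<Longrightarrow> adj b c \<Longrightarrow> c \<notin> support Y \<Longrightarrow> adj c e \<Longrightarrow> b \<noteq> e \<Longrightarrow> c \<in> support Y' \<and> e \<in> support Y'"
proof -
  interpret D: almost_split adj "\<lambda>v. \<not> sk v" "dual Z" "dual E" "dual X" "dual Y" "dual Y'"
    "\<lambda>a. (g a)\<^sup>T" "\<lambda>a. (f a)\<^sup>T" "\<lambda>a. (s a)\<^sup>T" "\<lambda>a. (r a)\<^sup>T" "\<lambda>a. (p a)\<^sup>T" "\<lambda>a. (i a)\<^sup>T" "\<lambda>a. (p' a)\<^sup>T" "\<lambda>a. (i' a)\<^sup>T"
    by (rule dual_almost_split)
  have tr: "(\<lambda>a. (f a)\<^sup>T * (p a)\<^sup>T) = (\<lambda>a. (p a * f a)\<^sup>T)" by (auto simp: transpose_mult_dim)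
  from pf_and_gi_transpose_right_invertible[OF boundary reg len dimE]
  have u: "right_invertible (\<lambda>a. p a * f a)" and vT: "right_invertible (\<lambda>a. (g a * i a)\<^sup>T)" by auto
  have v: "inj_family (\<lambda>a. g a * i a)" using inj_family_transpose[OF vT] by simp
  have uT: "inj_family (\<lambda>a. (f a)\<^sup>T * (p a)\<^sup>T)" using inj_family_transpose[OF u] unfolding tr .
  show sub: "support Y \<subseteq> support Y'" using support_Y_subset[OF u v] by (auto simp: support_def)
  show "\<exists>b c. (b = a \<or> adj a b) \<and> (c = b \<or> adj b c) \<and> c \<in> support Y" if a: "a \<in> support Y'"
  proof -
    have "dimv X a \<noteq> 0 \<or> dimv Z a \<noteq> 0" using a dimE[of a] dim_E_le[of a] by (auto simp: support_def)
    thus ?thesis using support_X_near[of a] D.support_X_near[of a] by (auto simp: support_def)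
  qed
  show "c \<in> support Y' \<and> e \<in> support Y'"
    if bc: "b \<in> support Y" "adj b c" "c \<notin> support Y" "adj c e" "b \<noteq> e"
  proof -
    have cb: "adj c b" using sym bc by blast
    have Y: "dimv Y b \<noteq> 0" "dimv Y c = 0" using bc by (auto simp: support_def)
    have "dimv E c \<noteq> 0 \<and> dimv E e \<noteq> 0"
    proof (cases "sk c")
      case True
      thus ?thesis using source_end_extension[OF v True cb bc(4,5) Y] by blast
    next
      case False
      thus ?thesis using D.source_end_extension[OF uT False cb bc(4,5)] Y by simp
    qed
    \<comment> \<open>At c the summand Y vanishes, so E_c is Y'_c. At e it may be Y that is nonzero,
      and then the inclusion of supports gives Y'.\<close>
    thus ?thesis using dimE[of c] dimE[of e] Y(2) sub by (auto simp: support_def)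
  qed
qed

end

section \<open>Splitting data of an Auslander-Reiten sequence\<close>

context bipartite
begin

lemma almost_split_of_eta:
  fixes X E Z Y Y' :: "('v, 'k::field) rep"
  assumes ar: "AR_sequence adj sk X E Z f g" and iso: "rep_iso adj sk E (dsum Y Y')"
    and Y: "valid_rep adj sk Y" "valid_rep adj sk Y'" "nonzero_rep Y"
  obtains r s i p i' p' where "almost_split adj sk X E Z Y Y' f g r s i p i' p'" "\<forall>a. dimv E a = dimv Y a + dimv Y' a"
proof -
  note ar' = ar[unfolded AR_sequence_def short_exact_def]
  have valid: "valid_rep adj sk X" "valid_rep adj sk E" "valid_rep adj sk Z"
    and f: "morph adj sk X E f" and g: "morph adj sk E Z g"
    and left: "left_almost_split adj sk X E f" and right: "right_almost_split adj sk E Z g"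
    and finj: "\<And>a u. u \<in> carrier_vec (dimv X a) \<Longrightarrow> f a *\<^sub>v u = 0\<^sub>v (dimv E a) \<Longrightarrow> u = 0\<^sub>v (dimv X a)"
    and gsurj: "\<And>a w. w \<in> carrier_vec (dimv Z a) \<Longrightarrow> \<exists>v\<in>carrier_vec (dimv E a). g a *\<^sub>v v = w"
    and ex: "\<And>a v. v \<in> carrier_vec (dimv E a) \<Longrightarrow> g a *\<^sub>v v = 0\<^sub>v (dimv Z a) \<longleftrightarrow> (\<exists>u\<in>carrier_vec (dimv X a). f a *\<^sub>v u = v)"
    using ar' by blast+
  note [simp] = morph_dim[OF f] morph_dim[OF g]
  have gC: "g a \<in> carrier_mat (dimv Z a) (dimv E a)" for a by (intro carrier_matI) simp_all
  have fC: "f a \<in> carrier_mat (dimv E a) (dimv X a)" for a by (intro carrier_matI) simp_all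
  have "\<exists>s. s \<in> carrier_mat (dimv E a) (dimv Z a) \<and> g a * s = 1\<^sub>m (dimv Z a)" for a
    using right_inverse_if_surj[OF gC[of a] gsurj[of _ a]] by blast
  then obtain s where s: "\<And>a. s a \<in> carrier_mat (dimv E a) (dimv Z a)" "\<And>a. g a * s a = 1\<^sub>m (dimv Z a)" by metis
  have [simp]: "dim_row (s a) = dimv E a" "dim_col (s a) = dimv Z a" for a using s(1)[of a] by auto
  have gf: "g a * f a = 0\<^sub>m (dimv Z a) (dimv X a)" for a
  proof (rule mat_eq_colI)
    fix j assume "j < dim_col (0\<^sub>m (dimv Z a) (dimv X a) :: 'k mat)"
    hence j: "j < dimv X a" by simp
    have "f a *\<^sub>v unit_vec (dimv X a) j = col (f a) j" using mult_mat_vec_unit[of j "f a"] j by simp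
    hence "\<exists>u\<in>carrier_vec (dimv X a). f a *\<^sub>v u = col (f a) j" by (intro bexI[of _ "unit_vec (dimv X a) j"]) auto
    hence "g a *\<^sub>v col (f a) j = 0\<^sub>v (dimv Z a)" using ex[of "col (f a) j" a] fC[of a] j by auto
    thus "col (g a * f a) j = col (0\<^sub>m (dimv Z a) (dimv X a)) j" using j by (subst col_mult_dim) auto
  qed simp_all
  have "\<exists>r. r \<in> carrier_mat (dimv X a) (dimv E a) \<and> f a * r = 1\<^sub>m (dimv E a) - s a * g a" for a
  proof -
    \<comment> \<open>The projection to the kernel of g along s. By exactness its columns come from
      X, and this defines r through f r = 1 - s g; the relations for r f and r s follow by
      cancelling the injective f.\<close>
    let ?T = "1\<^sub>m (dimv E a) - s a * g a"
    have gT: "g a * ?T = 0\<^sub>m (dimv Z a) (dimv E a)"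
    proof -
      have "g a * ?T = g a - (g a * s a) * g a" by (simp add: mat_ring)
      thus ?thesis unfolding s(2) by (auto simp: mat_eq_iff)
    qed
    have "\<exists>u\<in>carrier_vec (dimv X a). f a *\<^sub>v u = col ?T j" if j: "j < dimv E a" for j
    proof -
      have "g a *\<^sub>v col ?T j = col (g a * ?T) j" using j by (subst col_mult_dim) auto
      also have "\<dots> = 0\<^sub>v (dimv Z a)" unfolding gT using j by simp
      finally have "g a *\<^sub>v col ?T j = 0\<^sub>v (dimv Z a)" .
      moreover have "col ?T j \<in> carrier_vec (dimv E a)" by (rule carrier_vecI) simp
      ultimately show ?thesis using ex by blast
    qed
    then obtain r where r: "r \<in> carrier_mat (dimv X a) (dimv E a)" "\<And>j. j < dimv E a \<Longrightarrow> f a *\<^sub>v col r j = col ?T j"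
      using choose_matrix_columns[of "dimv E a" "dimv X a" "\<lambda>j u. f a *\<^sub>v u = col ?T j"] by blast
    have "f a * r = ?T"
    proof (rule mat_eq_colI)
      fix j assume "j < dim_col ?T"
      thus "col (f a * r) j = col ?T j" using r by (subst col_mult_dim) auto
    qed (use r(1) in simp_all)
    thus ?thesis using r(1) by blast
  qed
  then obtain r where r: "\<And>a. r a \<in> carrier_mat (dimv X a) (dimv E a)" "\<And>a. f a * r a = 1\<^sub>m (dimv E a) - s a * g a" by metis
  have [simp]: "dim_row (r a) = dimv X a" "dim_col (r a) = dimv E a" for a using r(1)[of a] by auto
  have f_cancel: "A = B" if "dim_row A = dimv X a" "dim_row B = dimv X a" "dim_col A = dim_col B" "f a * A = f a * B" for A B a
  proof (rule mat_eq_colI)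
    fix j assume j: "j < dim_col B"
    have "f a *\<^sub>v (col A j - col B j) = f a *\<^sub>v col A j - f a *\<^sub>v col B j"
      by (rule mult_minus_distrib_mat_vec[OF fC]) (auto intro!: carrier_vecI simp: that)
    also have "\<dots> = col (f a * A) j - col (f a * B) j" using j that(1-3) by (subst (1 2) col_mult_dim) auto
    also have "\<dots> = 0\<^sub>v (dimv E a)" unfolding that(4) by (intro eq_vecI) (use j in auto)
    finally have "col A j - col B j = 0\<^sub>v (dimv X a)" by (rule finj[rotated]) (auto intro!: carrier_vecI simp: that)
    thus "col A j = col B j" using that j by (auto simp: vec_eq_iff)
  qed (use that in auto)
  have fr_sg: "f a * r a + s a * g a = 1\<^sub>m (dimv E a)" for a unfolding r(2) by (auto simp: mat_eq_iff)
  have rf: "r a * f a = 1\<^sub>m (dimv X a)" for a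
  proof (rule f_cancel)
    have "f a * (r a * f a) = (f a * r a) * f a" by (simp add: mat_ring)
    also have "\<dots> = f a - s a * (g a * f a)" unfolding r(2) by (simp add: mat_ring)
    also have "\<dots> = f a * 1\<^sub>m (dimv X a)" unfolding gf by (auto simp: mat_eq_iff)
    finally show "f a * (r a * f a) = f a * 1\<^sub>m (dimv X a)" .
  qed simp_all
  have rs: "r a * s a = 0\<^sub>m (dimv X a) (dimv Z a)" for a
  proof (rule f_cancel)
    have "f a * (r a * s a) = (f a * r a) * s a" by (simp add: mat_ring)
    also have "\<dots> = s a - s a * (g a * s a)" unfolding r(2) by (simp add: mat_ring)
    also have "\<dots> = f a * 0\<^sub>m (dimv X a) (dimv Z a)" unfolding s(2) by (auto simp: mat_eq_iff)
    finally show "f a * (r a * s a) = f a * 0\<^sub>m (dimv X a) (dimv Z a)" .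
  qed simp_all
  obtain \<alpha> \<beta> where \<alpha>: "morph adj sk E (dsum Y Y') \<alpha>" and \<beta>: "morph adj sk (dsum Y Y') E \<beta>"
    and \<beta>\<alpha>: "\<And>a. \<beta> a * \<alpha> a = 1\<^sub>m (dimv E a)" and \<alpha>\<beta>: "\<And>a. \<alpha> a * \<beta> a = 1\<^sub>m (dimv (dsum Y Y') a)"
    using iso unfolding rep_iso_def by blast
  have dd: "dimv (dsum Y Y') a = dimv Y a + dimv Y' a" for a by (simp add: dsum_def)
  have \<alpha>C: "\<alpha> a \<in> carrier_mat (dimv (dsum Y Y') a) (dimv E a)" and \<beta>C: "\<beta> a \<in> carrier_mat (dimv E a) (dimv (dsum Y Y') a)" for a
    using \<alpha> \<beta> by (auto simp: morph_def)
  \<comment> \<open>The two mutually inverse matrices bound the dimensions in both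
    directions.\<close>
  have dimE: "dimv E a = dimv Y a + dimv Y' a" for a
    using dim_le_if_one_sided_inverse[OF \<alpha>C \<beta>C \<alpha>\<beta>] dim_le_if_one_sided_inverse[OF \<beta>C \<alpha>C \<beta>\<alpha>] dd[of a] by (metis le_antisym)
  note [simp] = morph_dim[OF \<alpha>, unfolded dd] morph_dim[OF \<beta>, unfolded dd]
  have vd: "valid_rep adj sk (dsum Y Y')" by (rule valid_dsum[OF Y(1,2)])
  let ?d = "\<lambda>a. dimv Y a + dimv Y' a"
  let ?p1 = "\<lambda>a. rect_id (dimv Y a) (?d a) :: 'k mat" and ?i1 = "\<lambda>a. rect_id (?d a) (dimv Y a) :: 'k mat"
  let ?p2 = "\<lambda>a. mat (dimv Y' a) (?d a) (\<lambda>(i,j). if j = dimv Y a + i then 1 else 0) :: 'k mat"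
  have p1: "morph adj sk (dsum Y Y') Y ?p1"
  proof (rule morphI)
    fix a b assume ab: "adj a b" "sk a"
    note [simp] = valid_dim[OF Y(1) ab] valid_dim[OF Y(2) ab] valid_dim[OF vd ab, unfolded dd]
    show "mapv Y a b * ?p1 b = ?p1 a * mapv (dsum Y Y') a b"
    proof (rule eq_matI)
      fix k l assume "k < dim_row (?p1 a * mapv (dsum Y Y') a b)" "l < dim_col (?p1 a * mapv (dsum Y Y') a b)"
      hence kl: "k < dimv Y a" "l < ?d b" by simp_all
      have "(mapv Y a b * ?p1 b) $$ (k,l) = (if l < dimv Y b then mapv Y a b $$ (k,l) else 0)"
        by (rule mult_rect_id) (use kl in simp_all)
      moreover have "(?p1 a * mapv (dsum Y Y') a b) $$ (k,l) = (if k < ?d a then mapv (dsum Y Y') a b $$ (k,l) else 0)"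
        by (rule rect_id_mult) (use kl in simp_all)
      ultimately show "(mapv Y a b * ?p1 b) $$ (k,l) = (?p1 a * mapv (dsum Y Y') a b) $$ (k,l)"
        using kl by (simp add: dsum_def)
    qed simp_all
  qed (simp_all add: dd)
  have i1: "morph adj sk Y (dsum Y Y') ?i1"
  proof (rule morphI)
    fix a b assume ab: "adj a b" "sk a"
    note [simp] = valid_dim[OF Y(1) ab] valid_dim[OF Y(2) ab] valid_dim[OF vd ab, unfolded dd]
    show "mapv (dsum Y Y') a b * ?i1 b = ?i1 a * mapv Y a b"
    proof (rule eq_matI)
      fix k l assume "k < dim_row (?i1 a * mapv Y a b)" "l < dim_col (?i1 a * mapv Y a b)"
      hence kl: "k < ?d a" "l < dimv Y b" by simp_all
      have "(mapv (dsum Y Y') a b * ?i1 b) $$ (k,l) = (if l < ?d b then mapv (dsum Y Y') a b $$ (k,l) else 0)"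
        by (rule mult_rect_id) (use kl in simp_all)
      moreover have "(?i1 a * mapv Y a b) $$ (k,l) = (if k < dimv Y a then mapv Y a b $$ (k,l) else 0)"
        by (rule rect_id_mult) (use kl in simp_all)
      ultimately show "(mapv (dsum Y Y') a b * ?i1 b) $$ (k,l) = (?i1 a * mapv Y a b) $$ (k,l)"
        using kl by (simp add: dsum_def)
    qed simp_all
  qed (simp_all add: dd)
  have sum1: "?i1 a * ?p1 a + (?p2 a)\<^sup>T * ?p2 a = 1\<^sub>m (?d a)" for a
  proof (rule eq_matI)
    fix k l assume "k < dim_row (1\<^sub>m (?d a) :: 'k mat)" "l < dim_col (1\<^sub>m (?d a) :: 'k mat)"
    hence kl: "k < ?d a" "l < ?d a" by simp_all
    have 1: "(?i1 a * ?p1 a) $$ (k,l) = (if k < dimv Y a \<and> k = l then 1 else 0)"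
      using rect_id_mult[of k "?d a" l "?p1 a" "dimv Y a"] kl by (auto simp: rect_id_def simp del: index_mult_mat(1))
    have "((?p2 a)\<^sup>T * ?p2 a) $$ (k,l) = (\<Sum>m<dimv Y' a. (if k = dimv Y a + m then 1 else 0) * (if l = dimv Y a + m then 1 else 0))"
      using kl by (simp add: scalar_prod_def atLeast0LessThan)
    also have "\<dots> = (\<Sum>m<dimv Y' a. if m = k - dimv Y a then (if \<not> k < dimv Y a \<and> k = l then 1 else 0) else 0)"
      by (rule sum.cong) auto
    also have "\<dots> = (if \<not> k < dimv Y a \<and> k = l then 1 else 0)" using kl by auto
    finally show "(?i1 a * ?p1 a + (?p2 a)\<^sup>T * ?p2 a) $$ (k,l) = 1\<^sub>m (?d a) $$ (k,l)" using 1 kl by (simp del: index_mult_mat(1))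
  qed simp_all
  show ?thesis
  proof (rule that)
    show "almost_split adj sk X E Z Y Y' f g r s (\<lambda>a. \<beta> a * ?i1 a) (\<lambda>a. ?p1 a * \<alpha> a) (\<lambda>a. \<beta> a * (?p2 a)\<^sup>T) (\<lambda>a. ?p2 a * \<alpha> a)"
    proof (unfold_locales)
      show "morph adj sk Y E (\<lambda>a. \<beta> a * ?i1 a)" by (rule morph_comp[OF Y(1) vd valid(2) i1 \<beta>])
      show "morph adj sk E Y (\<lambda>a. ?p1 a * \<alpha> a)" by (rule morph_comp[OF valid(2) vd Y(1) \<alpha> p1])
      fix a
      have "?p1 a * \<alpha> a * (\<beta> a * ?i1 a) = ?p1 a * (\<alpha> a * \<beta> a) * ?i1 a" by (simp add: mat_ring)
      thus "?p1 a * \<alpha> a * (\<beta> a * ?i1 a) = 1\<^sub>m (dimv Y a)" unfolding \<alpha>\<beta> dd by (simp add: rect_id_retract)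
      have "\<beta> a * ?i1 a * (?p1 a * \<alpha> a) + \<beta> a * (?p2 a)\<^sup>T * (?p2 a * \<alpha> a) = \<beta> a * (?i1 a * ?p1 a + (?p2 a)\<^sup>T * ?p2 a) * \<alpha> a"
        by (simp add: mat_ring)
      thus "\<beta> a * ?i1 a * (?p1 a * \<alpha> a) + \<beta> a * (?p2 a)\<^sup>T * (?p2 a * \<alpha> a) = 1\<^sub>m (dimv E a)"
        unfolding sum1 by (simp add: \<beta>\<alpha>)
    qed (use valid Y f g left right rf s(2) fr_sg gf rs in simp_all)
  qed (simp add: dimE)
qed

end

section \<open>From supports to diameter, center and type\<close>

context tree
begin

text \<open>Let A be the component of x in the support. No arrow joins A to the rest of the support,
  so M is the direct sum of its restrictions to A and to the complement of A. At every vertex one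
  summand is zero, hence identity matrices give the isomorphism.\<close>

lemma indecomposable_conn:
  fixes M :: "('v, 'k::field) rep"
  assumes M: "indecomposable adj sk M"
  shows "conn (support M)"
proof (rule ccontr)
  assume "\<not> conn (support M)"
  then obtain x y where x: "x \<in> support M" and y: "y \<in> support M"
    and no: "\<And>ws. successively adj ws \<Longrightarrow> ws \<noteq> [] \<Longrightarrow> hd ws = x \<Longrightarrow> set ws \<subseteq> support M \<Longrightarrow> last ws \<noteq> y"
    unfolding conn_def by blast
  have valid: "valid_rep adj sk M" using M by (simp add: indecomposable_def)
  define A where "A = {z. \<exists>ws. successively adj ws \<and> ws \<noteq> [] \<and> hd ws = x \<and> last ws = z \<and> set ws \<subseteq> support M}"
  have xA: "x \<in> A" unfolding A_def using x by (intro CollectI exI[of _ "[x]"]) auto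
  have yA: "y \<notin> A" unfolding A_def using no by blast
  have AS: "a \<in> support M" if "a \<in> A" for a using that by (auto simp: A_def)
  have closed: "b \<in> A" if ab: "a \<in> A" "adj a b" "b \<in> support M" for a b
  proof -
    obtain ws where "successively adj ws" "ws \<noteq> []" "hd ws = x" "last ws = a" "set ws \<subseteq> support M"
      using ab(1) by (auto simp: A_def)
    thus ?thesis unfolding A_def using ab by (intro CollectI exI[of _ "ws @ [b]"]) (auto simp: successively_append_iff)
  qed
  define R :: "'v set \<Rightarrow> ('v, 'k) rep" where "R B = \<lparr>dimv = (\<lambda>a. if a \<in> B then dimv M a else 0),
    mapv = (\<lambda>a b. mat (if a \<in> B then dimv M a else 0) (if b \<in> B then dimv M b else 0) (\<lambda>ij. mapv M a b $$ ij))\<rparr>" for B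
  have R: "valid_rep adj sk (R B)" for B
  proof -
    have "support (R B) \<subseteq> support M" by (auto simp: support_def R_def split: if_splits)
    hence "finite (support (R B))" using valid finite_subset by (auto simp: valid_rep_def)
    thus ?thesis by (simp add: valid_rep_def) (simp add: R_def)
  qed
  have dd: "dimv (dsum (R A) (R (- A))) a = dimv M a" for a by (simp add: dsum_def R_def)
  have maps: "mapv (dsum (R A) (R (- A))) a b = mapv M a b" if ab: "adj a b" "sk a" for a b
  proof (rule eq_matI)
    show "dim_row (mapv (dsum (R A) (R (- A))) a b) = dim_row (mapv M a b)" "dim_col (mapv (dsum (R A) (R (- A))) a b) = dim_col (mapv M a b)"
      using valid_dim[OF valid ab] by (simp_all add: dsum_def R_def)
    fix k l assume "k < dim_row (mapv M a b)" "l < dim_col (mapv M a b)"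
    hence kl: "k < dimv M a" "l < dimv M b" using valid_dim[OF valid ab] by simp_all
    hence "a \<in> support M" "b \<in> support M" by (auto simp: support_def)
    hence "a \<in> A \<longleftrightarrow> b \<in> A" using closed ab(1) adj_sym by blast
    thus "mapv (dsum (R A) (R (- A))) a b $$ (k,l) = mapv M a b $$ (k,l)" using kl by (auto simp: dsum_def R_def)
  qed
  have one: "morph adj sk M M (\<lambda>a. 1\<^sub>m (dimv M a))" by (rule morph_one[OF valid])
  have "morph adj sk M (dsum (R A) (R (- A))) (\<lambda>a. 1\<^sub>m (dimv M a))" "morph adj sk (dsum (R A) (R (- A))) M (\<lambda>a. 1\<^sub>m (dimv M a))"
    using one maps unfolding morph_def dd by auto
  hence "rep_iso adj sk M (dsum (R A) (R (- A)))" unfolding rep_iso_def dd by (intro exI[of _ "\<lambda>a. 1\<^sub>m (dimv M a)"]) simp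
  hence "\<not> nonzero_rep (R A) \<or> \<not> nonzero_rep (R (- A))" using M R unfolding indecomposable_def by blast
  moreover have "nonzero_rep (R A)" using xA x by (auto simp: nonzero_rep_def R_def support_def)
  moreover have "nonzero_rep (R (- A))" using yA y by (auto simp: nonzero_rep_def R_def support_def)
  ultimately show False by blast
qed

lemma bipartite_along_path:
  assumes bip: "bipartite_orientation adj sk" and xs: "nb_list adj xs" and k: "k < length xs"
  shows "sk (xs ! k) \<longleftrightarrow> (sk (hd xs) \<longleftrightarrow> even k)"
  using k
proof (induction k)
  case 0
  thus ?case using nb_list_not_Nil[OF xs] by (simp add: hd_conv_nth)
next
  case (Suc k)
  have "adj (xs ! k) (xs ! Suc k)" using xs Suc.prems unfolding nb_list_iff by simp
  hence "sk (xs ! k) \<longleftrightarrow> \<not> sk (xs ! Suc k)" using bip unfolding bipartite_orientation_def by blast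
  thus ?case using Suc by auto
qed

text \<open>Reduces statements about all diameter paths to the single path \<gamma>. Diameter paths
  share their center, and sinks alternate with sources; so for even length the common middle vertex
  determines the type of both ends, while for odd length the two ends have different types.\<close>

lemma longest_path_invariants:
  fixes M :: "('v, 'k) rep"
  assumes bip: "bipartite_orientation adj sk" and S: "conn (support M)"
    and g: "nb_list adj \<gamma>" "set \<gamma> \<subseteq> support M"
    and max: "\<And>ys. nb_list adj ys \<Longrightarrow> set ys \<subseteq> support M \<Longrightarrow> length ys \<le> length \<gamma>"
  shows "diameter adj M = plen \<gamma>" "center adj M = path_center \<gamma>"
    "sink_module adj sk M \<longleftrightarrow> even (plen \<gamma>) \<and> sk (hd \<gamma>)" "source_module adj sk M \<longleftrightarrow> even (plen \<gamma>) \<and> \<not> sk (hd \<gamma>)"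
proof -
  have le: "plen ys \<le> plen \<gamma>" if "nb_path adj (support M) ys" for ys
    using max[of ys] that by (auto simp: nb_path_iff plen_def)
  have "finite {plen xs | xs. nb_path adj (support M) xs}"
    by (rule finite_subset[of _ "{..plen \<gamma>}"]) (use le in auto)
  thus diam: "diameter adj M = plen \<gamma>"
    unfolding diameter_def by (rule Max_eqI) (use le g in \<open>auto simp: nb_path_iff\<close>)
  have dp: "diameter_path adj M xs \<longleftrightarrow> nb_list adj xs \<and> set xs \<subseteq> support M \<and> length xs = length \<gamma>" for xs
    unfolding diameter_path_def diam nb_path_iff using nb_list_not_Nil[OF g(1)] nb_list_not_Nil[of adj xs]
    by (cases xs; cases \<gamma>) (auto simp: plen_def)
  have ctr: "path_center xs = path_center \<gamma>" if "diameter_path adj M xs" for xs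
    using center_unique[OF S g _ _ _ max] that unfolding dp by blast
  have dg: "diameter_path adj M \<gamma>" unfolding dp using g by simp
  show "center adj M = path_center \<gamma>" unfolding center_def by (rule ctr) (rule someI[of _ \<gamma>], rule dg)
  have last: "sk (last xs) \<longleftrightarrow> (sk (hd xs) \<longleftrightarrow> even (plen xs))" if "nb_list adj xs" for xs
    using bipartite_along_path[OF bip that, of "plen xs"] nb_list_not_Nil[OF that]
    by (simp add: last_conv_nth plen_def)
  have hd: "sk (hd xs) = sk (hd \<gamma>)" "plen xs = plen \<gamma>" "nb_list adj xs" if xs: "diameter_path adj M xs" and e: "even (plen \<gamma>)" for xs
  proof -
    let ?m = "plen \<gamma> div 2"
    show p: "plen xs = plen \<gamma>" and nb: "nb_list adj xs" using xs unfolding dp by (auto simp: plen_def)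
    have m: "?m < length xs" "?m < length \<gamma>" using xs nb_list_not_Nil[OF g(1)] unfolding dp plen_def
      by (auto intro: le_less_trans[OF div_le_dividend])
    have "xs ! ?m = \<gamma> ! ?m" using ctr[OF xs] e unfolding path_center_def p by auto
    thus "sk (hd xs) = sk (hd \<gamma>)" using bipartite_along_path[OF bip nb m(1)] bipartite_along_path[OF bip g(1) m(2)] by auto
  qed
  show "sink_module adj sk M \<longleftrightarrow> even (plen \<gamma>) \<and> sk (hd \<gamma>)"
  proof (intro iffI)
    assume "sink_module adj sk M"
    hence "sk (hd \<gamma>) \<and> sk (last \<gamma>)" using dg unfolding sink_module_def by blast
    thus "even (plen \<gamma>) \<and> sk (hd \<gamma>)" using last[OF g(1)] by blast
  next
    assume e: "even (plen \<gamma>) \<and> sk (hd \<gamma>)"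
    show "sink_module adj sk M" unfolding sink_module_def
    proof (intro allI impI)
      fix xs assume xs: "diameter_path adj M xs"
      note h = hd[OF xs conjunct1[OF e]]
      show "sk (hd xs) \<and> sk (last xs)" using last[OF h(3)] h(1) e unfolding h(2) by blast
    qed
  qed
  show "source_module adj sk M \<longleftrightarrow> even (plen \<gamma>) \<and> \<not> sk (hd \<gamma>)"
  proof (intro iffI)
    assume "source_module adj sk M"
    hence "\<not> sk (hd \<gamma>) \<and> \<not> sk (last \<gamma>)" using dg unfolding source_module_def by blast
    thus "even (plen \<gamma>) \<and> \<not> sk (hd \<gamma>)" using last[OF g(1)] by blast
  next
    assume e: "even (plen \<gamma>) \<and> \<not> sk (hd \<gamma>)"
    show "source_module adj sk M" unfolding source_module_def
    proof (intro allI impI)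
      fix xs assume xs: "diameter_path adj M xs"
      note h = hd[OF xs conjunct1[OF e]]
      show "\<not> sk (hd xs) \<and> \<not> sk (last xs)" using last[OF h(3)] h(1) e unfolding h(2) by blast
    qed
  qed
qed

text \<open>Join each end of the path to S in at most two steps and connect the two feet inside S.
  The result is a walk on at most L + 4 vertices, and in a tree a path is no longer than any walk
  with the same ends.\<close>

lemma near_path_length:
  assumes S: "conn S" and max: "\<And>ys. nb_list adj ys \<Longrightarrow> set ys \<subseteq> S \<Longrightarrow> length ys \<le> L"
    and near: "\<And>a. a \<in> S' \<Longrightarrow> \<exists>b c. (b = a \<or> adj a b) \<and> (c = b \<or> adj b c) \<and> c \<in> S"
    and xs: "nb_list adj xs" "set xs \<subseteq> S'"
  shows "length xs \<le> L + 4"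
proof -
  have walk: "\<exists>us z. z \<in> S \<and> length us \<le> 2 \<and> hd (us @ [z]) = a \<and> successively adj (us @ [z])" if a: "a \<in> S'" for a
  proof -
    obtain b c where bc: "b = a \<or> adj a b" "c = b \<or> adj b c" "c \<in> S" using near[OF a] by blast
    consider "b = a" "c = b" | "b = a" "adj b c" | "adj a b" "c = b" | "adj a b" "adj b c" using bc by blast
    thus ?thesis
    proof cases
      case 1 thus ?thesis using bc(3) by (intro exI[of _ "[]"] exI[of _ c]) auto
    next
      case 2 thus ?thesis using bc(3) by (intro exI[of _ "[b]"] exI[of _ c]) auto
    next
      case 3 thus ?thesis using bc(3) by (intro exI[of _ "[a]"] exI[of _ c]) auto
    next
      case 4 thus ?thesis using bc(3) by (intro exI[of _ "[a, b]"] exI[of _ c]) auto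
    qed
  qed
  have ne: "xs \<noteq> []" by (rule nb_list_not_Nil[OF xs(1)])
  have "hd xs \<in> S'" "last xs \<in> S'" using xs(2) ne by auto
  from walk[OF this(1)] walk[OF this(2)] obtain us z vs w where
    us: "z \<in> S" "length us \<le> 2" "hd (us @ [z]) = hd xs" "successively adj (us @ [z])" and
    vs: "w \<in> S" "length vs \<le> 2" "hd (vs @ [w]) = last xs" "successively adj (vs @ [w])" by blast
  obtain \<eta> where \<eta>: "nb_list adj \<eta>" "hd \<eta> = z" "last \<eta> = w" "set \<eta> \<subseteq> S" by (rule conn_path[OF S us(1) vs(1)])
  have \<eta>ne: "\<eta> \<noteq> []" by (rule nb_list_not_Nil[OF \<eta>(1)])
  have "successively (\<lambda>x y. adj y x) (vs @ [w])" using vs(4) by (rule successively_mono) (auto intro: adj_sym)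
  hence rv: "successively adj (w # rev vs)" using successively_rev[of adj "vs @ [w]"] by simp
  have w: "successively adj (us @ \<eta> @ rev vs)"
    using us(4) rv nb_list_walk[OF \<eta>(1)] \<eta>(2,3) \<eta>ne by (auto simp: successively_append_iff successively_Cons)
  have h: "hd xs = hd (us @ \<eta> @ rev vs)" using us(3) \<eta>(2) \<eta>ne by (cases us) auto
  have l: "last xs = last (us @ \<eta> @ rev vs)" using vs(3) \<eta>(3) \<eta>ne by (cases vs) auto
  have "length xs \<le> length (us @ \<eta> @ rev vs)" by (rule shortest(1)[OF xs(1) w _ h l]) (use \<eta>ne in simp)
  thus ?thesis using us(2) vs(2) max[OF \<eta>(1,4)] by simp
qed

end

theorem theorem4:
  fixes adj :: "'v \<Rightarrow> 'v \<Rightarrow> bool" and n :: nat and sk :: "'v \<Rightarrow> bool"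
    and Y Y' :: "('v, 'k::field) rep"
  assumes "regular_tree adj n" and "n \<ge> 3"
    and "bipartite_orientation adj sk"
    and "indecomposable adj sk Y" and "regular_rep adj sk Y"
    and "is_eta adj sk Y Y'"
  shows "(sink_module adj sk Y \<longleftrightarrow> sink_module adj sk Y')
       \<and> (flow_module adj Y \<longleftrightarrow> flow_module adj Y')
       \<and> (source_module adj sk Y \<longleftrightarrow> source_module adj sk Y')
       \<and> center adj Y' = center adj Y
       \<and> radius adj Y' = radius adj Y + 2"
proof -
  interpret T: tree adj n using assms(1,2) by unfold_locales
  interpret B: bipartite adj sk
    using assms(1,3) by unfold_locales (auto simp: regular_tree_def bipartite_orientation_def)
  have Y: "valid_rep adj sk Y" "nonzero_rep Y" using assms(4) by (auto simp: indecomposable_def)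
  from assms(6) obtain X E Z f g where Y'i: "indecomposable adj sk Y'" and len: "rep_length Y < rep_length Y'"
    and ar: "AR_sequence adj sk X E Z f g" and iso: "rep_iso adj sk E (dsum Y Y')" unfolding is_eta_def by blast
  have Y': "valid_rep adj sk Y'" using Y'i by (auto simp: indecomposable_def)
  obtain r s i p i' p' where as: "almost_split adj sk X E Z Y Y' f g r s i p i' p'" and "\<forall>a. dimv E a = dimv Y a + dimv Y' a"
    by (rule B.almost_split_of_eta[OF ar iso Y(1) Y' Y(2)])
  hence dimE: "dimv E a = dimv Y a + dimv Y' a" for a by blast
  note supp = almost_split.eta_support[OF as _ assms(5) len dimE]
  have sub: "support Y \<subseteq> support Y'" by (rule supp(1)) (rule T.boundary)
  have near: "\<exists>b c. (b = a \<or> adj a b) \<and> (c = b \<or> adj b c) \<and> c \<in> support Y" if "a \<in> support Y'" for a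
    by (rule supp(2)[OF _ that]) (rule T.boundary)
  have end_ext: "c \<in> support Y' \<and> e \<in> support Y'"
    if "b \<in> support Y" "adj b c" "c \<notin> support Y" "adj c e" "b \<noteq> e" for b c e
    by (rule supp(3)[OF _ that]) (rule T.boundary)
  have conn: "T.conn (support Y)" by (rule T.indecomposable_conn[OF assms(4)])
  have conn': "T.conn (support Y')" by (rule T.indecomposable_conn[OF Y'i])
  have fin: "finite (support Y)" and ne: "support Y \<noteq> {}" using Y by (auto simp: valid_rep_def nonzero_rep_def support_def)
  obtain \<gamma> where g: "nb_list adj \<gamma>" "set \<gamma> \<subseteq> support Y"
    and max: "\<And>ys. nb_list adj ys \<Longrightarrow> set ys \<subseteq> support Y \<Longrightarrow> length ys \<le> length \<gamma>"
    using T.longest_exists[OF fin ne] by blast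
  have gne: "\<gamma> \<noteq> []" by (rule nb_list_not_Nil[OF g(1)])
  obtain c where c: "adj (last \<gamma>) c" "nb_list adj (\<gamma> @ [c])" by (rule T.extend[OF g(1)])
  obtain e where e: "adj c e" "nb_list adj (\<gamma> @ [c, e])" using T.extend[OF c(2)] by auto
  \<comment> \<open>\<open>extend\<close> lengthens a path at its last vertex, so the two vertices
    in front are added to the reversed list.\<close>
  have "nb_list adj (rev (\<gamma> @ [c, e]))" using e(2) by (simp only: T.nb_list_rev)
  from T.extend[OF this] obtain c' where c': "adj (hd \<gamma>) c'" "nb_list adj (rev (c' # \<gamma> @ [c, e]))"
    using gne by (auto simp: last_rev)
  from T.extend[OF c'(2)] obtain e' where e': "adj c' e'" "nb_list adj (rev (e' # c' # \<gamma> @ [c, e]))" by auto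
  define \<gamma>' where "\<gamma>' = e' # c' # \<gamma> @ [c, e]"
  have g': "nb_list adj \<gamma>'" using e'(2) unfolding \<gamma>'_def by (simp only: T.nb_list_rev)
  have ends: "hd \<gamma> \<in> support Y" "last \<gamma> \<in> support Y" using g(2) gne by auto
  \<comment> \<open>Otherwise appending c would give a longer path in the support of Y. So
    \<open>end_ext\<close> applies at this end, and in the same way at the other.\<close>
  have "c \<notin> support Y" using max[OF c(2)] g(2) by auto
  moreover have "last \<gamma> \<noteq> e"
  proof -
    obtain ys y where "\<gamma> = ys @ [y]" using gne by (cases \<gamma> rule: rev_cases) auto
    thus ?thesis using nb_list_suffix[of adj ys "[y, c, e]"] e(2) by simp
  qed
  ultimately have ce: "c \<in> support Y' \<and> e \<in> support Y'" using end_ext[OF ends(2) c(1) _ e(1)] by blast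
  have "nb_list adj (c' # \<gamma>)"
    using nb_list_prefix[of adj "c' # \<gamma>" "[c, e]"] nb_list_suffix[of adj "[e']" "c' # \<gamma> @ [c, e]"] g' unfolding \<gamma>'_def by simp
  hence "c' \<notin> support Y" using max[of "c' # \<gamma>"] g(2) by auto
  moreover have "hd \<gamma> \<noteq> e'" using g' gne unfolding \<gamma>'_def by (cases \<gamma>) auto
  ultimately have ce': "c' \<in> support Y' \<and> e' \<in> support Y'" using end_ext[OF ends(1) c'(1) _ e'(1)] by blast
  have sub': "set \<gamma>' \<subseteq> support Y'" unfolding \<gamma>'_def using ce ce' g(2) sub by auto
  \<comment> \<open>The upper bound L + 4 is attained by \<open>\<gamma>'\<close>, which has two new
    vertices at either end.\<close>
  have max': "length ys \<le> length \<gamma>'" if "nb_list adj ys" "set ys \<subseteq> support Y'" for ys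
    using T.near_path_length[OF conn max near that] by (simp add: \<gamma>'_def)
  note I = T.longest_path_invariants[OF assms(3) conn g]
  note I' = T.longest_path_invariants[OF assms(3) conn' g' sub']
  have diam: "diameter adj Y = plen \<gamma>" by (rule I(1)) (rule max)
  have diam': "diameter adj Y' = plen \<gamma>'" by (rule I'(1)) (rule max')
  have center: "center adj Y = path_center \<gamma>" by (rule I(2)) (rule max)
  have center': "center adj Y' = path_center \<gamma>'" by (rule I'(2)) (rule max')
  have sink: "sink_module adj sk Y \<longleftrightarrow> even (plen \<gamma>) \<and> sk (hd \<gamma>)" by (rule I(3)) (rule max)
  have sink': "sink_module adj sk Y' \<longleftrightarrow> even (plen \<gamma>') \<and> sk (hd \<gamma>')" by (rule I'(3)) (rule max')
  have source: "source_module adj sk Y \<longleftrightarrow> even (plen \<gamma>) \<and> \<not> sk (hd \<gamma>)" by (rule I(4)) (rule max)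
  have source': "source_module adj sk Y' \<longleftrightarrow> even (plen \<gamma>') \<and> \<not> sk (hd \<gamma>')" by (rule I'(4)) (rule max')
  \<comment> \<open>The length grows by 4 and indices move by 2: parity is kept, the middle stays at
    the same vertices, and the radius grows by 2.\<close>
  have plen': "plen \<gamma>' = plen \<gamma> + 4" using gne by (simp add: plen_def \<gamma>'_def Suc_diff_le)
  have shift: "\<gamma>' ! (k + 2) = \<gamma> ! k" if "k < length \<gamma>" for k using that by (simp add: \<gamma>'_def nth_append)
  have mid: "plen \<gamma>' div 2 = plen \<gamma> div 2 + 2" unfolding plen' by simp
  have pos: "length \<gamma> > 0" using gne by simp
  hence l1: "plen \<gamma> div 2 < length \<gamma>" unfolding plen_def by presburger
  have l2: "plen \<gamma> div 2 + 1 < length \<gamma>" if "odd (plen \<gamma>)" using that pos unfolding plen_def by presburger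
  have ctr: "path_center \<gamma>' = path_center \<gamma>"
  proof (cases "even (plen \<gamma>)")
    case True
    thus ?thesis unfolding path_center_def mid using shift[OF l1] by (simp add: plen')
  next
    case False
    have "\<gamma>' ! (plen \<gamma> div 2 + 2 + 1) = \<gamma> ! (plen \<gamma> div 2 + 1)" using shift[OF l2[OF False]] by (simp add: add.commute add.left_commute)
    thus ?thesis unfolding path_center_def mid using shift[OF l1] False by (simp add: plen')
  qed
  have "sk (hd \<gamma>) = sk (hd \<gamma>')"
  proof -
    \<comment> \<open>The start moves by two steps, so its type changes twice.\<close>
    have "sk (hd \<gamma>) \<longleftrightarrow> \<not> sk c'" "sk c' \<longleftrightarrow> \<not> sk e'" using B.bip c'(1) e'(1) by blast+
    thus ?thesis by (simp add: \<gamma>'_def)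
  qed
  thus ?thesis 
    unfolding flow_module_def radius_def diam diam' center center' sink sink' source source' ctr plen' by auto
qed

end
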